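(* Let $d\in\mathbb{N}$, let $H\colon \mathbb{T}^d\times\mathbb{R}^d\times\mathbb{R}^+\to\mathbb{R}$ satisfy the Monotonicity assumption and the Power-growth assumption with parameters $\alpha>1$, $\beta>0$ (both defined in the context). Let $\bar\beta=\beta+1$, $\bar\gamma=\alpha\frac{\beta+1}{\beta}$, and let $V\in L^{\bar\beta'}(\mathbb{T}^d)$, where $\bar\beta'=\bar\beta/(\bar\beta-1)$. Then there exists $(m,u)\in L^{\bar\beta}(\mathbb{T}^d)\times W^{1,\bar\gamma}(\mathbb{T}^d)$ that is a strong solution (as defined in the context) to the system $$\begin{cases}-u-H(x,Du,m)+V(x)=0,\\ m-\operatorname{div}(mD_pH(x,Du,m))-1=0\end{cases}\quad\text{in }\mathbb{T}^d.$$
   Context: Notation: $\mathbb{R}^+=(0,\infty)$, $\mathbb{R}^+_0=[0,\infty)$, $\mathbb{T}^d$ is the $d$-dimensional torus; the generic argument of $H$ is $(x,p,m)$ and $D_pH$ is the gradient in $p$. Regularity condition: $H$ is measurable and, for a.e. $x\in\mathbb{T}^d$, the maps $(p,m)\mapsto H(x,p,m)$ and $(p,m)\mapsto D_pH(x,p,m)$ are continuous on $\mathbb{R}^d\times\mathbb{R}^+$. Monotonicity assumption: $H$ satisfies the Regularity condition and, for a.e. $x\in\mathbb{T}^d$ and all $(p_1,m_1),(p_2,m_2)\in\mathbb{R}^d\times\mathbb{R}^+$, $$\big(-H(x,p_1,m_1)+H(x,p_2,m_2)\big)(m_1-m_2)+\big(m_1D_pH(x,p_1,m_1)-m_2D_pH(x,p_2,m_2)\big)\cdot(p_1-p_2)\geq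 0.$$ Power-growth assumption (with parameters $\alpha>1$, $\beta>0$): $H$ satisfies the Regularity condition and there is $C>0$ such that for a.e. $x\in\mathbb{T}^d$ and all $(p,m)\in\mathbb{R}^d\times\mathbb{R}^+$: $H(x,0,m)\leq-\frac1C m^\beta+C$; $|D_pH(x,p,m)|\leq C\big(|p|^{\alpha-1}+m^{\beta-\frac\beta\alpha}+1\big)$; $H(x,p,m)\geq\frac1C|p|^\alpha-C(m^\beta+1)$. Convention at $m=0$: by monotonicity, $H(x,p,\cdot)$ is nonincreasing, and $H(x,p,0):=\lim_{m\to0^+}H(x,p,m)\in\mathbb{R}\cup\{\infty\}$. The expression $mD_pH(x,p,m)$ at $m=0$ means $\lim_{m\to0^+}mD_pH(x,p,m)$, which exists (and equals $0$) under the power-growth assumption. Strong solution: $(m,u)\in L^1(\mathbb{T}^d)\times W^{1,1}(\mathbb{T}^d)$ with $m\geq0$ and $mD_pH(x,Du,m)\in L^1(\mathbb{T}^d;\mathbb{R}^d)$ such that (1) $u+H(x,Du,m)-V(x)\leq0$ a.e. in $\mathbb{T}^d$ and $u+H(x,Du,m)-V(x)=0$ a.e. in $\{m>0\}$; (2) $\int_{\mathbb{T}^d}\big[(m-1)\varphi+mD_pH(x,Du,m)\cdot D\varphi\big]\,dx=0$ for all $\varphi\in C^\infty(\mathbb{T}^d)$. On $\{m=0\}$ the expressions $H(x,Du,m)$ and $mD_pH(x,Du,m)$ are evaluated by the convention above. *)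

theory Defs
  imports "HOL-Analysis.Analysis"
begin

text \<open>
  Functions on the \<open>d\<close>-dimensional torus, \<open>d = CARD('n)\<close>, are represented by their lifts to
  \<open>\<real>\<^sup>d\<close>, i.e. by functions invariant under translation by vectors with integer entries.
  The measure of the torus is Lebesgue measure on the unit cube.
\<close>

definition periodic :: "(real^'n \<Rightarrow> 'b) \<Rightarrow> bool" where
  "periodic f \<longleftrightarrow> (\<forall>x z. (\<forall>i. z $ i \<in> \<int>) \<longrightarrow> f (x + z) = f x)"

abbreviation torus :: "(real^'n) measure" where
  "torus \<equiv> lebesgue_on (cbox 0 1)"

definition Lp_torus :: "real \<Rightarrow> (real^'n \<Rightarrow> 'b::euclidean_space) set" where
  "Lp_torus q = {f. periodic f \<and> f \<in> borel_measurable torus \<and>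
     integrable torus (\<lambda>x. norm (f x) powr q)}"

definition grad :: "(real^'n \<Rightarrow> real) \<Rightarrow> real^'n \<Rightarrow> real^'n" where
  "grad f x = (THE D. GDERIV f x :> D)"

text \<open>
  For \<open>C\<^sup>k\<close>, Frechet differentiability is required at each order; together with continuity of
  the partial derivatives this is the usual class, since existence and continuity of the partial
  derivatives implies Frechet differentiability.
\<close>

primrec Ck :: "nat \<Rightarrow> (real^'n \<Rightarrow> real) \<Rightarrow> bool" where
  "Ck 0 f \<longleftrightarrow> continuous_on UNIV f"
| "Ck (Suc k) f \<longleftrightarrow> f differentiable_on UNIV \<and> (\<forall>i. Ck k (\<lambda>x. grad f x $ i))"

definition Cinf_torus :: "(real^'n \<Rightarrow> real) set" where
  "Cinf_torus = {\<phi>. periodic \<phi> \<and> (\<forall>k. Ck k \<phi>)}"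

definition weak_gradient :: "(real^'n \<Rightarrow> real) \<Rightarrow> (real^'n \<Rightarrow> real^'n) \<Rightarrow> bool" where
  "weak_gradient u Du \<longleftrightarrow> u \<in> Lp_torus 1 \<and> Du \<in> Lp_torus 1 \<and>
     (\<forall>\<phi>\<in>Cinf_torus. \<forall>i.
        (LINT x|torus. u x * (grad \<phi> x $ i)) = - (LINT x|torus. (Du x $ i) * \<phi> x))"

definition W1p_torus :: "real \<Rightarrow> (real^'n \<Rightarrow> real) set" where
  "W1p_torus q = {u \<in> Lp_torus q. \<exists>Du \<in> Lp_torus q. weak_gradient u Du}"

text \<open>
  A Hamiltonian is a curried function \<open>H x p m\<close>; only its values at \<open>m > 0\<close> are ever used.
\<close>

abbreviation DpH :: "(real^'n \<Rightarrow> real^'n \<Rightarrow> real \<Rightarrow> real) \<Rightarrow> real^'n \<Rightarrow> real^'n \<Rightarrow> real \<Rightarrow> real^'n"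
  where "DpH H x p m \<equiv> grad (\<lambda>q. H x q m) p"

definition on_torus :: "(real^'n \<Rightarrow> real^'n \<Rightarrow> real \<Rightarrow> real) \<Rightarrow> bool" where
  "on_torus H \<longleftrightarrow> (\<forall>p. \<forall>m>0. periodic (\<lambda>x. H x p m))"

definition regularity :: "(real^'n \<Rightarrow> real^'n \<Rightarrow> real \<Rightarrow> real) \<Rightarrow> bool" where
  "regularity H \<longleftrightarrow>
     (\<lambda>(x, p, m). H x p m) \<in> borel_measurable (lebesgue_on (UNIV \<times> UNIV \<times> {0<..})) \<and>
     (AE x in torus.
        continuous_on (UNIV \<times> {0<..}) (\<lambda>(p, m). H x p m) \<and>
        (\<forall>m>0. (\<lambda>p. H x p m) differentiable_on UNIV) \<and>
        continuous_on (UNIV \<times> {0<..}) (\<lambda>(p, m). DpH H x p m))"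

definition monotonicity :: "(real^'n \<Rightarrow> real^'n \<Rightarrow> real \<Rightarrow> real) \<Rightarrow> bool" where
  "monotonicity H \<longleftrightarrow> regularity H \<and>
     (AE x in torus. \<forall>p1 p2. \<forall>m1>0. \<forall>m2>0.
        (- H x p1 m1 + H x p2 m2) * (m1 - m2)
        + (m1 *\<^sub>R DpH H x p1 m1 - m2 *\<^sub>R DpH H x p2 m2) \<bullet> (p1 - p2) \<ge> 0)"

definition power_growth ::
  "real \<Rightarrow> real \<Rightarrow> (real^'n \<Rightarrow> real^'n \<Rightarrow> real \<Rightarrow> real) \<Rightarrow> bool" where
  "power_growth \<alpha> \<beta> H \<longleftrightarrow> regularity H \<and>
     (\<exists>C>0. AE x in torus. \<forall>p. \<forall>m>0.
        H x 0 m \<le> - (1 / C) * m powr \<beta> + C \<and>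
        norm (DpH H x p m) \<le> C * (norm p powr (\<alpha> - 1) + m powr (\<beta> - \<beta> / \<alpha>) + 1) \<and>
        H x p m \<ge> (1 / C) * norm p powr \<alpha> - C * (m powr \<beta> + 1))"

text \<open>
  The values at \<open>m = 0\<close> are one-sided limits, which for \<open>H\<close> itself may be \<open>\<infinity>\<close>. The \<open>else\<close>
  branches are only relevant at \<open>m = 0\<close>, since densities are nonnegative almost everywhere.
\<close>

definition H_ext :: "(real^'n \<Rightarrow> real^'n \<Rightarrow> real \<Rightarrow> real) \<Rightarrow> real^'n \<Rightarrow> real^'n \<Rightarrow> real \<Rightarrow> ereal" where
  "H_ext H x p m =
     (if m > 0 then ereal (H x p m) else Lim (at_right 0) (\<lambda>s. ereal (H x p s)))"

definition mDpH_ext ::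
  "(real^'n \<Rightarrow> real^'n \<Rightarrow> real \<Rightarrow> real) \<Rightarrow> real^'n \<Rightarrow> real^'n \<Rightarrow> real \<Rightarrow> real^'n" where
  "mDpH_ext H x p m =
     (if m > 0 then m *\<^sub>R DpH H x p m else Lim (at_right 0) (\<lambda>s. s *\<^sub>R DpH H x p s))"

text \<open>
  The weak gradient \<open>Du\<close> is unique up to null sets, so quantifying it existentially
  does not depend on the representative.
\<close>

definition strong_solution ::
  "(real^'n \<Rightarrow> real^'n \<Rightarrow> real \<Rightarrow> real) \<Rightarrow> (real^'n \<Rightarrow> real)
    \<Rightarrow> (real^'n \<Rightarrow> real) \<Rightarrow> (real^'n \<Rightarrow> real) \<Rightarrow> bool" where
  "strong_solution H V m u \<longleftrightarrow>
     m \<in> Lp_torus 1 \<and> u \<in> W1p_torus 1 \<and> (AE x in torus. m x \<ge> 0) \<and>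
     (\<exists>Du. weak_gradient u Du \<and>
        (\<lambda>x. mDpH_ext H x (Du x) (m x)) \<in> Lp_torus 1 \<and>
        (AE x in torus. ereal (u x) + H_ext H x (Du x) (m x) - ereal (V x) \<le> 0) \<and>
        (AE x in torus. m x > 0 \<longrightarrow>
           ereal (u x) + H_ext H x (Du x) (m x) - ereal (V x) = 0) \<and>
        (\<forall>\<phi>\<in>Cinf_torus.
           (LINT x|torus. (m x - 1) * \<phi> x + mDpH_ext H x (Du x) (m x) \<bullet> grad \<phi> x) = 0))"

end

theory Submission
  imports Defs "HOL-Probability.Probability_Measure"
begin

text \<open>
  The system is the variational inequality of a monotone operator on the convex cone of pairs
  \<open>(m, u)\<close> with \<open>m \<ge> 0\<close> in \<open>L\<^sup>p \<times> W\<^sup>1\<^sup>,\<^sup>r\<close>, \<open>p = \<beta> + 1\<close>, \<open>r = \<alpha> (\<beta> + 1) / \<beta>\<close>: varying \<open>u\<close> yields the transport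
  equation, varying \<open>m\<close> yields the complementarity form of the Hamilton-Jacobi equation. On the
  part of the cone with all norms at most \<open>R\<close>, Minty's form of the inequality defines a family of
  half-spaces. Finitely many of them intersect because a matrix whose symmetric part is nonnegative
  has a nonnegative mixed strategy, and then all of them intersect by uniform convexity of the
  norms. Letting the test function tend to the solution along segments turns Minty's inequality
  into the variational inequality. Finally, testing with \<open>(1, 0)\<close> bounds \<open>m\<close>; the inequality
  \<open>u + H \<le> V\<close> thereby gained, the lower bound of \<open>H\<close> and Poincare's inequality bound \<open>u\<close> and its
  gradient. These bounds do not depend on \<open>R\<close>, so for large \<open>R\<close> the constraints are inactive.
\<close>

section \<open>A matrix game and intersections of convex sets\<close>

text \<open>The obstacle is that testing bounds the mass but not the gradient in the power
  \<open>\<gamma>\<close>, because the flux vanishes together with the density. The gradient is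
  reached through \<open>u + H \<le> V\<close>, which becomes available once the mass constraint is
  known to be inactive; this dictates the order mass, sign of the residual, mean of
  \<open>u\<close>, gradient. Minty's form is preferred because, for a fixed test state, it is
  affine and continuous in the unknown, so it cuts out closed convex sets; the variational
  inequality itself does not. On such sets, strong convergence of almost norm-minimal points takes
  the place of weak compactness. Test states in Minty's form have strictly positive mass, since
  monotonicity is assumed for \<open>m > 0\<close> only. Positivity is removed afterwards by mixing
  in the constant state \<open>(1, 0, 0)\<close>. The exponents fit the growth: with
  \<open>m\<close> in the power \<open>\<beta> + 1\<close> and \<open>Du\<close> in the power
  \<open>\<gamma>\<close>, both \<open>m powr \<beta>\<close> and
  \<open>norm Du powr \<alpha>\<close> are integrable to the power
  \<open>(\<beta> + 1) / \<beta>\<close>, which is dual to the masses. Every product in the pairing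
  is therefore integrable.\<close>

lemma skew_dominated_matrix_game:
  fixes B :: "'w \<Rightarrow> 'w \<Rightarrow> real"
  assumes fin: "finite I" and ne: "I \<noteq> {}"
    and B: "\<And>i j. i \<in> I \<Longrightarrow> j \<in> I \<Longrightarrow> B i j + B j i \<ge> 0"
  obtains l where "\<And>i. l i \<ge> 0" "sum l I = 1" "\<And>j. j \<in> I \<Longrightarrow> (\<Sum>i\<in>I. l i * B j i) \<ge> 0"
proof -
  \<comment> \<open>Symmetric games have value zero, so only the skew part \<open>S\<close> is
    solved. The symmetric part of \<open>B\<close> is entrywise nonnegative, hence \<open>B\<close>
    dominates \<open>S\<close> and the strategy found for \<open>S\<close> also serves
    \<open>B\<close>.\<close>
  define S where "S j i = (B j i - B i j) / 2" for i j
  have skew: "S i j = - S j i" for i j by (simp add: S_def field_simps)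
  \<comment> \<open>The index type may be infinite. Pinning the coordinates outside \<open>I\<close>
    to \<open>0\<close> makes the simplex compact in the product topology.\<close>
  define X where "X = PiE UNIV (\<lambda>i. if i \<in> I then {0..1::real} else {0}) \<inter> {l. sum l I = 1}"
  \<comment> \<open>Squared distance of the payoff vector from the nonnegative orthant. A minimiser
    is shown to make it zero.\<close>
  define f where "f l = (\<Sum>j\<in>I. (min 0 (\<Sum>i\<in>I. l i * S j i))^2)" for l
  have "compact (PiE UNIV (\<lambda>i. if i \<in> I then {0..1::real} else {0}))"
    unfolding compactin_euclidean_iff[symmetric] euclidean_product_topology[symmetric]
    by (subst compactin_PiE) auto
  moreover have "closed {l. sum l I = (1::real)}"
    by (intro closed_Collect_eq continuous_intros continuous_on_product_coordinates)
  ultimately have cX: "compact X" unfolding X_def by (rule compact_Int_closed)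
  obtain a where a: "a \<in> I" using ne by auto
  have "(\<lambda>i. if i = a then 1 else 0) \<in> X"
    using a fin unfolding X_def by (auto simp: PiE_def)
  hence neX: "X \<noteq> {}" by blast
  have "continuous_on X f" unfolding f_def
    by (intro continuous_intros continuous_on_product_coordinates[THEN continuous_on_subset] subset_UNIV)
  then obtain l where lX: "l \<in> X" and lmin: "\<And>y. y \<in> X \<Longrightarrow> f l \<le> f y"
    using continuous_attains_inf[OF cX neX] by blast
  have l0: "l i \<ge> 0" for i using lX unfolding X_def PiE_def Pi_def by (cases "i \<in> I") (auto dest: spec[of _ i])
  have l1: "sum l I = 1" using lX by (auto simp: X_def)
  have lout: "i \<notin> I \<Longrightarrow> l i = 0" for i using lX unfolding X_def PiE_def Pi_def by (auto dest: spec[of _ i])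
  define s where "s j = (\<Sum>i\<in>I. l i * S j i)" for j
  define r where "r j = (if j \<in> I then - min 0 (s j) else 0)" for j
  have r0: "r j \<ge> 0" for j by (simp add: r_def)
  define R where "R = sum r I"
  \<comment> \<open>Otherwise the shortfalls, normalised to \<open>r / R\<close>, are themselves a
    strategy. By skewness the payoff of that strategy is orthogonal to \<open>r\<close>, so a short
    move from \<open>l\<close> towards it decreases \<open>f\<close>, against minimality.\<close>
  have "R = 0"
  proof (rule ccontr)
    assume "R \<noteq> 0"
    hence Rp: "R > 0" using sum_nonneg[of I r] r0 by (auto simp: R_def less_le)
    \<comment> \<open>Rate of change of the payoffs \<open>s\<close> along the segment from
      \<open>l\<close> to \<open>r / R\<close>.\<close>
    define c where "c j = (\<Sum>i\<in>I. r i * S j i) / R - s j" for j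
    have key: "(\<Sum>j\<in>I. r j * c j) = (\<Sum>j\<in>I. (r j)^2)"
    proof -
      define Z where "Z = (\<Sum>j\<in>I. \<Sum>i\<in>I. r j * (r i * S j i))"
      have "Z = (\<Sum>i\<in>I. \<Sum>j\<in>I. r j * (r i * S j i))"
        unfolding Z_def by (rule sum.swap)
      also have "\<dots> = (\<Sum>i\<in>I. \<Sum>j\<in>I. - (r i * (r j * S i j)))"
      proof (intro sum.cong refl)
        fix i j show "r j * (r i * S j i) = - (r i * (r j * S i j))"
          using skew[of j i] by simp
      qed
      also have "\<dots> = - Z" by (simp only: sum_negf Z_def)
      finally have 0: "Z = 0" by simp
      have rs: "r j * s j = - ((r j)^2)" if "j \<in> I" for j
        using that by (auto simp: r_def min_def power2_eq_square)
      have "(\<Sum>j\<in>I. r j * c j) = Z / R - (\<Sum>j\<in>I. r j * s j)"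
        by (simp add: c_def Z_def right_diff_distrib sum_subtractf sum_distrib_left sum_divide_distrib)
      also have "(\<Sum>j\<in>I. r j * s j) = (\<Sum>j\<in>I. - ((r j)^2))" using rs by (intro sum.cong) auto
      finally show ?thesis unfolding 0 by (simp add: sum_negf)
    qed
    obtain b where b: "b \<in> I" "r b \<noteq> 0" using Rp sum.neutral[of I r] unfolding R_def by (metis less_irrefl)
    have pos: "(\<Sum>j\<in>I. (r j)^2) > 0"
      using b fin by (intro sum_pos2[of I b]) auto
    define A where "A = (\<Sum>j\<in>I. (r j)^2)"
    define Q where "Q = (\<Sum>j\<in>I. (c j)^2)"
    have Q0: "Q \<ge> 0" by (simp add: Q_def sum_nonneg)
    have A0: "A > 0" using pos by (simp add: A_def)
    \<comment> \<open>After the move \<open>f\<close> is at most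
      \<open>A - 2 * t * A + t^2 * Q\<close>, which is below \<open>A\<close> as soon as
      \<open>0 < t\<close> and \<open>t * Q < 2 * A\<close>. The \<open>+ 1\<close> guards against
      \<open>Q = 0\<close>.\<close>
    define t where "t = min 1 (A / (Q + 1))"
    have t: "t > 0" "t \<le> 1" "t * Q < 2 * A"
    proof -
      show "t > 0" "t \<le> 1" using A0 Q0 by (auto simp: t_def)
      have "t * Q \<le> A / (Q+1) * Q" using Q0 by (intro mult_right_mono) (auto simp: t_def)
      also have "\<dots> \<le> A" using Q0 A0 by (simp add: field_simps)
      finally show "t * Q < 2 * A" using A0 by simp
    qed
    define y where "y i = (1 - t) * l i + t * (r i / R)" for i
    have y1: "sum y I = 1" 
      using Rp l1 by (simp add: y_def sum.distrib sum_distrib_left[symmetric] sum_divide_distrib[symmetric] R_def[symmetric])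
    have y0: "y i \<ge> 0" for i using t l0 r0 Rp by (simp add: y_def)
    have "y i \<le> 1" if "i \<in> I" for i
      using y1 y0 member_le_sum[of i I y] fin that by auto
    moreover have "y i = 0" if "i \<notin> I" for i using that lout by (simp add: y_def r_def)
    ultimately have yX: "y \<in> X" using y1 y0 by (auto simp: X_def PiE_def)
    have "f y \<le> (\<Sum>j\<in>I. (- r j + t * c j)^2)"
      unfolding f_def
    proof (rule sum_mono)
      fix j assume j: "j \<in> I"
      have "(\<Sum>i\<in>I. y i * S j i) = s j + t * c j"
      proof -
        have "(\<Sum>i\<in>I. y i * S j i) = (\<Sum>i\<in>I. (1 - t) * (l i * S j i) + t / R * (r i * S j i))"
          by (intro sum.cong refl) (simp add: y_def algebra_simps)
        also have "\<dots> = (1 - t) * s j + t / R * (\<Sum>i\<in>I. r i * S j i)"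
          by (simp only: sum.distrib s_def sum_distrib_left)
        finally show ?thesis by (simp add: c_def algebra_simps)
      qed
      moreover have "s j \<ge> - r j" using j by (simp add: r_def)
      ultimately have "(\<Sum>i\<in>I. y i * S j i) \<ge> - r j + t * c j" by simp
      hence "\<bar>min 0 (\<Sum>i\<in>I. y i * S j i)\<bar> \<le> \<bar>- r j + t * c j\<bar>" by linarith
      thus "(min 0 (\<Sum>i\<in>I. y i * S j i))^2 \<le> (- r j + t * c j)^2" by (simp only: abs_le_square_iff)
    qed
    also have "\<dots> = A - 2 * t * A + t^2 * Q"
    proof -
      have "(\<Sum>j\<in>I. (- r j + t * c j)^2) = (\<Sum>j\<in>I. (r j)^2 - 2 * t * (r j * c j) + t^2 * (c j)^2)"
        by (intro sum.cong refl) (simp add: power2_eq_square algebra_simps)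
      also have "\<dots> = A - 2 * t * A + t^2 * Q"
        using key by (simp add: sum.distrib sum_subtractf sum_distrib_left[symmetric] A_def Q_def)
      finally show ?thesis .
    qed
    also have "\<dots> < A"
    proof -
      have "t * (t * Q) < t * (2 * A)" using t by (intro mult_strict_left_mono) auto
      thus ?thesis by (simp add: power2_eq_square algebra_simps)
    qed
    also have "A = f l" unfolding A_def f_def by (intro sum.cong) (auto simp: r_def s_def)
    finally show False using lmin[OF yX] by simp
  qed
  hence "r j = 0" if "j \<in> I" for j
    using that fin r0 by (simp add: R_def sum_nonneg_eq_0_iff)
  hence s0: "s j \<ge> 0" if "j \<in> I" for j using that by (force simp: r_def min_def split: if_splits)
  have "(\<Sum>i\<in>I. l i * B j i) \<ge> 0" if j: "j \<in> I" for j
  proof -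
    have "s j \<le> (\<Sum>i\<in>I. l i * B j i)" unfolding s_def
    proof (intro sum_mono mult_left_mono l0)
      fix i assume "i \<in> I" thus "S j i \<le> B j i" using B[of i j] j by (simp add: S_def field_simps)
    qed
    thus ?thesis using s0[OF j] by simp
  qed
  thus thesis using that l0 l1 by blast
qed

text \<open>The infimum of \<open>\<Phi>\<close> over the points that satisfy finitely many
  constraints grows with the constraints and stays below \<open>B\<close>. Along finite families
  that nearly exhaust the supremum of these infima, almost minimal points have almost no convexity
  gap and so form a Cauchy sequence. The factor \<open>T\<close> in the triangle inequality is there
  because \<open>D\<close> will be a sum of powers of norms, taken without roots.\<close>

lemma uniformly_convex_intersection:
  fixes \<Phi> :: "'z \<Rightarrow> real" and mid :: "'z \<Rightarrow> 'z \<Rightarrow> 'z" and D :: "'z \<Rightarrow> 'z \<Rightarrow> real"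
  assumes bounds: "\<And>a. a \<in> K \<Longrightarrow> 0 \<le> \<Phi> a \<and> \<Phi> a \<le> B"
    and midK: "\<And>a b. a \<in> K \<Longrightarrow> b \<in> K \<Longrightarrow> mid a b \<in> K"
    and midP: "\<And>a b w. a \<in> K \<Longrightarrow> b \<in> K \<Longrightarrow> w \<in> W \<Longrightarrow> P w a \<Longrightarrow> P w b \<Longrightarrow> P w (mid a b)"
    and fip: "\<And>F. finite F \<Longrightarrow> F \<subseteq> W \<Longrightarrow> \<exists>z\<in>K. \<forall>w\<in>F. P w z"
    and uc: "\<And>\<epsilon>. \<epsilon> > 0 \<Longrightarrow> \<exists>\<delta>>0. \<forall>a\<in>K. \<forall>b\<in>K. \<Phi> a + \<Phi> b - 2 * \<Phi> (mid a b) < \<delta> \<longrightarrow> D a b < \<epsilon>"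
    and complete: "\<And>z. (\<And>n. z n \<in> K) \<Longrightarrow> (\<And>\<epsilon>. \<epsilon> > 0 \<Longrightarrow> \<exists>N. \<forall>m\<ge>N. \<forall>n\<ge>N. D (z m) (z n) < \<epsilon>)
        \<Longrightarrow> \<exists>y\<in>K. (\<lambda>n. D (z n) y) \<longlonglongrightarrow> 0"
    and D0: "\<And>a b. D a b \<ge> 0"
    and tri: "\<And>a b c. a \<in> K \<Longrightarrow> b \<in> K \<Longrightarrow> c \<in> K \<Longrightarrow> D a c \<le> T * (D a b + D b c)"
    and closedP: "\<And>w z y. w \<in> W \<Longrightarrow> (\<And>n. z n \<in> K \<and> P w (z n)) \<Longrightarrow> y \<in> K \<Longrightarrow> (\<lambda>n. D (z n) y) \<longlonglongrightarrow> 0 \<Longrightarrow> P w y"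
  shows "\<exists>z\<in>K. \<forall>w\<in>W. P w z"
proof -
  define C where "C F = {z\<in>K. \<forall>w\<in>F. P w z}" for F
  define J where "J F = Inf (\<Phi> ` C F)" for F
  define FF where "FF = {F. finite F \<and> F \<subseteq> W}"
  have CF: "C F \<noteq> {}" if "F \<in> FF" for F using fip[of F] that by (auto simp: C_def FF_def)
  have bdd: "bdd_below (\<Phi> ` C F)" for F using bounds by (intro bdd_belowI[of _ 0]) (auto simp: C_def)
  have J_le: "J F \<le> \<Phi> z" if "z \<in> C F" for F z
    unfolding J_def using bdd that by (intro cInf_lower) auto
  have JB: "J F \<le> B" if F: "F \<in> FF" for F
  proof -
    obtain z where z: "z \<in> C F" using CF[OF F] by auto
    have "\<Phi> z \<le> B" using z bounds by (auto simp: C_def)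
    thus ?thesis using J_le[OF z] by simp
  qed
  have Jmono: "J F \<le> J G" if "F \<subseteq> G" "G \<in> FF" for F G
    unfolding J_def using CF[OF that(2)] that(1) bdd
    by (intro cInf_superset_mono image_mono) (auto simp: C_def)
  have near: "\<exists>z\<in>C F. \<Phi> z < J F + e" if "F \<in> FF" "e > 0" for F e
  proof -
    have "Inf (\<Phi> ` C F) < J F + e" using that by (simp add: J_def)
    thus ?thesis using CF[OF that(1)] bdd[of F] by (subst (asm) cInf_less_iff) auto
  qed
  define s where "s = Sup (J ` FF)"
  have bddJ: "bdd_above (J ` FF)" using JB by (intro bdd_aboveI[of _ B]) auto
  have neFF: "{} \<in> FF" by (simp add: FF_def)
  have Js: "J F \<le> s" if "F \<in> FF" for F unfolding s_def using bddJ that by (intro cSup_upper) auto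
  have "\<exists>F\<in>FF. J F > s - e" if "e > 0" for e
  proof -
    have "s - e < Sup (J ` FF)" using that by (simp add: s_def)
    thus ?thesis using neFF bddJ by (subst (asm) less_cSup_iff) auto
  qed
  hence "\<forall>n. \<exists>F\<in>FF. J F > s - 1 / real (Suc n)" by simp
  then obtain F where F: "\<And>n. F n \<in> FF" "\<And>n. J (F n) > s - 1 / real (Suc n)" by metis
  \<comment> \<open>Unions make the families increase, so that every later point also satisfies the
    earlier constraints.\<close>
  define G where "G n = (\<Union>k\<le>n. F k)" for n
  have G: "G n \<in> FF" for n using F(1) by (auto simp: G_def FF_def)
  have Gm: "G m \<subseteq> G n" if "m \<le> n" for m n using that by (fastforce simp: G_def)
  have JG: "J (G n) > s - 1 / real (Suc n)" for n
  proof -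
    have "F n \<subseteq> G n" by (auto simp: G_def)
    from Jmono[OF this G] F(2)[of n] show ?thesis by linarith
  qed
  have pick: "\<exists>z\<in>C F'. \<Phi> z < s + 1 / real (Suc n)" if "F' \<in> FF" for F' n
    using near[OF that, of "1 / real (Suc n)"] Js[OF that] by force
  have "\<exists>z. \<forall>n. z n \<in> C (G n) \<and> \<Phi> (z n) < s + 1 / real (Suc n)"
    using pick[OF G] by (intro choice) blast
  then obtain z where z: "\<And>n. z n \<in> C (G n)" "\<And>n. \<Phi> (z n) < s + 1 / real (Suc n)" by blast
  \<comment> \<open>Both values are below \<open>s + 1 / real (Suc n)\<close>. The midpoint is
    feasible for \<open>G n\<close>, so its value exceeds \<open>s - 1 / real (Suc n)\<close>; the
    four error terms add up.\<close>
  have gap: "\<Phi> a + \<Phi> b - 2 * \<Phi> (mid a b) < 4 / real (Suc n)"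
    if "a \<in> C (G n)" "b \<in> C (G n)" "\<Phi> a < s + 1 / real (Suc n)" "\<Phi> b < s + 1 / real (Suc n)" for a b n
  proof -
    have "G n \<subseteq> W" using G by (auto simp: FF_def)
    hence "mid a b \<in> C (G n)" using that(1,2) midK midP unfolding C_def by blast
    moreover have "4 / real (Suc n) = 4 * (1 / real (Suc n))" by simp
    ultimately show ?thesis using J_le JG[of n] that(3,4) by (smt (verit))
  qed
  have anti: "C H \<subseteq> C H'" if "H' \<subseteq> H" for H H' using that by (auto simp: C_def)
  have zin: "z m \<in> C (G n)" if "n \<le> m" for m n using z(1)[of m] anti[OF Gm[OF that]] by auto
  have le: "1 / real (Suc m) \<le> 1 / real (Suc n)" if "n \<le> m" for m n using that by (simp add: frac_le)
  have small: "\<exists>N. \<forall>n\<ge>N. 4 / real (Suc n) < \<delta>" if d: "\<delta> > 0" for \<delta>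
  proof -
    obtain N where N: "4 / \<delta> < real N" using reals_Archimedean2 by blast
    have "4 / real (Suc n) < \<delta>" if "n \<ge> N" for n
    proof -
      have "4 / \<delta> < real (Suc n)" using N that by linarith
      thus ?thesis using d by (simp add: field_simps)
    qed
    thus ?thesis by blast
  qed
  have zK: "z n \<in> K" for n using z(1) by (auto simp: C_def)
  have "\<exists>y\<in>K. (\<lambda>n. D (z n) y) \<longlonglongrightarrow> 0"
  proof (rule complete[OF zK])
    fix e :: real assume "e > 0"
    from uc[OF this] obtain d where d: "d > 0" "\<And>a b. a \<in> K \<Longrightarrow> b \<in> K \<Longrightarrow> \<Phi> a + \<Phi> b - 2 * \<Phi> (mid a b) < d \<Longrightarrow> D a b < e" by blast
    obtain N where N: "\<forall>n\<ge>N. 4 / real (Suc n) < d" using small[OF d(1)] by blast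
    show "\<exists>N. \<forall>m\<ge>N. \<forall>n\<ge>N. D (z m) (z n) < e"
    proof (intro exI allI impI)
      fix m n assume mn: "N \<le> m" "N \<le> n"
      have "\<Phi> (z m) < s + 1 / real (Suc N)" "\<Phi> (z n) < s + 1 / real (Suc N)"
        using z(2)[of m] z(2)[of n] le[OF mn(1)] le[OF mn(2)] by linarith+
      from gap[OF zin[OF mn(1)] zin[OF mn(2)] this] N have "\<Phi> (z m) + \<Phi> (z n) - 2 * \<Phi> (mid (z m) (z n)) < d" by force
      thus "D (z m) (z n) < e" using d(2) zK by blast
    qed
  qed
  then obtain y where y: "y \<in> K" "(\<lambda>n. D (z n) y) \<longlonglongrightarrow> 0" by blast
  \<comment> \<open>The point \<open>y\<close> was fixed before \<open>w\<close>. Almost minimal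
    points that satisfy \<open>w\<close> in addition are still feasible for \<open>G n\<close>, so
    the same gap estimate drives them to \<open>z n\<close>, hence to the same limit
    \<open>y\<close>.\<close>
  have "P w y" if w: "w \<in> W" for w
  proof -
    have "insert w (G n) \<in> FF" for n using G[of n] w by (auto simp: FF_def)
    hence "\<exists>z. \<forall>n. z n \<in> C (insert w (G n)) \<and> \<Phi> (z n) < s + 1 / real (Suc n)"
      using pick by (intro choice) blast
    then obtain z' where z': "\<And>n. z' n \<in> C (insert w (G n))" "\<And>n. \<Phi> (z' n) < s + 1 / real (Suc n)" by blast
    have z'G: "z' n \<in> C (G n)" for n using z'(1)[of n] anti[of "G n" "insert w (G n)"] by auto
    have z'K: "z' n \<in> K" and Pz': "P w (z' n)" for n using z'(1)[of n] by (auto simp: C_def)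
    have "(\<lambda>n. D (z' n) (z n)) \<longlonglongrightarrow> 0"
    proof (rule LIMSEQ_I)
      fix e :: real assume "e > 0"
      from uc[OF this] obtain d where d: "d > 0" "\<And>a b. a \<in> K \<Longrightarrow> b \<in> K \<Longrightarrow> \<Phi> a + \<Phi> b - 2 * \<Phi> (mid a b) < d \<Longrightarrow> D a b < e" by blast
      obtain N where N: "\<forall>n\<ge>N. 4 / real (Suc n) < d" using small[OF d(1)] by blast
      show "\<exists>N. \<forall>n\<ge>N. norm (D (z' n) (z n) - 0) < e"
      proof (intro exI allI impI)
        fix n assume n: "N \<le> n"
        have "\<Phi> (z' n) + \<Phi> (z n) - 2 * \<Phi> (mid (z' n) (z n)) < 4 / real (Suc n)"
          by (rule gap[OF z'G z(1) z'(2) z(2)])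
        also have "\<dots> < d" using N n by blast
        finally have "\<Phi> (z' n) + \<Phi> (z n) - 2 * \<Phi> (mid (z' n) (z n)) < d" .
        thus "norm (D (z' n) (z n) - 0) < e" using d(2)[OF z'K zK] D0 by simp
      qed
    qed
    hence "(\<lambda>n. T * (D (z' n) (z n) + D (z n) y)) \<longlonglongrightarrow> T * (0 + 0)"
      using y(2) by (intro tendsto_intros)
    hence "(\<lambda>n. T * (D (z' n) (z n) + D (z n) y)) \<longlonglongrightarrow> 0" by simp
    hence "(\<lambda>n. D (z' n) y) \<longlonglongrightarrow> 0"
      by (rule Lim_null_comparison[rotated]) (use D0 tri[OF z'K zK y(1)] in auto)
    thus ?thesis using closedP[OF w _ y(1)] z'K Pz' by blast
  qed
  thus ?thesis using y(1) by blast
qed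

section \<open>Convexity of powers of norms\<close>

lemma powr_midpoint_strict_convex:
  fixes p s t :: real
  assumes p: "p > 1" and "s \<ge> 0" "t \<ge> 0" "s \<noteq> t"
  shows "((s + t) / 2) powr p < (s powr p + t powr p) / 2"
proof -
  have *: "((s + t) / 2) powr p < (s powr p + t powr p) / 2" if st: "0 \<le> s" "s < t" for s t :: real
  proof -
    define m where "m = (s + t) / 2"
    have m: "s < m" "m < t" "m > 0" using st by (auto simp: m_def)
    \<comment> \<open>The mean value theorem asks for a derivative only inside the interval, which
      admits the endpoint \<open>0\<close>. The increments over the two halves are then compared
      through the strictly increasing derivative.\<close>
    have mvt: "\<exists>x. a < x \<and> x < b \<and> b powr p - a powr p = (b - a) * (p * x powr (p - 1))"
      if ab: "0 \<le> a" "a < b" for a b :: real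
    proof -
      have cont: "continuous_on {a..b} (\<lambda>x. x powr p)"
        using ab p by (intro continuous_on_powr' continuous_intros) auto
      have der: "((\<lambda>x. x powr p) has_real_derivative p * x powr (p - 1)) (at x)" if "a < x" for x
        using that ab by (intro has_real_derivative_powr) auto
      have "\<And>x. a < x \<Longrightarrow> x < b \<Longrightarrow> (\<lambda>x. x powr p) differentiable (at x)"
        using der by (auto simp: real_differentiable_def)
      from MVT[OF ab(2) cont this] obtain l x where x: "a < x" "x < b"
        "((\<lambda>x. x powr p) has_real_derivative l) (at x)" "b powr p - a powr p = (b - a) * l" by blast
      from DERIV_unique[OF x(3) der[OF x(1)]] x show ?thesis by blast
    qed
    obtain x where x: "s < x" "x < m" "m powr p - s powr p = (m - s) * (p * x powr (p - 1))"
      using mvt[OF st(1) m(1)] by blast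
    obtain y where y: "m < y" "y < t" "t powr p - m powr p = (t - m) * (p * y powr (p - 1))"
      using mvt[of m t] m by auto
    define l k where "l = p * x powr (p - 1)" and "k = p * y powr (p - 1)"
    have "l < k" unfolding l_def k_def using p x y st by (intro mult_strict_left_mono powr_less_mono2) auto
    hence "(m - s) * l < (m - s) * k" using m by simp
    also have ms: "m - s = t - m" by (simp add: m_def field_simps)
    finally have "m powr p - s powr p < t powr p - m powr p" using x(3) y(3) ms by (simp add: l_def k_def)
    thus ?thesis by (simp add: m_def)
  qed
  show ?thesis using *[of s t] *[of t s] assms by (cases "s < t") (auto simp: add.commute)
qed

lemma norm_powr_midpoint_le:
  fixes a b :: "'a::real_normed_vector"
  assumes "p > 1"
  shows "2 * norm ((1/2) *\<^sub>R (a + b)) powr p \<le> norm a powr p + norm b powr p"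
proof -
  have "norm ((1/2) *\<^sub>R (a + b)) powr p \<le> ((norm a + norm b) / 2) powr p"
    using norm_triangle_ineq[of a b] assms by (intro powr_mono2) auto
  also have "\<dots> \<le> (norm a powr p + norm b powr p) / 2"
    using powr_midpoint_strict_convex[OF assms, of "norm a" "norm b"] by (cases "norm a = norm b") auto
  finally show ?thesis by simp
qed

text \<open>Strictness has two sources: for equal norms the triangle inequality is strict in an
  inner product space, for different norms the power itself is strictly convex.\<close>

lemma norm_powr_midpoint_less:
  fixes a b :: "'a::real_inner"
  assumes p: "p > 1" and "a \<noteq> b"
  shows "2 * norm ((1/2) *\<^sub>R (a + b)) powr p < norm a powr p + norm b powr p"
proof (cases "norm a = norm b")
  case True
  have "norm (a + b) < norm a + norm b"
  proof (rule ccontr)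
    assume "\<not> ?thesis"
    hence "norm (a + b) = norm a + norm b" using norm_triangle_ineq[of a b] by linarith
    hence "norm a *\<^sub>R b = norm b *\<^sub>R a" by (simp add: norm_triangle_eq)
    thus False using True assms by (cases "norm a = 0") auto
  qed
  hence "norm ((1/2) *\<^sub>R (a + b)) < norm a" using True by simp
  hence "norm ((1/2) *\<^sub>R (a + b)) powr p < norm a powr p" using p by (intro powr_less_mono2) auto
  thus ?thesis using True by simp
next
  case False
  have "norm ((1/2) *\<^sub>R (a + b)) powr p \<le> ((norm a + norm b) / 2) powr p"
    using norm_triangle_ineq[of a b] assms by (intro powr_mono2) auto
  also have "\<dots> < (norm a powr p + norm b powr p) / 2"
    using powr_midpoint_strict_convex[OF p, of "norm a" "norm b"] False by auto
  finally show ?thesis by simp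
qed

text \<open>
  This replaces Clarkson's inequalities: by homogeneity the quotient only has to be bounded
  on a compact set, where strict convexity keeps the convexity defect away from zero.
\<close>

lemma norm_powr_uniformly_convex:
  fixes p \<delta> :: real
  assumes p: "p > 1" and \<delta>: "\<delta> > 0"
  obtains C where "C > 0" "\<And>a b :: 'a::euclidean_space.
    norm (a - b) powr p \<le> \<delta> * (norm a powr p + norm b powr p)
      + C * (norm a powr p + norm b powr p - 2 * norm ((1/2) *\<^sub>R (a + b)) powr p)"
proof -
  define N where "N ab = norm (fst ab) powr p + norm (snd ab) powr p" for ab :: "'a \<times> 'a"
  define g where "g ab = N ab - 2 * norm ((1/2) *\<^sub>R (fst ab + snd ab)) powr p" for ab
  \<comment> \<open>The normalised pairs whose distance the \<open>\<delta>\<close> term cannot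
    absorb. The normalisation bounds the set, and \<open>\<delta> > 0\<close> keeps it away from the
    diagonal, where the defect \<open>g\<close> vanishes.\<close>
  define S where "S = {ab :: 'a \<times> 'a. N ab = 1 \<and> norm (fst ab - snd ab) powr p \<ge> \<delta>}"
  have cN: "continuous_on UNIV N" unfolding N_def using p by (intro continuous_intros continuous_on_powr') auto
  have cg: "continuous_on UNIV g" unfolding g_def using p by (intro continuous_intros cN continuous_on_powr') auto
  have g0: "g ab \<ge> 0" for ab using norm_powr_midpoint_le[OF p] by (simp add: g_def N_def)
  have le1: "s \<le> 1" if "s \<ge> 0" "s powr p \<le> 1" for s :: real
  proof (rule ccontr)
    assume "\<not> s \<le> 1"
    hence "1 powr p < s powr p" using p by (intro powr_less_mono2) auto
    thus False using that by simp
  qed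
  have nle: "norm (fst ab) \<le> 1 \<and> norm (snd ab) \<le> 1" if "N ab = 1" for ab
    using that le1[of "norm (fst ab)"] le1[of "norm (snd ab)"] powr_ge_zero[of "norm (fst ab)" p] powr_ge_zero[of "norm (snd ab)" p]
    unfolding N_def by auto
  have "bounded S"
  proof (rule boundedI)
    fix x assume "x \<in> S"
    hence "N x = 1" by (simp add: S_def)
    from nle[OF this] show "norm x \<le> 1 + 1" using norm_Pair_le[of "fst x" "snd x"] by simp
  qed
  moreover have "closed S"
  proof -
    have "closed {ab. N ab = 1}" "closed {ab :: 'a \<times> 'a. \<delta> \<le> norm (fst ab - snd ab) powr p}"
      using p by (intro closed_Collect_eq closed_Collect_le continuous_intros cN continuous_on_powr'; auto)+
    thus ?thesis unfolding S_def by (simp add: Collect_conj_eq closed_Int)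
  qed
  ultimately have cS: "compact S" by (simp add: compact_eq_bounded_closed)
  obtain c where c: "c > 0" "\<And>x. x \<in> S \<Longrightarrow> g x \<ge> c"
  proof (cases "S = {}")
    case True thus ?thesis using that[of 1] by auto
  next
    case False
    then obtain x where x: "x \<in> S" "\<And>y. y \<in> S \<Longrightarrow> g x \<le> g y"
      using continuous_attains_inf[OF cS False continuous_on_subset[OF cg]] by blast
    have "fst x \<noteq> snd x" using x(1) p \<delta> by (auto simp: S_def)
    hence "g x > 0" using norm_powr_midpoint_less[OF p, of "fst x" "snd x"] by (simp add: g_def N_def)
    thus ?thesis using that[of "g x"] x by blast
  qed
  \<comment> \<open>On \<open>S\<close> both norms are at most \<open>1\<close>, so the distance to
    the power \<open>p\<close> is at most \<open>2 powr p\<close>, while the defect is at least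
    \<open>c\<close>.\<close>
  define C where "C = 2 powr p / c"
  have C0: "C > 0" using c by (simp add: C_def)
  have "norm (a - b) powr p \<le> \<delta> * N (a, b) + C * g (a, b)" for a b :: 'a
  proof (cases "a = 0 \<and> b = 0")
    case True thus ?thesis using p g0[of "(a,b)"] C0 \<delta> by (simp add: N_def)
  next
    case False
    define t where "t = N (a, b) powr (1 / p)"
    have N0: "N (a, b) > 0" using False by (auto simp: N_def add_pos_nonneg add_nonneg_pos)
    have t: "t > 0" "t powr p = N (a, b)" using N0 p by (auto simp: t_def powr_powr)
    define a' b' where "a' = (1 / t) *\<^sub>R a" and "b' = (1 / t) *\<^sub>R b"
    have sc: "norm ((1/t) *\<^sub>R v) powr p = norm v powr p / N (a,b)" for v :: 'a
      using t by (simp add: powr_mult powr_divide)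
    have Nab: "N (a', b') = 1" using N0 by (simp add: N_def a'_def b'_def sc[unfolded N_def] add_divide_distrib[symmetric] del: norm_scaleR) 
    have dab: "norm (a' - b') powr p = norm (a - b) powr p / N (a, b)"
      using sc[of "a - b"] by (simp add: a'_def b'_def scaleR_right_diff_distrib)
    have gab: "g (a', b') = g (a, b) / N (a, b)"
    proof -
      have "norm ((1/2) *\<^sub>R (a' + b')) powr p = norm ((1/2) *\<^sub>R (a + b)) powr p / N (a, b)"
        using sc[of "(1/2) *\<^sub>R (a + b)"] by (simp add: a'_def b'_def scaleR_add_right mult.commute)
      thus ?thesis using N0 unfolding g_def by (simp only: fst_conv snd_conv Nab diff_divide_distrib) simp
    qed
    show ?thesis
    proof (cases "norm (a' - b') powr p \<ge> \<delta>")
      case True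
      hence "(a', b') \<in> S" by (simp add: S_def Nab)
      hence cg: "c \<le> g (a', b')" using c by blast
      have "norm (a' - b') \<le> 2" using norm_triangle_ineq4[of a' b'] nle[OF Nab] by simp
      hence "norm (a' - b') powr p \<le> 2 powr p" using p by (intro powr_mono2) auto
      also have "\<dots> = C * c" using c by (simp add: C_def)
      also have "\<dots> \<le> C * g (a', b')" using cg C0 by simp
      finally have "norm (a - b) powr p \<le> C * g (a, b)" using N0 unfolding dab gab by (simp add: field_simps)
      thus ?thesis using N0 \<delta> by (meson add_increasing less_imp_le mult_nonneg_nonneg)
    next
      case False
      hence "norm (a - b) powr p \<le> \<delta> * N (a, b)" using N0 unfolding dab by (simp add: field_simps)
      thus ?thesis using g0[of "(a,b)"] C0 by (smt (verit) mult_nonneg_nonneg)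
    qed
  qed
  thus thesis using that[OF C0] by (simp add: g_def N_def)
qed

section \<open>Power-integrable functions\<close>

lemma powr_add_le:
  fixes a b p :: real
  assumes "a \<ge> 0" "b \<ge> 0" "p \<ge> 0"
  shows "(a + b) powr p \<le> 2 powr p * (a powr p + b powr p)"
proof -
  have "(a + b) powr p \<le> (2 * max a b) powr p" using assms by (intro powr_mono2) auto
  also have "\<dots> = 2 powr p * max a b powr p" using assms by (simp add: powr_mult)
  also have "max a b powr p \<le> a powr p + b powr p" by (auto simp: max_def)
  finally show ?thesis by simp
qed

lemma powr_le_one_add_powr:
  fixes x p r :: real
  assumes "x \<ge> 0" "0 \<le> r" "r \<le> p"
  shows "x powr r \<le> 1 + x powr p"
proof (cases "x \<le> 1")
  case True
  hence "x powr r \<le> 1" using assms by (simp add: powr_le1)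
  thus ?thesis using powr_ge_zero[of x p] by linarith
next
  case False
  hence "x powr r \<le> x powr p" using assms by (intro powr_mono) auto
  thus ?thesis by simp
qed

lemma young_crude:
  fixes a b p q :: real
  assumes "a \<ge> 0" "b \<ge> 0" "p > 1" "q > 1" "1/p + 1/q = 1"
  shows "a * b \<le> a powr p + b powr q"
proof -
  have "a * b \<le> a powr p / p + b powr q / q" by (rule Youngs_inequality) (use assms in auto)
  also have "\<dots> \<le> a powr p + b powr q" using assms by (intro add_mono) (auto simp: divide_le_eq mult_le_cancel_left1)
  finally show ?thesis .
qed

lemma young_scaled:
  fixes a b p q d :: real
  assumes "a \<ge> 0" "b \<ge> 0" "p > 1" "q > 1" "1/p + 1/q = 1" "d > 0"
  shows "a * b \<le> d powr p * a powr p + (1/d) powr q * b powr q"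
  using young_crude[of "d * a" "1/d * b" p q] assms by (simp add: powr_mult powr_divide)

lemma norm_powr_convex:
  fixes a b :: "'a::real_normed_vector"
  assumes p: "p \<ge> 1" and t: "0 \<le> t" "t \<le> 1"
  shows "norm ((1 - t) *\<^sub>R a + t *\<^sub>R b) powr p \<le> (1 - t) * norm a powr p + t * norm b powr p"
proof -
  have z: "(s * c) powr p \<le> s * c powr p" if "0 \<le> s" "s \<le> 1" "c \<ge> 0" for s c :: real
  proof -
    have "s powr p \<le> s powr 1" using p that by (intro powr_mono') auto
    thus ?thesis using that by (simp add: powr_mult mult_right_mono)
  qed
  have "norm ((1 - t) *\<^sub>R a + t *\<^sub>R b) \<le> (1 - t) * norm a + t * norm b"
    using norm_triangle_ineq[of "(1 - t) *\<^sub>R a" "t *\<^sub>R b"] t by simp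
  hence "norm ((1 - t) *\<^sub>R a + t *\<^sub>R b) powr p \<le> ((1 - t) * norm a + t * norm b) powr p"
    using p by (intro powr_mono2) auto
  also have "\<dots> \<le> (1 - t) * norm a powr p + t * norm b powr p"
  proof (cases "a = 0 \<or> b = 0")
    case True thus ?thesis using z[of t "norm b"] z[of "1-t" "norm a"] t by auto
  next
    case False
    thus ?thesis using convex_onD[OF powr_convex[OF p] t, of "norm a" "norm b"] by simp
  qed
  finally show ?thesis .
qed

text \<open>Convexity applied to \<open>a / (1 - t)\<close> and \<open>b / t\<close>. In contrast to
  \<open>powr_add_le\<close>, the factor of \<open>a\<close> tends to \<open>1\<close> as
  \<open>t\<close> tends to \<open>0\<close>; this lets norm bounds pass to limits without
  loss.\<close>

lemma norm_add_powr_le: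
  fixes a b :: "'a::real_normed_vector"
  assumes p: "p \<ge> 1" and t: "0 < t" "t < 1"
  shows "norm (a + b) powr p \<le> (1 - t) powr (1 - p) * norm a powr p + t powr (1 - p) * norm b powr p"
proof -
  have s: "s * norm ((1/s) *\<^sub>R c) powr p = s powr (1 - p) * norm c powr p" if "s > 0" for s and c :: 'a
    using that by (simp add: powr_divide powr_diff)
  have "a + b = (1 - t) *\<^sub>R ((1/(1-t)) *\<^sub>R a) + t *\<^sub>R ((1/t) *\<^sub>R b)" using t by simp
  thus ?thesis using norm_powr_convex[OF p, of t "(1/(1-t)) *\<^sub>R a" "(1/t) *\<^sub>R b"] t s[of "1-t" a] s[of t b] by simp
qed

definition in_Lp :: "'a measure \<Rightarrow> real \<Rightarrow> ('a \<Rightarrow> 'b::euclidean_space) \<Rightarrow> bool" where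
  "in_Lp M p f \<longleftrightarrow> f \<in> borel_measurable M \<and> integrable M (\<lambda>x. norm (f x) powr p)"

text \<open>The \<open>p\<close>-th power of the norm. As no root is taken, Minkowski's inequality
  is replaced by a triangle inequality with factor \<open>2 powr p\<close>, which is enough for
  limits and completeness.\<close>

definition Lp_mod :: "'a measure \<Rightarrow> real \<Rightarrow> ('a \<Rightarrow> 'b::euclidean_space) \<Rightarrow> real" where
  "Lp_mod M p f = (LINT x|M. norm (f x) powr p)"

lemma in_LpD:
  assumes "in_Lp M p f"
  shows "f \<in> borel_measurable M" "integrable M (\<lambda>x. norm (f x) powr p)"
  using assms by (auto simp: in_Lp_def)

lemma Lp_mod_nonneg [simp]: "Lp_mod M p f \<ge> 0"
  by (simp add: Lp_mod_def)

lemma in_Lp_bound: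
  assumes "f \<in> borel_measurable M" "integrable M h" "AE x in M. norm (f x) powr p \<le> h x"
  shows "in_Lp M p f"
  unfolding in_Lp_def
proof
  show "integrable M (\<lambda>x. norm (f x) powr p)"
    using assms by (intro Bochner_Integration.integrable_bound[OF assms(2)]) (auto elim!: eventually_mono)
qed fact

lemma in_Lp_add:
  assumes "in_Lp M p f" "in_Lp M p g" "p \<ge> 0"
  shows "in_Lp M p (\<lambda>x. f x + g x)" "Lp_mod M p (\<lambda>x. f x + g x) \<le> 2 powr p * (Lp_mod M p f + Lp_mod M p g)"
proof -
  note [measurable] = in_LpD(1)[OF assms(1)] in_LpD(1)[OF assms(2)]
  have int: "integrable M (\<lambda>x. 2 powr p * (norm (f x) powr p + norm (g x) powr p))"
    using assms by (auto simp: in_Lp_def)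
  have le: "norm (f x + g x) powr p \<le> 2 powr p * (norm (f x) powr p + norm (g x) powr p)" for x
    using powr_add_le[of "norm (f x)" "norm (g x)" p] powr_mono2[of p "norm (f x + g x)" "norm (f x) + norm (g x)"]
      norm_triangle_ineq[of "f x" "g x"] assms(3) by (meson norm_ge_zero order_trans)
  show in1: "in_Lp M p (\<lambda>x. f x + g x)" by (rule in_Lp_bound[OF _ int]) (auto simp: le)
  have "Lp_mod M p (\<lambda>x. f x + g x) \<le> (LINT x|M. 2 powr p * (norm (f x) powr p + norm (g x) powr p))"
    unfolding Lp_mod_def by (intro integral_mono int in_LpD[OF in1] le)
  thus "Lp_mod M p (\<lambda>x. f x + g x) \<le> 2 powr p * (Lp_mod M p f + Lp_mod M p g)"
    using assms by (simp add: Lp_mod_def in_Lp_def)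
qed

lemma in_Lp_scaleR:
  assumes "in_Lp M p f"
  shows "in_Lp M p (\<lambda>x. c *\<^sub>R f x)" "Lp_mod M p (\<lambda>x. c *\<^sub>R f x) = \<bar>c\<bar> powr p * Lp_mod M p f"
  using assms by (auto simp: in_Lp_def Lp_mod_def powr_mult)

lemma in_Lp_diff:
  assumes "in_Lp M p f" "in_Lp M p g" "p \<ge> 0"
  shows "in_Lp M p (\<lambda>x. f x - g x)" "Lp_mod M p (\<lambda>x. f x - g x) \<le> 2 powr p * (Lp_mod M p f + Lp_mod M p g)"
  using in_Lp_add[OF assms(1) in_Lp_scaleR(1)[OF assms(2), of "-1"] assms(3)] in_Lp_scaleR(2)[OF assms(2), of "-1"]
  by simp_all

lemma Lp_mod_minus_commute: "Lp_mod M p (\<lambda>x. f x - g x) = Lp_mod M p (\<lambda>x. g x - f x)"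
  by (simp add: Lp_mod_def norm_minus_commute)

lemma in_Lp_norm:
  assumes "in_Lp M p f"
  shows "in_Lp M p (\<lambda>x. norm (f x))" "Lp_mod M p (\<lambda>x. norm (f x)) = Lp_mod M p f"
  using assms by (auto simp: in_Lp_def Lp_mod_def)

lemma (in finite_measure) in_Lp_const: "in_Lp M p (\<lambda>x. c)"
  by (simp add: in_Lp_def)

lemma (in finite_measure) in_Lp_lower:
  assumes "in_Lp M p f" "0 \<le> r" "r \<le> p"
  shows "in_Lp M r f"
proof (rule in_Lp_bound)
  show "integrable M (\<lambda>x. 1 + norm (f x) powr p)" using assms by (auto simp: in_Lp_def)
qed (use assms in \<open>auto simp: in_Lp_def powr_le_one_add_powr\<close>)

lemma (in finite_measure) in_Lp_integrable:
  assumes "in_Lp M p f" "1 \<le> p"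
  shows "integrable M f"
  using in_Lp_lower[OF assms(1), of 1] assms by (auto simp: in_Lp_def integrable_norm_iff)

text \<open>The free weight \<open>d\<close> does the work of Hoelder's inequality: a large
  \<open>d\<close> makes the second term small, after which the first factor can be sent to
  zero.\<close>

lemma in_Lp_mult:
  fixes f g :: "'a \<Rightarrow> real"
  assumes "in_Lp M p f" "in_Lp M q g" "p > 1" "q > 1" "1/p + 1/q = 1"
  shows "integrable M (\<lambda>x. f x * g x)"
    and "d > 0 \<Longrightarrow> (LINT x|M. \<bar>f x * g x\<bar>) \<le> d powr p * Lp_mod M p f + (1/d) powr q * Lp_mod M q g"
proof -
  note [measurable] = in_LpD(1)[OF assms(1)] in_LpD(1)[OF assms(2)]
  have le: "norm (f x * g x) \<le> d powr p * norm (f x) powr p + (1/d) powr q * norm (g x) powr q" if "d > 0" for d x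
    using young_scaled[of "norm (f x)" "norm (g x)" p q d] assms that by (simp add: abs_mult)
  have int: "integrable M (\<lambda>x. d powr p * norm (f x) powr p + (1/d) powr q * norm (g x) powr q)" for d
    using assms by (auto simp: in_Lp_def)
  show i: "integrable M (\<lambda>x. f x * g x)"
    by (rule Bochner_Integration.integrable_bound[OF int[of 1]]) (use le[of 1] in auto)
  assume d: "d > 0"
  have "(LINT x|M. \<bar>f x * g x\<bar>) \<le> (LINT x|M. d powr p * norm (f x) powr p + (1/d) powr q * norm (g x) powr q)"
    using i le[OF d] by (intro integral_mono int) auto
  also have "\<dots> = d powr p * Lp_mod M p f + (1/d) powr q * Lp_mod M q g"
    using assms by (simp add: in_Lp_def Lp_mod_def)
  finally show "(LINT x|M. \<bar>f x * g x\<bar>) \<le> d powr p * Lp_mod M p f + (1/d) powr q * Lp_mod M q g" .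
qed

lemma Lp_mod_tendsto_integral_mult:
  fixes f :: "nat \<Rightarrow> 'a \<Rightarrow> real"
  assumes "\<And>n. in_Lp M p (f n)" "in_Lp M p h" "in_Lp M q g" "p > 1" "q > 1" "1/p + 1/q = 1"
    and lim: "(\<lambda>n. Lp_mod M p (\<lambda>x. f n x - h x)) \<longlonglongrightarrow> 0"
  shows "(\<lambda>n. LINT x|M. f n x * g x) \<longlonglongrightarrow> (LINT x|M. h x * g x)"
proof (rule LIMSEQ_I)
  fix e :: real assume e: "e > 0"
  define Q where "Q = Lp_mod M q g"
  have Q: "Q \<ge> 0" by (simp add: Q_def)
  \<comment> \<open>The value of \<open>d powr q\<close> for which the second term of the weighted
    Young bound stays below \<open>e / 2\<close>.\<close>
  define X where "X = 2 * (Q + 1) / e"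
  have X: "X > 0" using e Q by (simp add: X_def)
  define d where "d = X powr (1/q)"
  have d: "d > 0" "(1/d) powr q * Q < e / 2"
  proof -
    show "d > 0" using X by (simp add: d_def)
    have "d powr q = X" using assms(5) X by (simp add: d_def powr_powr)
    hence "(1/d) powr q = e / (2 * (Q + 1))" using \<open>d > 0\<close> by (simp add: powr_divide X_def)
    also have "\<dots> * Q < e / 2" using e Q by (simp add: field_simps)
    finally show "(1/d) powr q * Q < e / 2" .
  qed
  have "(\<lambda>n. d powr p * Lp_mod M p (\<lambda>x. f n x - h x)) \<longlonglongrightarrow> d powr p * 0"
    using lim by (intro tendsto_intros)
  hence "\<forall>\<^sub>F n in sequentially. d powr p * Lp_mod M p (\<lambda>x. f n x - h x) < e / 2"
    using e by (intro order_tendstoD) auto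
  then obtain N where N: "\<And>n. n \<ge> N \<Longrightarrow> d powr p * Lp_mod M p (\<lambda>x. f n x - h x) < e / 2"
    by (auto simp: eventually_sequentially)
  show "\<exists>N. \<forall>n\<ge>N. norm ((LINT x|M. f n x * g x) - (LINT x|M. h x * g x)) < e"
  proof (intro exI allI impI)
    fix n assume "N \<le> n"
    have i: "integrable M (\<lambda>x. f n x * g x)" "integrable M (\<lambda>x. h x * g x)"
      using in_Lp_mult(1)[OF assms(1,3-6)] in_Lp_mult(1)[OF assms(2-6)] by blast+
    have D: "in_Lp M p (\<lambda>x. f n x - h x)" using assms by (intro in_Lp_diff) auto
    have "(LINT x|M. f n x * g x) - (LINT x|M. h x * g x) = (LINT x|M. (f n x - h x) * g x)"
      using i by (simp add: left_diff_distrib)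
    hence "norm ((LINT x|M. f n x * g x) - (LINT x|M. h x * g x)) \<le> (LINT x|M. \<bar>(f n x - h x) * g x\<bar>)"
      using integral_norm_bound[of M "\<lambda>x. (f n x - h x) * g x"] by simp
    also have "\<dots> \<le> d powr p * Lp_mod M p (\<lambda>x. f n x - h x) + (1/d) powr q * Q"
      unfolding Q_def using in_Lp_mult(2)[OF D assms(3-6) d(1)] .
    also have "\<dots> < e" using N[OF \<open>N \<le> n\<close>] d(2) by simp
    finally show "norm ((LINT x|M. f n x * g x) - (LINT x|M. h x * g x)) < e" .
  qed
qed

text \<open>For fixed \<open>t\<close> the sequence is sent to its limit first; then
  \<open>t\<close> tends to \<open>0\<close> and the factor \<open>(1-t) powr (1-p)\<close> tends to
  \<open>1\<close>, so the bound \<open>R\<close> survives unchanged.\<close>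

lemma Lp_mod_le_closed:
  fixes f :: "'a \<Rightarrow> 'b::euclidean_space"
  assumes "\<And>n. in_Lp M p (f' n)" "in_Lp M p f" "p \<ge> 1"
    and lim: "(\<lambda>n. Lp_mod M p (\<lambda>x. f' n x - f x)) \<longlonglongrightarrow> 0"
  shows "t \<in> {0<..<1} \<Longrightarrow> Lp_mod M p f \<le> (1-t) powr (1-p) * Lp_mod M p (f' n) + t powr (1-p) * Lp_mod M p (\<lambda>x. f' n x - f x)"
    and "(\<And>n. Lp_mod M p (f' n) \<le> R) \<Longrightarrow> Lp_mod M p f \<le> R"
proof -
  have D: "in_Lp M p (\<lambda>x. f x - f' n x)" for n using assms by (intro in_Lp_diff) auto
  have le: "Lp_mod M p f \<le> (1-t) powr (1-p) * Lp_mod M p (f' n) + t powr (1-p) * Lp_mod M p (\<lambda>x. f' n x - f x)"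
    if t: "t \<in> {0<..<1}" for n t
  proof -
    have "Lp_mod M p f \<le> (LINT x|M. (1-t) powr (1-p) * norm (f' n x) powr p + t powr (1-p) * norm (f x - f' n x) powr p)"
      unfolding Lp_mod_def
    proof (intro integral_mono Bochner_Integration.integrable_add integrable_mult_right)
      fix x show "norm (f x) powr p \<le> (1-t) powr (1-p) * norm (f' n x) powr p + t powr (1-p) * norm (f x - f' n x) powr p"
        using norm_add_powr_le[OF assms(3), of t "f' n x" "f x - f' n x"] t by simp
    qed (use assms(1,2) D in \<open>auto simp: in_Lp_def\<close>)
    also have "\<dots> = (1-t) powr (1-p) * Lp_mod M p (f' n) + t powr (1-p) * Lp_mod M p (\<lambda>x. f x - f' n x)"
      unfolding Lp_mod_def using in_LpD(2)[OF assms(1)[of n]] in_LpD(2)[OF D[of n]]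
      by (subst Bochner_Integration.integral_add) auto
    finally show ?thesis by (simp add: Lp_mod_minus_commute)
  qed
  show "t \<in> {0<..<1} \<Longrightarrow> Lp_mod M p f \<le> (1-t) powr (1-p) * Lp_mod M p (f' n) + t powr (1-p) * Lp_mod M p (\<lambda>x. f' n x - f x)"
    by (rule le)
  assume R: "\<And>n. Lp_mod M p (f' n) \<le> R"
  have "Lp_mod M p f \<le> (1-t) powr (1-p) * R" if t: "t \<in> {0<..<1}" for t
  proof (rule LIMSEQ_le_const)
    show "(\<lambda>n. (1-t) powr (1-p) * R + t powr (1-p) * Lp_mod M p (\<lambda>x. f' n x - f x)) \<longlonglongrightarrow> (1-t) powr (1-p) * R"
      using tendsto_add[OF tendsto_const[of "(1-t) powr (1-p) * R"] tendsto_mult_right_zero[OF lim]] by simp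
    show "\<exists>N. \<forall>n\<ge>N. Lp_mod M p f \<le> (1-t) powr (1-p) * R + t powr (1-p) * Lp_mod M p (\<lambda>x. f' n x - f x)"
    proof (intro exI allI impI)
      fix n
      have "(1-t) powr (1-p) * Lp_mod M p (f' n) \<le> (1-t) powr (1-p) * R" using R by (intro mult_left_mono) auto
      thus "Lp_mod M p f \<le> (1-t) powr (1-p) * R + t powr (1-p) * Lp_mod M p (\<lambda>x. f' n x - f x)"
        using le[OF t, of n] by linarith
    qed
  qed
  hence ev: "\<forall>\<^sub>F t in at_right 0. Lp_mod M p f \<le> (1-t) powr (1-p) * R"
    unfolding eventually_at_right_field by (intro exI[of _ 1]) auto
  have "((\<lambda>t. (1-t) powr (1-p) * R) \<longlongrightarrow> (1-0) powr (1-p) * R) (at_right (0::real))"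
    by (intro tendsto_intros) auto
  from tendsto_lowerbound[OF this ev] show "Lp_mod M p f \<le> R" by simp
qed

lemma ennreal_le_suminf: "h k \<le> (\<Sum>k. h k)" for h :: "nat \<Rightarrow> ennreal"
proof -
  have "sum h {k} \<le> suminf h" by (rule sum_le_suminf) auto
  thus ?thesis by simp
qed

text \<open>Riesz-Fischer, arranged to work for every \<open>p > 0\<close>: the increments of a fast
  subsequence are weighted by \<open>2 ^ k\<close> before the integrals are summed, so that almost
  everywhere they are dominated by a geometric series.\<close>

lemma Lp_complete:
  fixes f :: "nat \<Rightarrow> 'a \<Rightarrow> 'b::euclidean_space"
  assumes f: "\<And>n. in_Lp M p (f n)" and p: "p > 0"
    and cauchy: "\<And>e. e > 0 \<Longrightarrow> \<exists>N. \<forall>m\<ge>N. \<forall>n\<ge>N. Lp_mod M p (\<lambda>x. f m x - f n x) < e"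
  obtains g where "in_Lp M p g" "(\<lambda>n. Lp_mod M p (\<lambda>x. f n x - g x)) \<longlonglongrightarrow> 0"
proof -
  note [measurable] = in_LpD(1)[OF f]
  have D: "in_Lp M p (\<lambda>x. f m x - f n x)" for m n using f p by (intro in_Lp_diff) auto
  \<comment> \<open>Solves \<open>(2 ^ k) powr p * d k = (1/2) ^ k\<close>, so the weighted
    increments have summable integrals.\<close>
  define d where "d k = 2 powr (- (k * (p + 1)))" for k :: real
  have "\<exists>N. \<forall>m\<ge>N. \<forall>n\<ge>N. Lp_mod M p (\<lambda>x. f m x - f n x) < d (real k)" for k :: nat
    by (rule cauchy) (simp add: d_def)
  then obtain N where N: "\<And>k m n. m \<ge> N k \<Longrightarrow> n \<ge> N k \<Longrightarrow> Lp_mod M p (\<lambda>x. f m x - f n x) < d (real k)"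
    by metis
  define r where "r = rec_nat (N 0) (\<lambda>k s. max (Suc s) (N (Suc k)))"
  have rS: "r (Suc k) = max (Suc (r k)) (N (Suc k))" for k by (simp add: r_def)
  have rN: "r k \<ge> N k" for k by (cases k) (auto simp: r_def)
  have rmono: "strict_mono r" by (rule strict_monoI_Suc) (simp add: rS less_max_iff_disj)
  define \<Delta> where "\<Delta> k x = f (r (Suc k)) x - f (r k) x" for k x
  have \<Delta>: "Lp_mod M p (\<Delta> k) < d (real k)" for k
    unfolding \<Delta>_def using N[of k "r (Suc k)" "r k"] rN[of k] rS[of k] by simp
  have \<Delta>L: "in_Lp M p (\<Delta> k)" for k unfolding \<Delta>_def by (rule D)
  note [measurable] = in_LpD(1)[OF \<Delta>L]
  have nn: "(\<integral>\<^sup>+x. ennreal (norm (h x) powr p) \<partial>M) = ennreal (Lp_mod M p h)" if "in_Lp M p h" for h :: "'a \<Rightarrow> 'b"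
    unfolding Lp_mod_def using that by (intro nn_integral_eq_integral) (auto simp: in_Lp_def)
  have "(\<integral>\<^sup>+x. (\<Sum>k. ennreal ((2 ^ k * norm (\<Delta> k x)) powr p)) \<partial>M)
      = (\<Sum>k. \<integral>\<^sup>+x. ennreal ((2 ^ k * norm (\<Delta> k x)) powr p) \<partial>M)"
    by (rule nn_integral_suminf) measurable
  also have "\<dots> \<le> (\<Sum>k. ennreal ((1/2) ^ k))"
  proof (intro suminf_le allI summableI)
    fix k
    have "(\<integral>\<^sup>+x. ennreal ((2 ^ k * norm (\<Delta> k x)) powr p) \<partial>M) = (\<integral>\<^sup>+x. ennreal ((2 ^ k) powr p) * ennreal (norm (\<Delta> k x) powr p) \<partial>M)"
      by (simp add: powr_mult ennreal_mult)
    also have "\<dots> = ennreal ((2 ^ k) powr p) * ennreal (Lp_mod M p (\<Delta> k))"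
      by (subst nn_integral_cmult) (auto simp: nn[OF \<Delta>L])
    also have "\<dots> = ennreal ((2 ^ k) powr p * Lp_mod M p (\<Delta> k))" by (simp add: ennreal_mult)
    also have "\<dots> \<le> ennreal ((2 ^ k) powr p * d (real k))"
      using \<Delta>[of k] by (intro ennreal_leI mult_left_mono) auto
    also have "(2 ^ k) powr p * d (real k) = (1/2) ^ k"
    proof -
      have "(2 ^ k) powr p = 2 powr (real k * p)"
        by (simp add: powr_powr flip: powr_realpow)
      hence "(2 ^ k) powr p * d (real k) = 2 powr (real k * p + - (real k * (p + 1)))"
        unfolding d_def by (simp only: powr_add)
      also have "real k * p + - (real k * (p + 1)) = - real k" by (simp add: algebra_simps)
      finally show ?thesis by (simp add: powr_minus powr_realpow power_one_over inverse_eq_divide)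
    qed
    finally show "(\<integral>\<^sup>+x. ennreal ((2 ^ k * norm (\<Delta> k x)) powr p) \<partial>M) \<le> ennreal ((1/2) ^ k)" .
  qed
  also have "\<dots> < \<infinity>"
    by (subst suminf_ennreal2) (auto intro: summable_geometric simp: ennreal_less_top)
  finally have "(\<integral>\<^sup>+x. (\<Sum>k. ennreal ((2 ^ k * norm (\<Delta> k x)) powr p)) \<partial>M) \<noteq> \<infinity>" by simp
  hence AE1: "AE x in M. (\<Sum>k. ennreal ((2 ^ k * norm (\<Delta> k x)) powr p)) \<noteq> \<infinity>"
    by (intro nn_integral_PInf_AE) auto
  define g where "g x = lim (\<lambda>k. f (r k) x)" for x
  have gm [measurable]: "g \<in> borel_measurable M" unfolding g_def by (rule borel_measurable_lim_metric) measurable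
  have conv: "AE x in M. (\<lambda>k. f (r k) x) \<longlonglongrightarrow> g x"
  proof (rule AE_mp[OF AE1], rule AE_I2, rule impI)
    fix x assume fin: "(\<Sum>k. ennreal ((2 ^ k * norm (\<Delta> k x)) powr p)) \<noteq> \<infinity>"
    define S where "S = enn2real (\<Sum>k. ennreal ((2 ^ k * norm (\<Delta> k x)) powr p))"
    have le: "norm (\<Delta> k x) \<le> S powr (1/p) * (1/2) ^ k" for k
    proof -
      have "ennreal ((2 ^ k * norm (\<Delta> k x)) powr p) \<le> (\<Sum>k. ennreal ((2 ^ k * norm (\<Delta> k x)) powr p))"
        by (rule ennreal_le_suminf)
      also have "\<dots> = ennreal S" using fin by (simp add: S_def ennreal_enn2real less_top[symmetric])
      finally have "(2 ^ k * norm (\<Delta> k x)) powr p \<le> S" by (simp add: S_def ennreal_le_iff)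
      hence "((2 ^ k * norm (\<Delta> k x)) powr p) powr (1/p) \<le> S powr (1/p)" using p by (intro powr_mono2) auto
      hence "2 ^ k * norm (\<Delta> k x) \<le> S powr (1/p)" using p by (simp add: powr_powr)
      hence "2 ^ k * norm (\<Delta> k x) * (1/2) ^ k \<le> S powr (1/p) * (1/2) ^ k" by (rule mult_right_mono) simp
      moreover have "2 ^ k * norm (\<Delta> k x) * (1/2) ^ k = norm (\<Delta> k x)" by (simp add: power_one_over)
      ultimately show ?thesis by (simp only:)
    qed
    have "summable (\<lambda>k. S powr (1/p) * (1/2) ^ k)" by (rule summable_mult[OF summable_geometric]) simp
    hence "summable (\<lambda>k. norm (\<Delta> k x))"
      by (rule summable_comparison_test'[where N = 0]) (simp add: le)
    hence "summable (\<lambda>k. \<Delta> k x)" by (rule summable_norm_cancel)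
    hence "convergent (\<lambda>n. \<Sum>k<n. \<Delta> k x)" by (simp add: summable_iff_convergent)
    moreover have "(\<Sum>k<n. \<Delta> k x) = f (r n) x - f (r 0) x" for n
      unfolding \<Delta>_def by (rule sum_lessThan_telescope)
    ultimately have "convergent (\<lambda>n. f (r n) x - f (r 0) x)" by (simp only:)
    from convergent_add[OF this convergent_const[of "f (r 0) x"]]
    have "convergent (\<lambda>n. f (r n) x)" by simp
    thus "(\<lambda>k. f (r k) x) \<longlonglongrightarrow> g x" unfolding g_def by (simp add: convergent_LIMSEQ_iff)
  qed
  \<comment> \<open>Along the subsequence, Fatou's lemma turns the Cauchy estimate between members
    into an estimate of the distance to \<open>g\<close>.\<close>
  have fatou: "(\<integral>\<^sup>+x. ennreal (norm (f n x - g x) powr p) \<partial>M) \<le> ennreal e"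
    if "e > 0" "\<And>m. m \<ge> n \<Longrightarrow> Lp_mod M p (\<lambda>x. f n x - f m x) \<le> e" for n e
  proof -
    have "(\<integral>\<^sup>+x. ennreal (norm (f n x - g x) powr p) \<partial>M) = (\<integral>\<^sup>+x. liminf (\<lambda>k. ennreal (norm (f n x - f (r k) x) powr p)) \<partial>M)"
    proof (rule nn_integral_cong_AE, rule AE_mp[OF conv], rule AE_I2, rule impI)
      fix x assume "(\<lambda>k. f (r k) x) \<longlonglongrightarrow> g x"
      hence "(\<lambda>k. norm (f n x - f (r k) x) powr p) \<longlonglongrightarrow> norm (f n x - g x) powr p"
        using p by (intro tendsto_powr' tendsto_intros) auto
      hence "(\<lambda>k. ennreal (norm (f n x - f (r k) x) powr p)) \<longlonglongrightarrow> ennreal (norm (f n x - g x) powr p)"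
        by (rule tendsto_ennrealI)
      from lim_imp_Liminf[OF _ this] show "ennreal (norm (f n x - g x) powr p) = liminf (\<lambda>k. ennreal (norm (f n x - f (r k) x) powr p))"
        by simp
    qed
    also have "\<dots> \<le> liminf (\<lambda>k. \<integral>\<^sup>+x. ennreal (norm (f n x - f (r k) x) powr p) \<partial>M)"
      by (rule nn_integral_liminf) measurable
    also have "\<dots> \<le> ennreal e"
    proof (rule Liminf_le)
      show "\<forall>\<^sub>F k in sequentially. (\<integral>\<^sup>+x. ennreal (norm (f n x - f (r k) x) powr p) \<partial>M) \<le> ennreal e"
        unfolding nn[OF D] using that(2) seq_suble[OF rmono]
        by (intro eventually_sequentiallyI[of n]) (auto intro!: ennreal_leI intro: order_trans)
    qed simp
    finally show ?thesis .
  qed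
  have fin: "in_Lp M p (\<lambda>x. f n x - g x)" "Lp_mod M p (\<lambda>x. f n x - g x) \<le> e"
    if "e > 0" "\<And>m. m \<ge> n \<Longrightarrow> Lp_mod M p (\<lambda>x. f n x - f m x) \<le> e" for n e
  proof -
    show i: "in_Lp M p (\<lambda>x. f n x - g x)" unfolding in_Lp_def
      by (intro conjI integrableI_bounded) (use order_le_less_trans[OF fatou[OF that]] in auto)
    show "Lp_mod M p (\<lambda>x. f n x - g x) \<le> e"
      using fatou[OF that] nn[OF i] that(1) by simp
  qed
  obtain N1 where N1: "\<And>m n. m \<ge> N1 \<Longrightarrow> n \<ge> N1 \<Longrightarrow> Lp_mod M p (\<lambda>x. f m x - f n x) < 1" using cauchy[of 1] by auto
  have "in_Lp M p (\<lambda>x. f N1 x - g x)" by (rule fin(1)[of 1]) (use N1 in \<open>auto intro: less_imp_le\<close>)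
  from in_Lp_diff(1)[OF f[of N1] this] p have "in_Lp M p (\<lambda>x. f N1 x - (f N1 x - g x))" by simp
  hence "in_Lp M p g" by simp
  moreover have "(\<lambda>n. Lp_mod M p (\<lambda>x. f n x - g x)) \<longlonglongrightarrow> 0"
  proof (rule LIMSEQ_I)
    fix e :: real assume e: "e > 0"
    obtain N where N: "\<And>m n. m \<ge> N \<Longrightarrow> n \<ge> N \<Longrightarrow> Lp_mod M p (\<lambda>x. f m x - f n x) < e / 2" using cauchy[of "e/2"] e by auto
    show "\<exists>N. \<forall>n\<ge>N. norm (Lp_mod M p (\<lambda>x. f n x - g x) - 0) < e"
    proof (intro exI allI impI)
      fix n assume "N \<le> n"
      hence "Lp_mod M p (\<lambda>x. f n x - g x) \<le> e / 2" using e N by (intro fin(2)) (auto intro: less_imp_le)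
      thus "norm (Lp_mod M p (\<lambda>x. f n x - g x) - 0) < e" using e by simp
    qed
  qed
  ultimately show thesis by (rule that)
qed

section \<open>Periodic functions on the torus\<close>

lemma prob_space_torus: "prob_space (torus :: (real^'n) measure)"
proof
  show "emeasure torus (space torus :: (real^'n) set) = 1"
  proof -
    have "(0 :: real^'n) \<in> cbox 0 1" by (simp add: mem_box_cart)
    hence "measure lborel (cbox 0 (1 :: real^'n)) = 1" by (subst content_cbox_cart) auto
    moreover have "emeasure lborel (cbox 0 (1 :: real^'n)) = ennreal (measure lborel (cbox 0 (1 :: real^'n)))"
      by (rule emeasure_eq_ennreal_measure, rule less_imp_neq, rule emeasure_lborel_cbox_finite[unfolded infinity_ennreal_def])
    ultimately show ?thesis by (simp add: emeasure_restrict_space)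
  qed
qed

interpretation torus: prob_space "torus :: (real^'n) measure"
  by (rule prob_space_torus)

section \<open>Lattice translations and integration over a period cell\<close>

definition lattice :: "(real^'n) set" where
  "lattice = {z. \<forall>i. z $ i \<in> \<int>}"

text \<open>Half-open, unlike the closed cube under \<open>torus\<close>, so that its lattice
  translates partition the space. The two cubes differ by a null set.\<close>

definition unit_cell :: "(real^'n) set" where
  "unit_cell = {x. \<forall>i. 0 \<le> x $ i \<and> x $ i < 1}"

lemma countable_lattice: "countable (lattice :: (real^'n) set)"
proof -
  have "lattice \<subseteq> range (\<lambda>h :: 'n \<Rightarrow> int. \<chi> i. real_of_int (h i))"
  proof
    fix z :: "real^'n" assume z: "z \<in> lattice"
    have "z = (\<chi> i. real_of_int \<lfloor>z $ i\<rfloor>)" using z by (auto simp: lattice_def vec_eq_iff)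
    thus "z \<in> range (\<lambda>h :: 'n \<Rightarrow> int. \<chi> i. real_of_int (h i))" by (rule range_eqI[of _ _ "\<lambda>i. \<lfloor>z $ i\<rfloor>"])
  qed
  thus ?thesis by (rule countable_subset) auto
qed

lemma lattice_translate_unique: "\<exists>!z. z \<in> lattice \<and> x - z \<in> unit_cell" for x :: "real^'n"
proof
  show "(\<chi> i. real_of_int \<lfloor>x $ i\<rfloor>) \<in> lattice \<and> x - (\<chi> i. real_of_int \<lfloor>x $ i\<rfloor>) \<in> unit_cell"
    by (auto simp: lattice_def unit_cell_def) linarith+
  fix z assume z: "z \<in> lattice \<and> x - z \<in> unit_cell"
  have "z $ i = real_of_int \<lfloor>x $ i\<rfloor>" for i
  proof -
    obtain k where "z $ i = real_of_int k" using z by (auto simp: lattice_def elim!: Ints_cases dest: spec[of _ i])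
    moreover have "0 \<le> x $ i - z $ i" "x $ i - z $ i < 1" using z by (auto simp: unit_cell_def)
    ultimately show ?thesis by (simp add: floor_unique)
  qed
  thus "z = (\<chi> i. real_of_int \<lfloor>x $ i\<rfloor>)" by (simp add: vec_eq_iff)
qed

lemma unit_cell_borel [measurable]: "unit_cell \<in> sets (borel :: (real^'n) measure)"
proof -
  have "unit_cell = (\<Inter>i. {x :: real^'n. 0 \<le> x $ i} \<inter> {x. x $ i < 1})" by (auto simp: unit_cell_def)
  moreover have "{x :: real^'n. 0 \<le> x $ i} \<in> sets borel" "{x :: real^'n. x $ i < 1} \<in> sets borel" for i
    by (auto intro!: borel_closed borel_open closed_Collect_le open_Collect_less continuous_intros)
  hence "(\<Inter>i. {x :: real^'n. 0 \<le> x $ i} \<inter> {x. x $ i < 1}) \<in> sets borel"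
    by (intro sets.finite_INT sets.Int) auto
  ultimately show ?thesis by simp
qed

text \<open>Exactly one lattice translate of the cell contains a given point. The sum over the
  lattice is written as an integral against counting measure, which allows it to be exchanged with
  Lebesgue integrals.\<close>

lemma nn_integral_lattice_partition:
  "(\<integral>\<^sup>+z. indicator unit_cell (x - z) \<partial>count_space lattice) = (1 :: ennreal)"
  "(\<integral>\<^sup>+z. indicator unit_cell (x + z) \<partial>count_space lattice) = (1 :: ennreal)" for x :: "real^'n"
proof -
  have *: "(\<integral>\<^sup>+z. indicator unit_cell (f z) \<partial>count_space lattice) = (1 :: ennreal)"
    if "\<exists>!z. z \<in> lattice \<and> f z \<in> unit_cell" for f :: "real^'n \<Rightarrow> real^'n"
  proof -
    from that obtain z where z: "z \<in> lattice" "f z \<in> unit_cell" "\<And>y. y \<in> lattice \<Longrightarrow> f y \<in> unit_cell \<Longrightarrow> y = z"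
      by (auto elim!: ex1E)
    have "(\<integral>\<^sup>+z. indicator unit_cell (f z) \<partial>count_space lattice) = (\<integral>\<^sup>+y. indicator {z} y \<partial>count_space lattice)"
    proof (rule nn_integral_cong)
      fix y :: "real^'n" assume "y \<in> space (count_space lattice)"
      hence "f y \<in> unit_cell \<longleftrightarrow> y = z" using z(2) z(3)[of y] by auto
      thus "(indicator unit_cell (f y) :: ennreal) = indicator {z} y" by (simp add: indicator_def)
    qed
    also have "\<dots> = emeasure (count_space lattice) {z}" by (rule nn_integral_indicator) (simp add: z(1))
    also have "\<dots> = 1" by (simp add: z(1) emeasure_count_space)
    finally show ?thesis .
  qed
  show "(\<integral>\<^sup>+z. indicator unit_cell (x - z) \<partial>count_space lattice) = (1 :: ennreal)"
    by (rule *[OF lattice_translate_unique])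
  show "(\<integral>\<^sup>+z. indicator unit_cell (x + z) \<partial>count_space lattice) = (1 :: ennreal)"
  proof (rule *)
    obtain z where z: "z \<in> lattice" "x - z \<in> unit_cell" "\<And>y. y \<in> lattice \<Longrightarrow> x - y \<in> unit_cell \<Longrightarrow> y = z"
      using lattice_translate_unique[of x] by (auto elim!: ex1E)
    have m: "- y \<in> lattice \<longleftrightarrow> y \<in> lattice" for y :: "real^'n" by (simp add: lattice_def)
    show "\<exists>!z. z \<in> lattice \<and> x + z \<in> unit_cell"
    proof (rule ex1I[of _ "- z"])
      show "- z \<in> lattice \<and> x + - z \<in> unit_cell" using z(1,2) m[of z] by simp
      fix y assume "y \<in> lattice \<and> x + y \<in> unit_cell"
      hence "- y = z" using m[of y] z(3)[of "- y"] by simp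
      thus "y = - z" by (metis minus_minus)
    qed
  qed
qed

lemma nn_integral_lborel_shift:
  fixes f :: "'a::euclidean_space \<Rightarrow> ennreal"
  assumes [measurable]: "f \<in> borel_measurable borel"
  shows "(\<integral>\<^sup>+x. f (x + y) \<partial>lborel) = (\<integral>\<^sup>+x. f x \<partial>lborel)"
proof -
  have "(\<integral>\<^sup>+x. f x \<partial>lborel) = (\<integral>\<^sup>+x. f x \<partial>(distr lborel borel ((+) y)))"
    by (simp only: lborel_distr_plus)
  also have "\<dots> = (\<integral>\<^sup>+x. f (y + x) \<partial>lborel)" by (rule nn_integral_distr) measurable
  finally have 1: "(\<integral>\<^sup>+x. f x \<partial>lborel) = (\<integral>\<^sup>+x. f (y + x) \<partial>lborel)" .
  show ?thesis unfolding 1 by (simp only: add.commute)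
qed

lemma periodicD: "periodic f \<Longrightarrow> z \<in> lattice \<Longrightarrow> f (x + z) = f x"
  by (simp add: periodic_def lattice_def)

text \<open>A partition of unity by translates of the cell is inserted, sum and integral are
  exchanged, and each summand is shifted by its lattice vector, which periodicity of
  \<open>f\<close> permits. The indicator of the translated cell then sums to one and
  disappears.\<close>

lemma nn_integral_unit_cell_translate:
  fixes f :: "real^'n \<Rightarrow> ennreal"
  assumes [measurable]: "f \<in> borel_measurable borel" and per: "periodic f"
  shows "(\<integral>\<^sup>+x. indicator unit_cell x * f (x + y) \<partial>lborel) = (\<integral>\<^sup>+x. indicator unit_cell x * f x \<partial>lborel)"
proof -
  let ?I = "indicator unit_cell :: real^'n \<Rightarrow> ennreal"
  have "(\<integral>\<^sup>+x. ?I x * f (x + y) \<partial>lborel) = (\<integral>\<^sup>+x. ?I (x - y) * f x \<partial>lborel)"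
    using nn_integral_lborel_shift[of "\<lambda>x. ?I (x - y) * f x" y] by simp
  also have "\<dots> = (\<integral>\<^sup>+x. \<integral>\<^sup>+z. ?I (x - z) * (?I (x - y) * f x) \<partial>count_space lattice \<partial>lborel)"
    by (subst nn_integral_multc) (auto simp: nn_integral_lattice_partition)
  also have "\<dots> = (\<integral>\<^sup>+z. \<integral>\<^sup>+x. ?I (x - z) * (?I (x - y) * f x) \<partial>lborel \<partial>count_space lattice)"
    by (intro nn_integral_count_space_nn_integral countable_lattice) measurable
  also have "\<dots> = (\<integral>\<^sup>+z. \<integral>\<^sup>+x. ?I (x - y + z) * (?I x * f x) \<partial>lborel \<partial>count_space lattice)"
  proof (rule nn_integral_cong)
    fix z :: "real^'n" assume "z \<in> space (count_space lattice)"
    hence "f (x + z) = f x" for x using periodicD[OF per] by simp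
    thus "(\<integral>\<^sup>+x. ?I (x - z) * (?I (x - y) * f x) \<partial>lborel) = (\<integral>\<^sup>+x. ?I (x - y + z) * (?I x * f x) \<partial>lborel)"
      using nn_integral_lborel_shift[of "\<lambda>x. ?I (x - z) * (?I (x - y) * f x)" z]
      by (simp add: algebra_simps)
  qed
  also have "\<dots> = (\<integral>\<^sup>+x. \<integral>\<^sup>+z. ?I (x - y + z) * (?I x * f x) \<partial>count_space lattice \<partial>lborel)"
    by (rule nn_integral_count_space_nn_integral[OF countable_lattice, symmetric]) measurable
  also have "\<dots> = (\<integral>\<^sup>+x. ?I x * f x \<partial>lborel)"
    by (subst nn_integral_multc) (auto simp: nn_integral_lattice_partition)
  finally show ?thesis .
qed

lemma unit_cell_subset: "unit_cell \<subseteq> cbox 0 (1 :: real^'n)" "box 0 (1 :: real^'n) \<subseteq> unit_cell"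
  by (auto simp: unit_cell_def mem_box_cart less_imp_le)

lemma AE_unit_cell: "AE x in lborel. x \<in> cbox 0 (1 :: real^'n) \<longleftrightarrow> x \<in> unit_cell"
proof (rule AE_I')
  show "cbox 0 1 - box 0 (1 :: real^'n) \<in> null_sets lborel"
    using negligible_frontier_interval[of 0 "1 :: real^'n"]
    by (simp add: negligible_iff_null_sets null_sets_completion_iff)
  show "{x \<in> space lborel. \<not> (x \<in> cbox 0 (1 :: real^'n) \<longleftrightarrow> x \<in> unit_cell)} \<subseteq> cbox 0 1 - box 0 1"
    using unit_cell_subset by auto
qed

lemma AE_torus_unit_cell: "AE x in (torus :: (real^'n) measure). x \<in> unit_cell"
proof -
  have "AE x in lebesgue. x \<in> cbox 0 (1 :: real^'n) \<longleftrightarrow> x \<in> unit_cell"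
    by (rule AE_completion[OF AE_unit_cell])
  thus ?thesis by (subst AE_restrict_space_iff) auto
qed

lemma nn_integral_torus:
  fixes f :: "real^'n \<Rightarrow> ennreal"
  assumes "f \<in> borel_measurable borel"
  shows "(\<integral>\<^sup>+x. f x \<partial>torus) = (\<integral>\<^sup>+x. indicator unit_cell x * f x \<partial>lborel)"
proof -
  have "(\<integral>\<^sup>+x. f x \<partial>torus) = (\<integral>\<^sup>+x. f x * indicator (cbox 0 1) x \<partial>lborel)"
    by (simp add: nn_integral_restrict_space nn_integral_completion)
  also have "\<dots> = (\<integral>\<^sup>+x. indicator unit_cell x * f x \<partial>lborel)"
    by (rule nn_integral_cong_AE, rule AE_mp[OF AE_unit_cell]) (auto split: split_indicator)
  finally show ?thesis .
qed

lemma borel_measurable_torus: "f \<in> borel_measurable borel \<Longrightarrow> f \<in> borel_measurable torus"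
  by (simp add: measurable_completion measurable_restrict_space1)

lemma nn_integral_torus_translate:
  fixes f :: "real^'n \<Rightarrow> ennreal"
  assumes [measurable]: "f \<in> borel_measurable borel" and "periodic f"
  shows "(\<integral>\<^sup>+x. f (x + y) \<partial>torus) = (\<integral>\<^sup>+x. f x \<partial>torus)"
proof -
  have "(\<lambda>x. f (x + y)) \<in> borel_measurable borel" by measurable
  from nn_integral_torus[OF this] nn_integral_torus[OF assms(1)] nn_integral_unit_cell_translate[OF assms]
  show ?thesis by (simp only:)
qed

lemma periodic_continuous_bounded:
  fixes f :: "real^'n \<Rightarrow> 'b::real_normed_vector"
  assumes c: "continuous_on UNIV f" and per: "periodic f"
  obtains B where "B > 0" "\<And>x. norm (f x) \<le> B"
proof -
  have "compact (f ` cbox 0 1)" by (intro compact_continuous_image continuous_on_subset[OF c]) auto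
  then obtain B where B: "B > 0" "\<And>x. x \<in> cbox 0 1 \<Longrightarrow> norm (f x) \<le> B"
    using compact_imp_bounded[of "f ` cbox 0 1"] bounded_pos[of "f ` cbox 0 1"] by auto
  have "norm (f x) \<le> B" for x
  proof -
    obtain z where z: "z \<in> lattice" "x - z \<in> unit_cell" using lattice_translate_unique[of x] by blast
    have "f x = f (x - z)" using periodicD[OF per z(1), of "x - z"] by simp
    thus ?thesis using B(2)[of "x - z"] z(2) unit_cell_subset(1) by auto
  qed
  thus thesis using that B(1) by blast
qed

lemma integrable_torus_continuous:
  fixes f :: "real^'n \<Rightarrow> 'b::euclidean_space"
  assumes "continuous_on UNIV f" and "periodic f"
  shows "integrable torus f"
proof -
  obtain B where "\<And>x. norm (f x) \<le> B" using periodic_continuous_bounded[OF assms] by blast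
  thus ?thesis using assms(1)
    by (intro torus.integrable_const_bound[of _ B] borel_measurable_torus borel_measurable_continuous_onI) auto
qed

lemma periodic_comp: "periodic f \<Longrightarrow> periodic (\<lambda>x. g (f x))"
  by (simp add: periodic_def)

lemma periodic_translate: "periodic f \<Longrightarrow> periodic (\<lambda>x. f (x + y))"
  unfolding periodic_def by (metis add.assoc add.commute)

lemma integral_torus_translate:
  fixes f :: "real^'n \<Rightarrow> real"
  assumes c: "continuous_on UNIV f" and per: "periodic f"
  shows "(LINT x|torus. f (x + y)) = (LINT x|torus. f x)"
proof -
  obtain B where B: "B > 0" "\<And>x. norm (f x) \<le> B" using periodic_continuous_bounded[OF c per] by blast
  have m: "f \<in> borel_measurable borel" using c by (rule borel_measurable_continuous_onI)
  have cy: "continuous_on UNIV (\<lambda>x. f (x + y))" using c by (rule continuous_on_compose2) (auto intro!: continuous_intros)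
  have ip: "integrable torus f" "integrable torus (\<lambda>x. f (x + y))"
    by (intro integrable_torus_continuous periodic_translate c cy per)+
  have nn: "0 \<le> B + f x" for x using B(2)[of x] by (simp add: abs_le_iff)
  \<comment> \<open>Translation invariance is known for nonnegative integrands; adding the bound
    \<open>B\<close> reduces to that case.\<close>
  have "ennreal (LINT x|torus. B + f (x + y)) = (\<integral>\<^sup>+x. ennreal (B + f (x + y)) \<partial>torus)"
    using ip nn by (intro nn_integral_eq_integral[symmetric]) auto
  also have "\<dots> = (\<integral>\<^sup>+x. ennreal (B + f x) \<partial>torus)"
    using m by (intro nn_integral_torus_translate[of "\<lambda>x. ennreal (B + f x)"] periodic_comp[OF per]) measurable
  also have "\<dots> = ennreal (LINT x|torus. B + f x)" using ip nn by (intro nn_integral_eq_integral) auto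
  finally have "(LINT x|torus. B + f (x + y)) = (LINT x|torus. B + f x)"
    using nn by (subst (asm) ennreal_inj) (auto intro!: integral_nonneg_AE)
  thus ?thesis using ip by simp
qed

section \<open>Gradients and smooth periodic functions\<close>

lemma grad_eqI:
  assumes "GDERIV f x :> D" shows "grad f x = D"
proof -
  have "D' = D" if "GDERIV f x :> D'" for D'
  proof -
    have "(\<lambda>h. h \<bullet> D') = (\<lambda>h. h \<bullet> D)" using that assms unfolding gderiv_def by (rule has_derivative_unique)
    thus ?thesis by (metis inner_eq_zero_iff inner_diff_right right_minus_eq)
  qed
  thus ?thesis unfolding grad_def using assms by (rule the_equality[rotated])
qed

lemma GDERIV_grad:
  fixes f :: "real^'n \<Rightarrow> real"
  assumes "f differentiable (at x)"
  shows "GDERIV f x :> grad f x"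
proof -
  obtain f' where f': "(f has_derivative f') (at x)" using assms by (auto simp: differentiable_def)
  then interpret linear f' by (rule has_derivative_linear)
  have "f' h = h \<bullet> (\<Sum>b\<in>Basis. f' b *\<^sub>R b)" for h
  proof -
    have "f' h = f' (\<Sum>b\<in>Basis. (h \<bullet> b) *\<^sub>R b)" by (simp add: euclidean_representation)
    also have "\<dots> = h \<bullet> (\<Sum>b\<in>Basis. f' b *\<^sub>R b)"
      by (simp add: sum scale inner_sum_right mult.commute)
    finally show ?thesis .
  qed
  hence "f' = (\<lambda>h. h \<bullet> (\<Sum>b\<in>Basis. f' b *\<^sub>R b))" by (rule ext)
  hence "GDERIV f x :> (\<Sum>b\<in>Basis. f' b *\<^sub>R b)" using f' by (simp add: gderiv_def)
  thus ?thesis by (simp only: grad_eqI)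
qed

lemma gderiv_lipschitz:
  fixes f :: "real^'n \<Rightarrow> real"
  assumes "\<And>x. GDERIV f x :> g x" "\<And>x. norm (g x) \<le> B"
  shows "\<bar>f y - f x\<bar> \<le> B * norm (y - x)"
proof -
  have "norm (f y - f x) \<le> B * norm (y - x)"
  proof (rule differentiable_bound[of UNIV f "\<lambda>x h. h \<bullet> g x"])
    fix x show "(f has_derivative (\<lambda>h. h \<bullet> g x)) (at x within UNIV)" using assms(1)[of x] by (simp add: gderiv_def)
    have "\<bar>h \<bullet> g x\<bar> \<le> norm h * B" for h
      by (rule order_trans[OF Cauchy_Schwarz_ineq2 mult_left_mono[OF assms(2) norm_ge_zero]])
    thus "onorm (\<lambda>h. h \<bullet> g x) \<le> B" by (intro onorm_le) (simp add: mult.commute)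
  qed auto
  thus ?thesis by simp
qed

lemma difference_quotient_limit:
  fixes f :: "real^'n \<Rightarrow> real"
  assumes "GDERIV f x :> D"
  shows "(\<lambda>k. real (Suc k) * (f (x + (1 / real (Suc k)) *\<^sub>R y) - f x)) \<longlonglongrightarrow> y \<bullet> D"
proof -
  have d: "((\<lambda>t. f (x + t *\<^sub>R y)) has_derivative (\<lambda>t. (t *\<^sub>R y) \<bullet> D)) (at 0)"
  proof -
    have "((\<lambda>t. x + t *\<^sub>R y) has_derivative (\<lambda>t. t *\<^sub>R y)) (at 0)"
      by (auto intro!: derivative_eq_intros)
    from has_derivative_compose[OF this, of f "\<lambda>h. h \<bullet> D"] assms show ?thesis by (simp add: gderiv_def)
  qed
  hence "((\<lambda>t. f (x + t *\<^sub>R y)) has_real_derivative (y \<bullet> D)) (at 0)"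
    by (simp add: has_field_derivative_def mult.commute[of _ "y \<bullet> D"] mult_commute_abs)
  hence "((\<lambda>h. (f (x + h *\<^sub>R y) - f x) / h) \<longlongrightarrow> y \<bullet> D) (at 0)"
    by (simp add: DERIV_def)
  moreover have "filterlim (\<lambda>k. 1 / real (Suc k)) (at 0) sequentially"
    unfolding filterlim_at using LIMSEQ_inverse_real_of_nat by (auto simp: inverse_eq_divide)
  ultimately have "(\<lambda>k. (f (x + (1 / real (Suc k)) *\<^sub>R y) - f x) / (1 / real (Suc k))) \<longlonglongrightarrow> y \<bullet> D"
    by (rule filterlim_compose)
  thus ?thesis by (simp add: mult.commute)
qed

text \<open>Difference quotients integrate to zero by translation invariance, are bounded through
  the Lipschitz constant, and converge to the directional derivative.\<close>

lemma integral_torus_directional_derivative: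
  fixes f :: "real^'n \<Rightarrow> real"
  assumes der: "\<And>x. GDERIV f x :> g x" and cg: "continuous_on UNIV g" and per: "periodic f" "periodic g"
  shows "(LINT x|torus. y \<bullet> g x) = 0"
proof -
  obtain B where B: "B > 0" "\<And>x. norm (g x) \<le> B" using periodic_continuous_bounded[OF cg per(2)] by blast
  have cf: "continuous_on UNIV f"
    using der unfolding gderiv_def by (intro continuous_at_imp_continuous_on ballI has_derivative_continuous) auto
  have cfy: "continuous_on UNIV (\<lambda>x. f (x + h))" for h
    using cf by (rule continuous_on_compose2) (auto intro!: continuous_intros)
  have i: "integrable torus f" "integrable torus (\<lambda>x. f (x + h))" for h
    by (intro integrable_torus_continuous periodic_translate cf cfy per)+
  let ?Q = "\<lambda>k x. real (Suc k) * (f (x + (1 / real (Suc k)) *\<^sub>R y) - f x)"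
  have "(\<lambda>k. LINT x|torus. ?Q k x) \<longlonglongrightarrow> (LINT x|torus. y \<bullet> g x)"
  proof (rule integral_dominated_convergence[where w = "\<lambda>_. B * norm y"])
    show "(\<lambda>x. y \<bullet> g x) \<in> borel_measurable torus"
      by (intro borel_measurable_torus borel_measurable_continuous_onI continuous_intros cg)
    show "?Q k \<in> borel_measurable torus" for k
      by (intro borel_measurable_torus borel_measurable_continuous_onI continuous_intros cf cfy)
    show "AE x in torus. (\<lambda>k. ?Q k x) \<longlonglongrightarrow> y \<bullet> g x"
      by (intro AE_I2 difference_quotient_limit der)
    show "AE x in torus. norm (?Q k x) \<le> B * norm y" for k
    proof (rule AE_I2)
      fix x
      have "\<bar>f (x + (1 / real (Suc k)) *\<^sub>R y) - f x\<bar> \<le> B * (norm y / real (Suc k))"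
        using gderiv_lipschitz[OF der B(2), of "x + (1 / real (Suc k)) *\<^sub>R y" x] by simp
      hence "real (Suc k) * \<bar>f (x + (1 / real (Suc k)) *\<^sub>R y) - f x\<bar> \<le> real (Suc k) * (B * (norm y / real (Suc k)))"
        by (intro mult_left_mono) auto
      also have "\<dots> = B * norm y" by simp
      finally show "norm (?Q k x) \<le> B * norm y" by (simp only: real_norm_def abs_mult abs_of_nat)
    qed
  qed auto
  moreover have "(LINT x|torus. ?Q k x) = 0" for k
    using i integral_torus_translate[OF cf per(1)] by simp
  ultimately show ?thesis by (simp add: LIMSEQ_const_iff)
qed

lemma Cinf_torusD:
  fixes \<phi> :: "real^'n \<Rightarrow> real"
  assumes "\<phi> \<in> Cinf_torus"
  shows "periodic \<phi>" "GDERIV \<phi> x :> grad \<phi> x" "continuous_on UNIV \<phi>" "continuous_on UNIV (grad \<phi>)" "periodic (grad \<phi>)"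
proof -
  show per: "periodic \<phi>" using assms by (simp add: Cinf_torus_def)
  have "Ck 0 \<phi>" "Ck (Suc 0) \<phi>" using assms by (auto simp only: Cinf_torus_def)
  hence d: "continuous_on UNIV \<phi>" "\<phi> differentiable_on UNIV" "\<And>i. continuous_on UNIV (\<lambda>x. grad \<phi> x $ i)" by simp_all
  show "continuous_on UNIV \<phi>" by (rule d)
  show der: "GDERIV \<phi> x :> grad \<phi> x" for x
    by (rule GDERIV_grad) (use d(2) in \<open>simp add: differentiable_on_def\<close>)
  have "continuous_on UNIV (\<lambda>x. \<chi> i. grad \<phi> x $ i)" by (intro continuous_on_vec_lambda d)
  thus "continuous_on UNIV (grad \<phi>)" by (simp only: vec_nth_inverse)
  show "periodic (grad \<phi>)" unfolding periodic_def
  proof (intro allI impI)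
    fix x z :: "real^'n" assume z: "\<forall>i. z $ i \<in> \<int>"
    have "((\<lambda>y. \<phi> (y + z)) has_derivative (\<lambda>h. h \<bullet> grad \<phi> (x + z))) (at x)"
    proof -
      have "((\<lambda>y. y + z) has_derivative (\<lambda>h. h)) (at x)" by (auto intro!: derivative_eq_intros)
      from has_derivative_compose[OF this, of \<phi> "\<lambda>h. h \<bullet> grad \<phi> (x + z)"] der[of "x + z"]
      show ?thesis by (simp add: gderiv_def)
    qed
    moreover have "(\<lambda>y. \<phi> (y + z)) = \<phi>" using per z by (auto simp: periodic_def)
    ultimately have "GDERIV \<phi> x :> grad \<phi> (x + z)" by (simp add: gderiv_def)
    thus "grad \<phi> (x + z) = grad \<phi> x" by (rule grad_eqI[symmetric])
  qed
qed

lemma Ck_const: "Ck k (\<lambda>x :: real^'n. c)"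
proof (induction k arbitrary: c)
  case (Suc k)
  have "grad (\<lambda>x :: real^'n. c) x = 0" for x by (rule grad_eqI[OF GDERIV_const])
  thus ?case using Suc by simp
qed (simp add: continuous_on_const)

lemma GDERIV_linear:
  assumes "GDERIV f x :> p" "GDERIV g x :> q"
  shows "GDERIV (\<lambda>x. a * f x + b * g x) x :> a *\<^sub>R p + b *\<^sub>R q"
  using assms unfolding gderiv_def by (auto intro!: derivative_eq_intros simp: inner_add_right)

lemma Ck_linear:
  assumes "Ck k f" "Ck k g"
  shows "Ck k (\<lambda>x. a * f x + b * g x)"
  using assms
proof (induction k arbitrary: f g)
  case 0 thus ?case by (auto intro!: continuous_intros)
next
  case (Suc k)
  have d: "f differentiable (at x)" "g differentiable (at x)" for x
    using Suc.prems by (auto simp: differentiable_on_def)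
  have "GDERIV (\<lambda>x. a * f x + b * g x) x :> a *\<^sub>R grad f x + b *\<^sub>R grad g x" for x
    by (intro GDERIV_linear GDERIV_grad d)
  hence "grad (\<lambda>x. a * f x + b * g x) x = a *\<^sub>R grad f x + b *\<^sub>R grad g x" for x
    by (rule grad_eqI)
  moreover have "(\<lambda>x. a * f x + b * g x) differentiable_on UNIV"
    using Suc.prems by (auto intro!: derivative_intros)
  ultimately show ?case using Suc by simp
qed

lemma Cinf_torus_const: "(\<lambda>x. c) \<in> Cinf_torus"
  by (simp add: Cinf_torus_def Ck_const periodic_def)

lemma Cinf_torus_linear:
  assumes "\<phi> \<in> Cinf_torus" "\<psi> \<in> Cinf_torus"
  shows "(\<lambda>x. a * \<phi> x + b * \<psi> x) \<in> Cinf_torus"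
    and "grad (\<lambda>x. a * \<phi> x + b * \<psi> x) x = a *\<^sub>R grad \<phi> x + b *\<^sub>R grad \<psi> x"
proof -
  show "(\<lambda>x. a * \<phi> x + b * \<psi> x) \<in> Cinf_torus"
    using assms by (auto simp: Cinf_torus_def Ck_linear periodic_def)
  show "grad (\<lambda>x. a * \<phi> x + b * \<psi> x) x = a *\<^sub>R grad \<phi> x + b *\<^sub>R grad \<psi> x"
    by (intro grad_eqI GDERIV_linear Cinf_torusD(2) assms)
qed

text \<open>The derivative of the product of the two functions has mean zero.\<close>

lemma torus_integration_by_parts:
  assumes "\<phi> \<in> Cinf_torus" "\<psi> \<in> Cinf_torus"
  shows "(LINT x|torus. \<phi> x * (grad \<psi> x $ i)) = - (LINT x|torus. (grad \<phi> x $ i) * \<psi> x)"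
proof -
  note a = Cinf_torusD[OF assms(1)] and b = Cinf_torusD[OF assms(2)]
  have per: "periodic (\<lambda>x. \<phi> x * (grad \<psi> x $ i))" "periodic (\<lambda>x. (grad \<phi> x $ i) * \<psi> x)" 
     "periodic (\<lambda>x. \<phi> x * \<psi> x)" "periodic (\<lambda>x. \<phi> x *\<^sub>R grad \<psi> x + \<psi> x *\<^sub>R grad \<phi> x)"
    using a(1,5) b(1,5) by (simp_all add: periodic_def)
  have i: "integrable torus (\<lambda>x. \<phi> x * (grad \<psi> x $ i))" "integrable torus (\<lambda>x. (grad \<phi> x $ i) * \<psi> x)"
    by (intro integrable_torus_continuous per continuous_intros a b)+
  have "GDERIV (\<lambda>x. \<phi> x * \<psi> x) x :> \<phi> x *\<^sub>R grad \<psi> x + \<psi> x *\<^sub>R grad \<phi> x" for x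
    by (rule GDERIV_mult[OF a(2) b(2)])
  moreover have "continuous_on UNIV (\<lambda>x. \<phi> x *\<^sub>R grad \<psi> x + \<psi> x *\<^sub>R grad \<phi> x)"
    by (intro continuous_intros a b)
  ultimately have "(LINT x|torus. axis i 1 \<bullet> (\<phi> x *\<^sub>R grad \<psi> x + \<psi> x *\<^sub>R grad \<phi> x)) = 0"
    using per(3,4) by (rule integral_torus_directional_derivative)
  moreover have "axis i 1 \<bullet> (\<phi> x *\<^sub>R grad \<psi> x + \<psi> x *\<^sub>R grad \<phi> x) = \<phi> x * (grad \<psi> x $ i) + (grad \<phi> x $ i) * \<psi> x" for x
    by (simp add: inner_axis' mult.commute)
  ultimately show ?thesis using i by simp
qed

section \<open>Poincare's inequality for smooth functions\<close>

lemma abs_powr_convex: "p \<ge> 1 \<Longrightarrow> convex_on UNIV (\<lambda>x :: real. \<bar>x\<bar> powr p)"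
  using norm_powr_convex[where 'a = real, of p] by (intro convex_onI) auto

lemma continuous_on_norm_powr:
  fixes f :: "'a::topological_space \<Rightarrow> 'b::real_normed_vector"
  assumes "continuous_on S f" "p > 0"
  shows "continuous_on S (\<lambda>x. norm (f x) powr p)"
  using assms by (intro continuous_on_powr' continuous_intros) auto

lemma continuous_on_abs_powr:
  fixes f :: "'a::topological_space \<Rightarrow> real"
  assumes "continuous_on S f" "p > 0"
  shows "continuous_on S (\<lambda>x. \<bar>f x\<bar> powr p)"
  using continuous_on_norm_powr[OF assms] by simp

lemma abs_sum_powr_le:
  fixes a :: "nat \<Rightarrow> real"
  assumes p: "p \<ge> 1" and N: "N > 0"
  shows "\<bar>\<Sum>j<N. a j\<bar> powr p \<le> real N powr (p - 1) * (\<Sum>j<N. \<bar>a j\<bar> powr p)"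
proof -
  have "\<bar>\<Sum>j<N. (1 / real N) *\<^sub>R a j\<bar> powr p \<le> (\<Sum>j<N. (1 / real N) * \<bar>a j\<bar> powr p)"
    by (rule convex_on_sum[OF _ _ abs_powr_convex[OF p]]) (use N in auto)
  also have "(\<Sum>j<N. (1 / real N) *\<^sub>R a j) = (\<Sum>j<N. a j) / real N" by (simp add: sum_divide_distrib)
  also have "\<bar>(\<Sum>j<N. a j) / real N\<bar> powr p = \<bar>\<Sum>j<N. a j\<bar> powr p / real N powr p"
    using N by (simp add: abs_divide powr_divide)
  also have "(\<Sum>j<N. (1 / real N) * \<bar>a j\<bar> powr p) = (\<Sum>j<N. \<bar>a j\<bar> powr p) / real N"
    by (simp add: sum_divide_distrib)
  finally have "\<bar>\<Sum>j<N. a j\<bar> powr p \<le> real N powr p * ((\<Sum>j<N. \<bar>a j\<bar> powr p) / real N)"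
    using N by (simp add: pos_divide_le_eq mult.commute)
  also have "real N powr p * ((\<Sum>j<N. \<bar>a j\<bar> powr p) / real N) = real N powr (p - 1) * (\<Sum>j<N. \<bar>a j\<bar> powr p)"
    using N by (simp add: powr_diff)
  finally show ?thesis .
qed

text \<open>The translation is cut into equal small steps. Jensen's inequality and translation
  invariance bound the whole difference by a difference quotient of one small step, uniformly in
  their number, and these quotients converge to \<open>y \<bullet> grad \<phi>\<close>. No
  integration along segments occurs.\<close>

lemma torus_translation_difference:
  fixes \<phi> :: "real^'n \<Rightarrow> real"
  assumes phi: "\<phi> \<in> Cinf_torus" and p: "p \<ge> 1"
  shows "(LINT x|torus. \<bar>\<phi> (x + y) - \<phi> x\<bar> powr p) \<le> norm y powr p * (LINT x|torus. norm (grad \<phi> x) powr p)"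
proof -
  note a = Cinf_torusD[OF phi]
  have p0: "p > 0" using p by simp
  obtain B where B: "B > 0" "\<And>x. norm (grad \<phi> x) \<le> B" using periodic_continuous_bounded[OF a(4,5)] by blast
  have cy: "continuous_on UNIV (\<lambda>x. \<phi> (x + h))" for h
    using a(3) by (rule continuous_on_compose2) (auto intro!: continuous_intros)
  have cd: "continuous_on UNIV (\<lambda>x. \<bar>\<phi> (x + h) - \<phi> x\<bar> powr p)" for h
    using p0 by (intro continuous_on_abs_powr continuous_on_norm_powr continuous_intros cy a) auto
  have pd: "periodic (\<lambda>x. \<bar>\<phi> (x + h) - \<phi> x\<bar> powr p)" for h
    using a(1) periodic_translate[OF a(1), of h] by (simp add: periodic_def)
  have id: "integrable torus (\<lambda>x. \<bar>\<phi> (x + h) - \<phi> x\<bar> powr p)" for h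
    by (rule integrable_torus_continuous[OF cd pd])
  let ?Q = "\<lambda>k x. real (Suc k) * (\<phi> (x + (1 / real (Suc k)) *\<^sub>R y) - \<phi> x)"
  have step: "(LINT x|torus. \<bar>\<phi> (x + y) - \<phi> x\<bar> powr p) \<le> (LINT x|torus. \<bar>?Q k x\<bar> powr p)" for k
  proof -
    define N where "N = Suc k"
    define h where "h = (1 / real N) *\<^sub>R y"
    define b where "b j x = \<phi> (x + real j *\<^sub>R h + h) - \<phi> (x + real j *\<^sub>R h)" for j x
    have N0: "N > 0" by (simp add: N_def)
    have Nh: "real N *\<^sub>R h = y" using N0 by (simp add: h_def)
    have tele: "(\<Sum>j<N. b j x) = \<phi> (x + y) - \<phi> x" for x
    proof -
      have "(\<Sum>j<N. b j x) = (\<Sum>j<N. \<phi> (x + real (Suc j) *\<^sub>R h) - \<phi> (x + real j *\<^sub>R h))"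
        by (intro sum.cong refl) (simp add: b_def algebra_simps)
      also have "\<dots> = \<phi> (x + real N *\<^sub>R h) - \<phi> (x + real 0 *\<^sub>R h)" by (rule sum_lessThan_telescope)
      finally show ?thesis by (simp add: Nh)
    qed
    have bt: "(LINT x|torus. \<bar>b j x\<bar> powr p) = (LINT x|torus. \<bar>\<phi> (x + h) - \<phi> x\<bar> powr p)" for j
      using integral_torus_translate[OF cd[of h] pd[of h], of "real j *\<^sub>R h"] by (simp add: b_def)
    have bi: "integrable torus (\<lambda>x. \<bar>b j x\<bar> powr p)" for j
    proof (rule integrable_torus_continuous)
      have "continuous_on UNIV (\<lambda>x. \<bar>\<phi> (x + real j *\<^sub>R h + h) - \<phi> (x + real j *\<^sub>R h)\<bar> powr p)"
        using cd[of h] by (rule continuous_on_compose2[of UNIV _ UNIV "\<lambda>x. x + real j *\<^sub>R h"]) (auto intro!: continuous_intros)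
      thus "continuous_on UNIV (\<lambda>x. \<bar>b j x\<bar> powr p)" by (simp add: b_def)
      show "periodic (\<lambda>x. \<bar>b j x\<bar> powr p)"
        using periodic_translate[OF pd[of h], of "real j *\<^sub>R h"] by (simp add: b_def)
    qed
    have "(LINT x|torus. \<bar>\<phi> (x + y) - \<phi> x\<bar> powr p) \<le> (LINT x|torus. real N powr (p - 1) * (\<Sum>j<N. \<bar>b j x\<bar> powr p))"
    proof (intro integral_mono id)
      show "integrable torus (\<lambda>x. real N powr (p - 1) * (\<Sum>j<N. \<bar>b j x\<bar> powr p))"
        by (intro integrable_mult_right Bochner_Integration.integrable_sum bi)
      fix x show "\<bar>\<phi> (x + y) - \<phi> x\<bar> powr p \<le> real N powr (p - 1) * (\<Sum>j<N. \<bar>b j x\<bar> powr p)"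
        using abs_sum_powr_le[OF p N0, of "\<lambda>j. b j x"] by (simp only: tele)
    qed
    also have "\<dots> = real N powr (p - 1) * (real N * (LINT x|torus. \<bar>\<phi> (x + h) - \<phi> x\<bar> powr p))"
      by (simp add: Bochner_Integration.integral_sum[OF bi] bt)
    also have "\<dots> = real N powr p * (LINT x|torus. \<bar>\<phi> (x + h) - \<phi> x\<bar> powr p)"
      using N0 by (simp add: powr_diff)
    also have "\<dots> = (LINT x|torus. real N powr p * \<bar>\<phi> (x + h) - \<phi> x\<bar> powr p)" by simp
    also have "\<dots> = (LINT x|torus. \<bar>?Q k x\<bar> powr p)"
      unfolding N_def[symmetric] h_def[symmetric] abs_mult by (simp add: powr_mult)
    finally show ?thesis .
  qed
  have "(\<lambda>k. LINT x|torus. \<bar>?Q k x\<bar> powr p) \<longlonglongrightarrow> (LINT x|torus. \<bar>y \<bullet> grad \<phi> x\<bar> powr p)"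
  proof (rule integral_dominated_convergence[where w = "\<lambda>_. (B * norm y) powr p"])
    show "(\<lambda>x. \<bar>y \<bullet> grad \<phi> x\<bar> powr p) \<in> borel_measurable torus"
      using p0 by (intro borel_measurable_torus borel_measurable_continuous_onI continuous_on_abs_powr continuous_on_norm_powr continuous_intros a) auto
    show "(\<lambda>x. \<bar>?Q k x\<bar> powr p) \<in> borel_measurable torus" for k
      using p0 by (intro borel_measurable_torus borel_measurable_continuous_onI continuous_on_abs_powr continuous_on_norm_powr continuous_intros a cy) auto
    show "AE x in torus. (\<lambda>k. \<bar>?Q k x\<bar> powr p) \<longlonglongrightarrow> \<bar>y \<bullet> grad \<phi> x\<bar> powr p"
      by (rule AE_I2, rule tendsto_powr', rule tendsto_rabs, rule difference_quotient_limit[OF a(2)]) (use p0 in auto)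
    show "AE x in torus. norm (\<bar>?Q k x\<bar> powr p) \<le> (B * norm y) powr p" for k
    proof (rule AE_I2)
      fix x
      have "\<bar>\<phi> (x + (1 / real (Suc k)) *\<^sub>R y) - \<phi> x\<bar> \<le> B * (norm y / real (Suc k))"
        using gderiv_lipschitz[OF a(2) B(2), of "x + (1 / real (Suc k)) *\<^sub>R y" x] by simp
      hence "real (Suc k) * \<bar>\<phi> (x + (1 / real (Suc k)) *\<^sub>R y) - \<phi> x\<bar> \<le> real (Suc k) * (B * (norm y / real (Suc k)))"
        by (intro mult_left_mono) auto
      also have "\<dots> = B * norm y" by simp
      finally have "\<bar>?Q k x\<bar> \<le> B * norm y" by (simp only: abs_mult abs_of_nat)
      hence "\<bar>?Q k x\<bar> powr p \<le> (B * norm y) powr p" using p0 by (intro powr_mono2) auto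
      thus "norm (\<bar>?Q k x\<bar> powr p) \<le> (B * norm y) powr p" by (simp only: real_norm_def abs_of_nonneg powr_ge_zero)
    qed
  qed auto
  hence "(LINT x|torus. \<bar>\<phi> (x + y) - \<phi> x\<bar> powr p) \<le> (LINT x|torus. \<bar>y \<bullet> grad \<phi> x\<bar> powr p)"
    by (rule LIMSEQ_le_const) (use step in blast)
  also have "\<dots> \<le> (LINT x|torus. norm y powr p * norm (grad \<phi> x) powr p)"
  proof (rule integral_mono)
    show "integrable torus (\<lambda>x. \<bar>y \<bullet> grad \<phi> x\<bar> powr p)" "integrable torus (\<lambda>x. norm y powr p * norm (grad \<phi> x) powr p)"
      using p0 a(5)
      by (intro integrable_torus_continuous continuous_on_abs_powr continuous_on_norm_powr continuous_intros a;
          simp add: periodic_def)+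
    fix x
    have "\<bar>y \<bullet> grad \<phi> x\<bar> powr p \<le> (norm y * norm (grad \<phi> x)) powr p"
      using Cauchy_Schwarz_ineq2[of y "grad \<phi> x"] p0 by (intro powr_mono2) auto
    thus "\<bar>y \<bullet> grad \<phi> x\<bar> powr p \<le> norm y powr p * norm (grad \<phi> x) powr p" by (simp add: powr_mult)
  qed
  also have "\<dots> = norm y powr p * (LINT x|torus. norm (grad \<phi> x) powr p)" by simp
  finally show ?thesis .
qed

lemma prob_torus_cbox [simp]: "measure torus (cbox 0 (1 :: real^'n)) = 1"
  using torus.prob_space by (simp add: space_restrict_space)

text \<open>By translation invariance the mean is the average of \<open>\<phi> (x + y)\<close> over
  \<open>y\<close>. Jensen's inequality and Fubini's theorem then reduce the claim to the estimate
  for single translations.\<close>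

lemma torus_poincare:
  fixes \<phi> :: "real^'n \<Rightarrow> real"
  assumes phi: "\<phi> \<in> Cinf_torus" and p: "p \<ge> 1"
  shows "Lp_mod torus p (\<lambda>x. \<phi> x - (LINT y|torus. \<phi> y)) \<le> norm (1 :: real^'n) powr p * Lp_mod torus p (grad \<phi>)"
proof -
  note a = Cinf_torusD[OF phi]
  have p0: "p > 0" using p by simp
  interpret T: pair_prob_space "torus :: (real^'n) measure" "torus :: (real^'n) measure" ..
  obtain B where B: "B > 0" "\<And>x. norm (\<phi> x) \<le> B" using periodic_continuous_bounded[OF a(3,1)] by blast
  define m where "m = (LINT y|torus. \<phi> y)"
  define G where "G x y = \<bar>\<phi> x - \<phi> (x + y)\<bar> powr p" for x y
  have cy: "continuous_on UNIV (\<lambda>x. \<phi> (x + h))" "continuous_on UNIV (\<lambda>x. \<phi> (h + x))" for h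
    using a(3) by (rule continuous_on_compose2, auto intro!: continuous_intros)+
  have G_le: "\<bar>G x y\<bar> \<le> (2 * B) powr p" for x y
  proof -
    have "\<bar>\<phi> x - \<phi> (x + y)\<bar> \<le> 2 * B" using B(2)[of x] B(2)[of "x + y"] unfolding real_norm_def by linarith
    hence "G x y \<le> (2 * B) powr p" unfolding G_def using p0 by (intro powr_mono2) auto
    thus ?thesis by (simp add: G_def)
  qed
  have "(\<lambda>z :: (real^'n) \<times> (real^'n). G (fst z) (snd z)) \<in> borel_measurable borel"
    unfolding G_def using p0
    by (intro borel_measurable_continuous_onI continuous_on_abs_powr continuous_on_norm_powr continuous_intros continuous_on_compose2[OF a(3)]) auto
  moreover have "(\<lambda>z. z) \<in> torus \<Otimes>\<^sub>M torus \<rightarrow>\<^sub>M (borel :: ((real^'n) \<times> (real^'n)) measure)"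
  proof -
    have "(\<lambda>x. x) \<in> borel_measurable (torus :: (real^'n) measure)" by (rule borel_measurable_torus) simp
    from measurable_compose[OF measurable_fst this] measurable_compose[OF measurable_snd this]
    show ?thesis unfolding borel_prod[symmetric] by (intro measurable_pair) (auto simp: comp_def)
  qed
  ultimately have Gm: "(\<lambda>z. G (fst z) (snd z)) \<in> borel_measurable (torus \<Otimes>\<^sub>M torus)"
    using measurable_compose by blast
  have Gi: "integrable (torus \<Otimes>\<^sub>M torus) (case_prod G)"
    by (rule T.P.integrable_const_bound[of _ "(2 * B) powr p"]) (use Gm G_le in \<open>auto simp: split_beta'\<close>)
  have Gx: "integrable torus (G x)" for x
    using G_le p0 unfolding G_def
    by (intro torus.integrable_const_bound[of _ "(2 * B) powr p"] borel_measurable_torus borel_measurable_continuous_onI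
       continuous_on_abs_powr continuous_on_norm_powr continuous_intros cy) auto
  have Gy: "integrable torus (\<lambda>x. G x y)" for y
    using G_le p0 unfolding G_def
    by (intro torus.integrable_const_bound[of _ "(2 * B) powr p"] borel_measurable_torus borel_measurable_continuous_onI
       continuous_on_abs_powr continuous_on_norm_powr continuous_intros cy a) auto
  have jensen: "\<bar>\<phi> x - m\<bar> powr p \<le> (LINT y|torus. G x y)" for x
  proof -
    have per: "periodic (\<lambda>y. \<phi> (x + y))" using periodic_translate[OF a(1), of x] by (simp add: add.commute)
    have i: "integrable torus (\<lambda>y. \<phi> (x + y))" by (rule integrable_torus_continuous[OF cy(2) per])
    have "(LINT y|torus. \<phi> (x + y)) = m"
      using integral_torus_translate[OF a(3,1), of x] by (simp add: m_def add.commute)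
    hence "(LINT y|torus. \<phi> x - \<phi> (x + y)) = \<phi> x - m" using i by simp
    moreover have "\<bar>LINT y|torus. \<phi> x - \<phi> (x + y)\<bar> powr p \<le> (LINT y|torus. \<bar>\<phi> x - \<phi> (x + y)\<bar> powr p)"
      by (rule torus.jensens_inequality[where I = UNIV]) (use i abs_powr_convex[OF p] Gx[of x, unfolded G_def] in auto)
    ultimately show ?thesis by (simp add: G_def)
  qed
  have im: "integrable torus (\<lambda>x. \<bar>\<phi> x - m\<bar> powr p)"
    using p0 a(1) by (intro integrable_torus_continuous continuous_on_abs_powr continuous_intros a) (auto simp: periodic_def)
  have "Lp_mod torus p (\<lambda>x. \<phi> x - m) \<le> (LINT x|torus. LINT y|torus. G x y)"
    unfolding Lp_mod_def real_norm_def using jensen T.integrable_fst'[OF Gi] im by (intro integral_mono) (auto simp: split_beta')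
  also have "\<dots> = (LINT y|torus. LINT x|torus. G x y)" by (rule T.Fubini_integral[OF Gi, symmetric])
  \<comment> \<open>Here \<open>y\<close> runs through the unit cube, so its norm is at most that of
    the vector \<open>1\<close>; this is the origin of the constant.\<close>
  also have "\<dots> \<le> (LINT y|(torus :: (real^'n) measure). norm (1 :: real^'n) powr p * Lp_mod torus p (grad \<phi>))"
  proof (rule integral_mono)
    show "integrable torus (\<lambda>y. LINT x|torus. G x y)" using T.integrable_snd[OF Gi] .
    fix y :: "real^'n" assume "y \<in> space torus"
    hence y: "y \<in> cbox 0 1" by (simp add: space_restrict_space)
    have "(LINT x|torus. G x y) \<le> norm y powr p * Lp_mod torus p (grad \<phi>)"
      using torus_translation_difference[OF phi p, of y] by (simp add: G_def Lp_mod_def abs_minus_commute)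
    also have "\<dots> \<le> norm (1 :: real^'n) powr p * Lp_mod torus p (grad \<phi>)"
      using y p0 by (intro mult_right_mono powr_mono2 norm_le_componentwise_cart) (auto simp: mem_box_cart)
    finally show "(LINT x|torus. G x y) \<le> norm (1 :: real^'n) powr p * Lp_mod torus p (grad \<phi>)" .
  qed simp
  also have "\<dots> = norm (1 :: real^'n) powr p * Lp_mod torus p (grad \<phi>)" by simp
  finally show ?thesis by (simp add: m_def)
qed

section \<open>Monotone Hamiltonians at a point\<close>

text \<open>Real-valued counterpart of \<open>H_ext\<close>. A real number suffices since growth and
  monotonicity keep the limit at mass zero finite.\<close>

definition hval :: "(real^'n \<Rightarrow> real \<Rightarrow> real) \<Rightarrow> real^'n \<Rightarrow> real \<Rightarrow> real" where
  "hval h p m = (if m > 0 then h p m else Lim (at_right 0) (h p))"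

text \<open>The growth condition on the gradient forces the one-sided limit of the flux at \<open>m = 0\<close> to be \<open>0\<close>.\<close>

definition hflux :: "(real^'n \<Rightarrow> real \<Rightarrow> real) \<Rightarrow> real^'n \<Rightarrow> real \<Rightarrow> real^'n" where
  "hflux h p m = (if m > 0 then m *\<^sub>R grad (\<lambda>q. h q m) p else 0)"

text \<open>The hypotheses at one fixed point of the torus, with a constant \<open>C\<close> common
  to almost all points. Assertions that hold almost everywhere are thereby reduced to pointwise
  ones.\<close>

locale monotone_hamiltonian =
  fixes h :: "real^'n \<Rightarrow> real \<Rightarrow> real" and \<alpha> \<beta> C :: real
  assumes \<alpha>: "\<alpha> > 1" and \<beta>: "\<beta> > 0" and C: "C > 0"
    and cont: "continuous_on (UNIV \<times> {0<..}) (\<lambda>(p, m). h p m)"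
    and diff: "\<And>m. m > 0 \<Longrightarrow> (\<lambda>p. h p m) differentiable_on UNIV"
    and cont_grad: "continuous_on (UNIV \<times> {0<..}) (\<lambda>(p, m). grad (\<lambda>q. h q m) p)"
    and mono: "\<And>p1 p2 m1 m2. m1 > 0 \<Longrightarrow> m2 > 0 \<Longrightarrow>
        (- h p1 m1 + h p2 m2) * (m1 - m2)
        + (m1 *\<^sub>R grad (\<lambda>q. h q m1) p1 - m2 *\<^sub>R grad (\<lambda>q. h q m2) p2) \<bullet> (p1 - p2) \<ge> 0"
    and growth0: "\<And>m. m > 0 \<Longrightarrow> h 0 m \<le> - (1 / C) * m powr \<beta> + C"
    and growth_grad: "\<And>p m. m > 0 \<Longrightarrow> norm (grad (\<lambda>q. h q m) p) \<le> C * (norm p powr (\<alpha> - 1) + m powr (\<beta> - \<beta> / \<alpha>) + 1)"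
    and growth: "\<And>p m. m > 0 \<Longrightarrow> h p m \<ge> (1 / C) * norm p powr \<alpha> - C * (m powr \<beta> + 1)"
begin

abbreviation dh :: "real^'n \<Rightarrow> real \<Rightarrow> real^'n" where
  "dh p m \<equiv> grad (\<lambda>q. h q m) p"

abbreviation gr :: "real \<Rightarrow> real \<Rightarrow> real" where
  "gr P M \<equiv> P powr \<alpha> + M powr \<beta> + 1"

lemma gderiv: "m > 0 \<Longrightarrow> GDERIV (\<lambda>q. h q m) p :> dh p m"
  using diff[of m] by (intro GDERIV_grad) (auto simp: differentiable_on_def)

lemma gr_mono: "0 \<le> P \<Longrightarrow> P \<le> P' \<Longrightarrow> 0 \<le> M \<Longrightarrow> M \<le> M' \<Longrightarrow> gr P M \<le> gr P' M'"
  using \<alpha> \<beta> by (intro add_mono powr_mono2) auto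

text \<open>The exponent \<open>\<beta> - \<beta> / \<alpha>\<close> equals
  \<open>(\<beta> / \<alpha>) * (\<alpha> - 1)\<close>. With
  \<open>a = M powr (\<beta> / \<alpha>)\<close> the mixed term becomes
  \<open>a powr (\<alpha> - 1) * P\<close>, which is at most the power \<open>\<alpha>\<close> of
  the larger of \<open>a\<close> and \<open>P\<close>.\<close>

lemma growth_times:
  assumes "P \<ge> 0" "M \<ge> 0"
  shows "(P powr (\<alpha> - 1) + M powr (\<beta> - \<beta> / \<alpha>) + 1) * P \<le> 3 * gr P M"
proof -
  define a where "a = M powr (\<beta> / \<alpha>)"
  have a0: "a \<ge> 0" by (simp add: a_def)
  have e: "x powr (\<alpha> - 1) * x = x powr \<alpha>" if "x \<ge> 0" for x :: real
    using that by (cases "x = 0") (simp_all add: powr_diff)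
  have "M powr (\<beta> - \<beta> / \<alpha>) = a powr (\<alpha> - 1)"
    using \<alpha> by (simp add: a_def powr_powr field_simps)
  moreover have "a powr (\<alpha> - 1) * P \<le> max a P powr (\<alpha> - 1) * max a P"
    using a0 assms \<alpha> by (intro mult_mono powr_mono2) auto
  moreover have "max a P powr (\<alpha> - 1) * max a P = max a P powr \<alpha>" using assms by (intro e) auto
  moreover have "max a P powr \<alpha> \<le> a powr \<alpha> + P powr \<alpha>" by (auto simp: max_def)
  moreover have "a powr \<alpha> = M powr \<beta>" using \<alpha> by (simp add: a_def powr_powr)
  ultimately have 1: "M powr (\<beta> - \<beta> / \<alpha>) * P \<le> M powr \<beta> + P powr \<alpha>" by simp
  have 2: "P \<le> 1 + P powr \<alpha>" using powr_le_one_add_powr[of P 1 \<alpha>] assms \<alpha> by simp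
  have "y \<le> u + v \<Longrightarrow> z \<le> 1 + v \<Longrightarrow> 0 \<le> u \<Longrightarrow> v + y + z \<le> 3 * (v + u + 1)" for y z u v :: real by simp
  from this[OF 1 2 powr_ge_zero] show ?thesis unfolding distrib_right e[OF assms(1)] mult_1 .
qed

lemma grad_inner_bound:
  assumes "m > 0" "norm p \<le> P" "m \<le> M" "norm r \<le> P"
  shows "\<bar>dh p m \<bullet> r\<bar> \<le> 3 * C * gr P M"
proof -
  have P0: "P \<ge> 0" using assms(2) norm_ge_zero order_trans by blast
  have e: "\<beta> - \<beta> / \<alpha> \<ge> 0" using \<alpha> \<beta> by (simp add: field_simps)
  have "\<bar>dh p m \<bullet> r\<bar> \<le> norm (dh p m) * norm r" by (rule Cauchy_Schwarz_ineq2)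
  also have "\<dots> \<le> (C * (norm p powr (\<alpha> - 1) + m powr (\<beta> - \<beta> / \<alpha>) + 1)) * P"
    using growth_grad[OF assms(1), of p] assms(4) by (intro mult_mono) (auto intro: order_trans[OF norm_ge_zero])
  also have "\<dots> \<le> (C * (P powr (\<alpha> - 1) + M powr (\<beta> - \<beta> / \<alpha>) + 1)) * P"
    using assms(1-3) P0 C \<alpha> e by (intro mult_mono mult_left_mono add_mono powr_mono2) auto
  also have "\<dots> = C * ((P powr (\<alpha> - 1) + M powr (\<beta> - \<beta> / \<alpha>) + 1) * P)" by (rule mult.assoc)
  also have "\<dots> \<le> C * (3 * gr P M)"
    using growth_times[of P M] assms P0 C by (intro mult_left_mono) auto
  also have "\<dots> = 3 * C * gr P M" by simp
  finally show ?thesis .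
qed

lemma segment_mvt:
  assumes "m > 0"
  obtains s where "0 < s" "s < 1" "h p m - h q m = dh (q + s *\<^sub>R (p - q)) m \<bullet> (p - q)"
proof -
  define f where "f s = h (q + s *\<^sub>R (p - q)) m" for s
  have f: "(f has_real_derivative dh (q + s *\<^sub>R (p - q)) m \<bullet> (p - q)) (at s)" for s
  proof -
    have "((\<lambda>s. q + s *\<^sub>R (p - q)) has_derivative (\<lambda>t. t *\<^sub>R (p - q))) (at s)"
      by (auto intro!: derivative_eq_intros)
    from has_derivative_compose[OF this gderiv[OF assms, unfolded gderiv_def]]
    show ?thesis unfolding f_def has_field_derivative_def
      by (simp add: inner_commute mult.commute[of _ "(p - q) \<bullet> _"] mult_commute_abs)
  qed
  obtain s where "0 < s" "s < 1" "f 1 - f 0 = (1 - 0) * (dh (q + s *\<^sub>R (p - q)) m \<bullet> (p - q))"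
    using MVT2[of 0 1 f "\<lambda>s. dh (q + s *\<^sub>R (p - q)) m \<bullet> (p - q)"] f by auto
  thus thesis using that by (simp add: f_def)
qed

lemma antimono_mass:
  assumes "0 < m1" "m1 \<le> m2"
  shows "h p m2 \<le> h p m1"
proof (cases "m1 = m2")
  case False
  hence "(h p m1 - h p m2) * (m2 - m1) \<ge> 0" using mono[of m2 m1 p p] assms by (simp add: algebra_simps)
  thus ?thesis using False assms by (simp add: zero_le_mult_iff)
qed simp

text \<open>Monotonicity at equal masses says that the gradient is monotone in \<open>p\<close>,
  hence that \<open>h\<close> is convex in \<open>p\<close>; the tangent at \<open>p\<close> then
  lies below the graph at \<open>0\<close>.\<close>

lemma convex_bound:
  assumes m: "m > 0"
  shows "h p m - dh p m \<bullet> p \<le> h 0 m"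
proof -
  obtain s where s: "0 < s" "s < 1" "h p m - h 0 m = dh (s *\<^sub>R p) m \<bullet> p"
    using segment_mvt[OF m, of p 0] by auto
  have "m * ((dh p m - dh (s *\<^sub>R p) m) \<bullet> (p - s *\<^sub>R p)) \<ge> 0"
    using mono[OF m m, of p "s *\<^sub>R p"] by (simp add: scaleR_diff_right[symmetric])
  hence "(dh p m - dh (s *\<^sub>R p) m) \<bullet> ((1 - s) *\<^sub>R p) \<ge> 0"
    using m by (simp add: zero_le_mult_iff scaleR_diff_left)
  hence "(dh p m - dh (s *\<^sub>R p) m) \<bullet> p \<ge> 0" using s by (simp add: zero_le_mult_iff)
  thus ?thesis using s(3) by (simp add: inner_diff_left)
qed

text \<open>No upper growth of \<open>h\<close> is assumed. It is obtained from the value at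
  \<open>p = 0\<close> by convexity and the bound on the gradient.\<close>

lemma abs_bound:
  assumes "m > 0"
  shows "\<bar>h p m\<bar> \<le> 4 * C * gr (norm p) m"
proof -
  define g where "g = C * gr (norm p) m"
  have g: "C \<le> g" "C * (m powr \<beta> + 1) \<le> g" using C by (simp_all add: g_def)
  have b: "dh p m \<bullet> p \<le> 3 * g"
    unfolding g_def mult.assoc[symmetric] by (rule abs_le_D1[OF grad_inner_bound[OF assms order_refl order_refl order_refl]])
  have pos: "1 / C \<ge> 0" using C by simp
  have "- (1 / C) * m powr \<beta> \<le> 0"
    unfolding mult_minus_left neg_le_0_iff_le by (intro mult_nonneg_nonneg pos powr_ge_zero)
  hence "- (1 / C) * m powr \<beta> + C \<le> C" by (simp only: add_le_same_cancel2)
  with growth0[OF assms] have "h 0 m \<le> C" by (rule order_trans)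
  moreover have "h p m \<le> h 0 m + dh p m \<bullet> p" using convex_bound[OF assms, of p] by simp
  ultimately have 1: "h p m \<le> 4 * g" using b g(1) by linarith
  define x y where "x = (1 / C) * norm p powr \<alpha>" and "y = C * (m powr \<beta> + 1)"
  have "x \<ge> 0" unfolding x_def by (intro mult_nonneg_nonneg pos powr_ge_zero)
  moreover have "g \<ge> 0" using C g(1) by linarith
  moreover have "y \<le> g" unfolding y_def by (rule g(2))
  moreover have "x - y \<le> h p m" unfolding x_def y_def by (rule growth[OF assms])
  ultimately have "- (4 * g) \<le> h p m" by linarith
  hence "\<bar>h p m\<bar> \<le> 4 * g" using 1 by (intro abs_leI) auto
  thus ?thesis by (simp add: g_def mult.assoc)
qed

text \<open>As \<open>m\<close> decreases, \<open>h p m\<close> increases, and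
  \<open>abs_bound\<close> on masses up to \<open>1\<close> keeps it bounded. The one-sided limit is
  therefore a finite supremum.\<close>

lemma mass_limit: "((h p) \<longlongrightarrow> hval h p 0) (at_right 0)"
proof -
  define S where "S = (SUP m\<in>{0<..}. h p m)"
  have bdd: "bdd_above (h p ` {0<..})"
  proof (rule bdd_aboveI)
    fix y assume "y \<in> h p ` {0<..}"
    then obtain m where m: "m > 0" "y = h p m" by auto
    have "y \<le> h p (min m 1)" using m antimono_mass[of "min m 1" m p] by auto
    also have "\<dots> \<le> 4 * C * gr (norm p) (min m 1)" using abs_bound[of "min m 1" p] m by auto
    also have "\<dots> \<le> 4 * C * gr (norm p) 1" using m C gr_mono[of "norm p" "norm p" "min m 1" 1] by (intro mult_left_mono) auto
    finally show "y \<le> 4 * C * gr (norm p) 1" .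
  qed
  have "((h p) \<longlongrightarrow> S) (at_right 0)"
  proof (rule order_tendstoI)
    fix a assume "a < S"
    then obtain m where m: "m > 0" "a < h p m" unfolding S_def using bdd by (subst (asm) less_cSUP_iff) auto
    thus "\<forall>\<^sub>F x in at_right 0. a < h p x"
      unfolding eventually_at_right_field by (intro exI[of _ m]) (auto intro: less_le_trans[OF _ antimono_mass])
  next
    fix a assume "S < a"
    thus "\<forall>\<^sub>F x in at_right 0. h p x < a"
      unfolding eventually_at_right_field S_def using bdd
      by (intro exI[of _ 1]) (auto intro: le_less_trans[OF cSUP_upper])
  qed
  thus ?thesis by (simp add: hval_def tendsto_Lim)
qed

text \<open>Joint continuity down to mass zero. Near \<open>m = 0\<close> the gradient in
  \<open>p\<close> stays bounded, so moving \<open>p\<close> changes \<open>h\<close> by an amount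
  controlled uniformly in the mass and only the limit in \<open>m\<close> remains. The flux is a
  bounded gradient times a vanishing mass.\<close>

lemma hval_sequence:
  assumes p: "pk \<longlonglongrightarrow> p" and mk: "mk \<longlonglongrightarrow> m" and pos: "\<And>k. mk k > 0"
  shows "(\<lambda>k. h (pk k) (mk k)) \<longlonglongrightarrow> hval h p m"
    and "(\<lambda>k. mk k *\<^sub>R dh (pk k) (mk k)) \<longlonglongrightarrow> hflux h p m"
proof -
  have m0: "m \<ge> 0" using LIMSEQ_le_const[OF mk] pos less_imp_le by blast
  obtain P where P: "\<And>k. norm (pk k) \<le> P" using convergent_imp_Bseq[OF convergentI[OF p]] by (auto simp: Bseq_def)
  obtain M where M: "\<And>k. norm (mk k) \<le> M" using convergent_imp_Bseq[OF convergentI[OF mk]] by (auto simp: Bseq_def)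
  have M': "mk k \<le> M" for k using M[of k] by auto
  have P0: "P \<ge> 0" using order_trans[OF norm_ge_zero P] .
  have pP: "norm p \<le> P" using LIMSEQ_le_const2[OF tendsto_norm[OF p]] P by blast
  show "(\<lambda>k. h (pk k) (mk k)) \<longlonglongrightarrow> hval h p m"
  proof (cases "m > 0")
    case True
    thus ?thesis
      using continuous_on_tendsto_compose[OF cont tendsto_Pair[OF p mk]] pos by (simp add: hval_def)
  next
    case False
    hence m: "m = 0" using m0 by simp
    \<comment> \<open>Points of the segment between \<open>p\<close> and \<open>pk k\<close> have
      norm at most \<open>2 * P + P\<close>, which is crude but independent of
      \<open>k\<close>.\<close>
    define B where "B = C * ((2 * P + P) powr (\<alpha> - 1) + M powr (\<beta> - \<beta> / \<alpha>) + 1)"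
    have e: "\<beta> - \<beta> / \<alpha> \<ge> 0" using \<alpha> \<beta> by (simp add: field_simps)
    have d: "\<bar>h (pk k) (mk k) - h p (mk k)\<bar> \<le> B * norm (pk k - p)" for k
    proof -
      obtain s where s: "0 < s" "s < 1" "h (pk k) (mk k) - h p (mk k) = dh (p + s *\<^sub>R (pk k - p)) (mk k) \<bullet> (pk k - p)"
        using segment_mvt[OF pos] .
      define q where "q = p + s *\<^sub>R (pk k - p)"
      have "norm (pk k - p) \<le> 2 * P" using P[of k] pP norm_triangle_ineq4[of "pk k" p] by simp
      hence "norm (s *\<^sub>R (pk k - p)) \<le> 1 * (2 * P)"
        using s unfolding norm_scaleR by (intro mult_mono) auto
      hence nq: "norm q \<le> 2 * P + P" using norm_triangle_ineq[of p "s *\<^sub>R (pk k - p)"] pP by (simp add: q_def)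
      have "norm (dh q (mk k)) \<le> C * (norm q powr (\<alpha> - 1) + mk k powr (\<beta> - \<beta> / \<alpha>) + 1)" by (rule growth_grad[OF pos])
      also have "\<dots> \<le> B" unfolding B_def using nq M'[of k] pos[of k] C \<alpha> e by (intro mult_left_mono add_mono powr_mono2) auto
      finally have "norm (dh q (mk k)) * norm (pk k - p) \<le> B * norm (pk k - p)" by (intro mult_right_mono) auto
      thus ?thesis using s(3) Cauchy_Schwarz_ineq2[of "dh q (mk k)" "pk k - p"] by (simp add: q_def)
    qed
    have "(\<lambda>k. norm (pk k - p)) \<longlonglongrightarrow> 0" using p by (simp add: LIM_zero tendsto_norm_zero)
    hence "(\<lambda>k. B * norm (pk k - p)) \<longlonglongrightarrow> 0" by (rule tendsto_mult_right_zero)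
    hence 1: "(\<lambda>k. h (pk k) (mk k) - h p (mk k)) \<longlonglongrightarrow> 0"
      by (rule Lim_null_comparison[rotated]) (use d in auto)
    have "filterlim mk (at_right 0) sequentially" using mk pos m unfolding filterlim_at by (auto simp: less_imp_neq[symmetric])
    hence 2: "(\<lambda>k. h p (mk k)) \<longlonglongrightarrow> hval h p m" unfolding m by (rule filterlim_compose[OF mass_limit])
    from tendsto_add[OF 1 2] show ?thesis by simp
  qed
  show "(\<lambda>k. mk k *\<^sub>R dh (pk k) (mk k)) \<longlonglongrightarrow> hflux h p m"
  proof (cases "m > 0")
    case True
    have "(\<lambda>k. dh (pk k) (mk k)) \<longlonglongrightarrow> dh p m"
      using continuous_on_tendsto_compose[OF cont_grad tendsto_Pair[OF p mk]] True pos by simp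
    thus ?thesis using True mk unfolding hflux_def by (auto intro!: tendsto_intros)
  next
    case False
    hence m: "m = 0" using m0 by simp
    define B where "B = C * (P powr (\<alpha> - 1) + M powr (\<beta> - \<beta> / \<alpha>) + 1)"
    have e: "\<beta> - \<beta> / \<alpha> \<ge> 0" using \<alpha> \<beta> by (simp add: field_simps)
    have d: "norm (mk k *\<^sub>R dh (pk k) (mk k)) \<le> B * mk k" for k
    proof -
      have "norm (dh (pk k) (mk k)) \<le> C * (norm (pk k) powr (\<alpha> - 1) + mk k powr (\<beta> - \<beta> / \<alpha>) + 1)" by (rule growth_grad[OF pos])
      also have "\<dots> \<le> B" unfolding B_def using P[of k] M'[of k] pos[of k] C \<alpha> e by (intro mult_left_mono add_mono powr_mono2) auto
      finally show ?thesis using pos[of k] by (simp add: mult.commute mult_left_mono)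
    qed
    have "(\<lambda>k. B * mk k) \<longlonglongrightarrow> 0" using mk m by (auto intro: tendsto_mult_right_zero)
    hence "(\<lambda>k. mk k *\<^sub>R dh (pk k) (mk k)) \<longlonglongrightarrow> 0"
      by (rule Lim_null_comparison[rotated]) (use d in auto)
    thus ?thesis using m by (simp add: hflux_def)
  qed
qed

text \<open>Ties the limits in the definition of a strong solution to the real-valued functions used
  in the estimates; in particular the extended value at mass zero is never infinite here.\<close>

lemma H_ext_eq: "m \<ge> 0 \<Longrightarrow> H x = h \<Longrightarrow> H_ext H x p m = ereal (hval h p m)"
  and mDpH_ext_eq: "m \<ge> 0 \<Longrightarrow> H x = h \<Longrightarrow> mDpH_ext H x p m = hflux h p m"
proof -
  assume m: "m \<ge> 0" "H x = h"
  have "((\<lambda>s. ereal (h p s)) \<longlongrightarrow> ereal (hval h p 0)) (at_right 0)"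
    using mass_limit by (rule tendsto_ereal)
  hence "Lim (at_right 0) (\<lambda>s. ereal (h p s)) = ereal (hval h p 0)" by (rule tendsto_Lim[OF trivial_limit_at_right_real])
  thus "H_ext H x p m = ereal (hval h p m)" using m by (auto simp: H_ext_def hval_def)
  have "((\<lambda>s. s *\<^sub>R dh p s) \<longlongrightarrow> 0) (at_right 0)"
  proof -
    define B where "B = C * (norm p powr (\<alpha> - 1) + 1 powr (\<beta> - \<beta> / \<alpha>) + 1)"
    have e: "\<beta> - \<beta> / \<alpha> \<ge> 0" using \<alpha> \<beta> by (simp add: field_simps)
    have "norm (s *\<^sub>R dh p s) \<le> B * s" if "0 < s" "s < 1" for s
    proof -
      have "norm (dh p s) \<le> C * (norm p powr (\<alpha> - 1) + s powr (\<beta> - \<beta> / \<alpha>) + 1)" by (rule growth_grad) fact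
      also have "\<dots> \<le> B" unfolding B_def
      using that C powr_mono2[OF e, of s 1] by (intro mult_left_mono add_mono) auto
      finally show ?thesis using that by (simp add: mult.commute mult_left_mono)
    qed
    hence "\<forall>\<^sub>F s in at_right 0. norm (s *\<^sub>R dh p s) \<le> B * s"
      unfolding eventually_at_right_field by (intro exI[of _ 1]) auto
    moreover have "((\<lambda>s. B * s) \<longlongrightarrow> 0) (at_right 0)"
      using tendsto_mult_right_zero[OF tendsto_ident_at, of B] by simp
    ultimately show ?thesis by (rule Lim_null_comparison)
  qed
  hence "Lim (at_right 0) (\<lambda>s. s *\<^sub>R dh p s) = 0" by (rule tendsto_Lim[OF trivial_limit_at_right_real])
  thus "mDpH_ext H x p m = hflux h p m" using m by (simp add: mDpH_ext_def hflux_def)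
qed

lemma seq_to_zero: "(\<lambda>k. m + 1 / real (Suc k)) \<longlonglongrightarrow> m" "m \<ge> 0 \<Longrightarrow> m + 1 / real (Suc k) > 0"
  using tendsto_add[OF tendsto_const[of m] LIMSEQ_inverse_real_of_nat] by (auto simp: inverse_eq_divide add_nonneg_pos)

text \<open>Approach from strictly positive masses: inequalities and measurability known for
  \<open>m > 0\<close> carry over to \<open>m = 0\<close> along this sequence.\<close>

lemma hval_approx:
  assumes "m \<ge> 0"
  shows "(\<lambda>k. h p (m + 1 / real (Suc k))) \<longlonglongrightarrow> hval h p m"
    and "(\<lambda>k. (m + 1 / real (Suc k)) *\<^sub>R dh p (m + 1 / real (Suc k))) \<longlonglongrightarrow> hflux h p m"
proof -
  note * = tendsto_const[of p] seq_to_zero(1)[of m] seq_to_zero(2)[OF assms]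
  show "(\<lambda>k. h p (m + 1 / real (Suc k))) \<longlonglongrightarrow> hval h p m" by (rule hval_sequence(1)[OF *])
  show "(\<lambda>k. (m + 1 / real (Suc k)) *\<^sub>R dh p (m + 1 / real (Suc k))) \<longlonglongrightarrow> hflux h p m"
    by (rule hval_sequence(2)[OF *])
qed

lemma tendsto_mass_powr: "m \<ge> 0 \<Longrightarrow> (\<lambda>k. (m + 1 / real (Suc k)) powr \<beta>) \<longlonglongrightarrow> m powr \<beta>"
  using \<beta> seq_to_zero by (intro tendsto_powr' tendsto_const) auto

lemma hval_lower:
  assumes "m \<ge> 0"
  shows "hval h p m \<ge> (1 / C) * norm p powr \<alpha> - C * (m powr \<beta> + 1)"
proof (rule LIMSEQ_le[OF _ hval_approx(1)[OF assms]])
  show "(\<lambda>k. (1 / C) * norm p powr \<alpha> - C * ((m + 1 / real (Suc k)) powr \<beta> + 1)) \<longlonglongrightarrow> (1 / C) * norm p powr \<alpha> - C * (m powr \<beta> + 1)"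
    by (intro tendsto_intros tendsto_mass_powr assms)
qed (use growth seq_to_zero(2)[OF assms] in blast)

lemma hval_abs_bound:
  assumes "m \<ge> 0"
  shows "\<bar>hval h p m\<bar> \<le> 4 * C * gr (norm p) m"
proof (rule LIMSEQ_le[OF tendsto_rabs[OF hval_approx(1)[OF assms]]])
  show "(\<lambda>k. 4 * C * gr (norm p) (m + 1 / real (Suc k))) \<longlonglongrightarrow> 4 * C * gr (norm p) m"
    by (intro tendsto_intros tendsto_mass_powr assms)
qed (use abs_bound seq_to_zero(2)[OF assms] in blast)

lemma hflux_inner_bound:
  assumes "m \<ge> 0" "norm p \<le> P" "m \<le> M" "norm r \<le> P"
  shows "\<bar>hflux h p m \<bullet> r\<bar> \<le> M * (3 * C * gr P M)"
proof (cases "m > 0")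
  case True
  have "m * \<bar>dh p m \<bullet> r\<bar> \<le> M * (3 * C * gr P M)"
    using grad_inner_bound[OF True assms(2-4)] assms True by (intro mult_mono) auto
  thus ?thesis using True by (simp add: hflux_def abs_mult)
next
  case False
  have "gr P M \<ge> 0" by simp
  thus ?thesis using False assms C by (simp add: hflux_def)
qed

text \<open>By convexity the left side is at least \<open>- m * h 0 m\<close>, and the growth of
  \<open>h 0 m\<close> makes this coercive in the mass. It is the source of the a priori bound on
  the density.\<close>

lemma lagrangian_bound:
  assumes "m \<ge> 0"
  shows "hflux h p m \<bullet> p - m * hval h p m \<ge> (1 / C) * m powr (\<beta> + 1) - C * m"
proof (cases "m > 0")
  case True
  have "h p m - dh p m \<bullet> p \<le> - (1 / C) * m powr \<beta> + C"
    using order_trans[OF convex_bound[OF True, of p] growth0[OF True]] .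
  hence "m * (h p m - dh p m \<bullet> p) \<le> m * (- (1 / C) * m powr \<beta> + C)" using True by (intro mult_left_mono) auto
  thus ?thesis using True by (simp add: hflux_def hval_def powr_add algebra_simps)
next
  case False
  thus ?thesis using assms \<beta> by (simp add: hflux_def)
qed

end

section \<open>Measurability of superposition operators\<close>

text \<open>Lebesgue measure is complete, so changes on null sets do not affect
  measurability.\<close>

lemma borel_measurable_torus_AE:
  fixes f g :: "real^'n \<Rightarrow> 'b::euclidean_space"
  assumes f: "f \<in> borel_measurable torus" and ae: "AE x in torus. f x = g x"
  shows "g \<in> borel_measurable torus"
proof -
  have "AE x in lebesgue. x \<in> cbox 0 1 \<longrightarrow> f x = g x"
    using ae by (subst (asm) AE_restrict_space_iff) auto
  hence "AE x in lebesgue. (if x \<in> cbox 0 1 then f x else 0) = (if x \<in> cbox 0 1 then g x else 0)"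
    by (auto elim!: eventually_mono)
  from borel_measurable_AE[OF borel_measurable_if_I[OF f] this]
  have "(\<lambda>x. if x \<in> cbox 0 1 then g x else 0) \<in> borel_measurable lebesgue" by simp
  thus ?thesis by (rule borel_measurable_if_D)
qed

lemma borel_measurable_torus_limit:
  fixes f :: "nat \<Rightarrow> real^'n \<Rightarrow> 'b::euclidean_space"
  assumes [measurable]: "\<And>k. f k \<in> borel_measurable torus" and lim: "AE x in torus. (\<lambda>k. f k x) \<longlonglongrightarrow> g x"
  shows "g \<in> borel_measurable torus"
proof (rule borel_measurable_torus_AE)
  show "(\<lambda>x. lim (\<lambda>k. f k x)) \<in> borel_measurable torus" by (rule borel_measurable_lim_metric) measurable
  show "AE x in torus. lim (\<lambda>k. f k x) = g x" using lim by (auto elim!: eventually_mono dest: limI)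
qed

lemma AE_torus_lborel:
  assumes "AE x in (lborel :: (real^'n) measure). P x"
  shows "AE x in (torus :: (real^'n) measure). P x"
proof -
  have "AE x in lebesgue. P x" using assms by (rule AE_completion)
  thus ?thesis by (subst AE_restrict_space_iff) auto
qed

text \<open>A null set contains no ball, so it cannot fill a neighbourhood of any point of
  \<open>S\<close>.\<close>

lemma AE_lborel_dense:
  fixes S :: "'a::euclidean_space set"
  assumes ae: "AE y in lborel. P y" and S: "open S"
  shows "S \<subseteq> closure {y \<in> S. P y}"
proof
  fix y assume y: "y \<in> S"
  show "y \<in> closure {y \<in> S. P y}"
    unfolding closure_approachable
  proof (intro allI impI)
    fix e :: real assume e: "e > 0"
    define U where "U = S \<inter> ball y e"
    have U: "open U" "y \<in> U" using S y e by (auto simp: U_def)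
    have "\<exists>z\<in>U. P z"
    proof (rule ccontr)
      assume "\<not> ?thesis"
      hence "AE z in lborel. z \<notin> U" using ae by (auto elim!: eventually_mono)
      hence "U \<in> null_sets lborel" using U(1) by (subst (asm) AE_iff_null_sets[symmetric]) auto
      hence "negligible U" by (simp add: negligible_iff_null_sets null_sets_completionI)
      moreover obtain r where r: "r > 0" "ball y r \<subseteq> U" using U open_contains_ball by blast
      ultimately have "negligible (ball y r)" by (blast intro: negligible_subset)
      thus False using r(1) by (simp add: negligible_convex_interior)
    qed
    thus "\<exists>z\<in>{y \<in> S. P y}. dist z y < e" by (auto simp: U_def dist_commute)
  qed
qed

text \<open>As \<open>H\<close> is only Lebesgue measurable, substituting functions of
  \<open>x\<close> could land inside an exceptional null set. \<open>H\<close> is replaced by a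
  Borel function \<open>F\<close> off a null set \<open>N\<close>, the arguments by functions with
  values in a countable dense set of good points, and continuity in \<open>(p, m)\<close> recovers
  the original arguments.\<close>

lemma caratheodory_measurable:
  fixes H :: "real^'n \<Rightarrow> real^'n \<Rightarrow> real \<Rightarrow> real"
  assumes meas: "(\<lambda>(x, p, m). H x p m) \<in> borel_measurable (lebesgue_on (UNIV \<times> UNIV \<times> {0<..}))"
    and cont: "AE x in torus. continuous_on (UNIV \<times> {0<..}) (\<lambda>(p, m). H x p m)"
    and p [measurable]: "p \<in> borel_measurable torus" and m [measurable]: "m \<in> borel_measurable torus"
    and pos: "\<And>x. m x > 0"
  shows "(\<lambda>x. H x (p x) (m x)) \<in> borel_measurable torus"
proof -
  define S where "S = (UNIV :: (real^'n) set) \<times> {0 :: real <..}"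
  have oS: "open S" unfolding S_def by (intro open_Times) auto
  have "open ((UNIV :: (real^'n) set) \<times> S)" using oS by (intro open_Times) auto
  hence "(\<lambda>z. if z \<in> UNIV \<times> S then (\<lambda>(x, p, m). H x p m) z else 0) \<in> borel_measurable lebesgue"
    using meas unfolding S_def by (intro borel_measurable_if_I) (auto intro!: lborelD)
  then obtain F where F [measurable]: "F \<in> borel_measurable lborel"
    and aeF: "AE z in lborel. (if z \<in> UNIV \<times> S then (\<lambda>(x, p, m). H x p m) z else 0) = F z"
    using completion_ex_borel_measurable_real by blast
  from aeF obtain N where N': "{z \<in> space lborel. \<not> (if z \<in> UNIV \<times> S then (\<lambda>(x, p, m). H x p m) z else 0) = F z} \<subseteq> N"
    "emeasure lborel N = 0" "N \<in> sets lborel" by (rule AE_E)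
  have N: "N \<in> null_sets lborel" using N'(2,3) by (rule null_setsI)
  have Hz: "H x (fst y) (snd y) = F (x, y)" if "(x, y) \<notin> N" "y \<in> S" for x y
  proof -
    have "(if (x, y) \<in> UNIV \<times> S then (\<lambda>(x, p, m). H x p m) (x, y) else 0) = F (x, y)"
      using N'(1) that(1) unfolding space_lborel space_borel by blast
    thus ?thesis using that(2) by (simp add: case_prod_unfold)
  qed
  have "AE z in (lborel :: (real^'n) measure) \<Otimes>\<^sub>M (lborel :: ((real^'n) \<times> real) measure). z \<notin> N"
    using N unfolding lborel_prod by (rule AE_not_in)
  hence "AE x in (lborel :: (real^'n) measure). AE y in (lborel :: ((real^'n) \<times> real) measure). (x, y) \<notin> N"
    by (rule lborel_pair.AE_pair)
  moreover have "{z \<in> space ((lborel :: (real^'n) measure) \<Otimes>\<^sub>M (lborel :: ((real^'n) \<times> real) measure)). (fst z, snd z) \<notin> N}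
      \<in> sets (lborel \<Otimes>\<^sub>M lborel)"
  proof -
    have "{z \<in> space ((lborel :: (real^'n) measure) \<Otimes>\<^sub>M (lborel :: ((real^'n) \<times> real) measure)). (fst z, snd z) \<notin> N} = - N"
      by (auto simp: space_pair_measure)
    thus ?thesis using N unfolding lborel_prod by (auto simp: null_sets_def)
  qed
  \<comment> \<open>Fubini's theorem: for almost every argument \<open>y = (p, m)\<close>, the set
    of \<open>x\<close> with \<open>(x, y)\<close> in \<open>N\<close> is null. Such
    \<open>y\<close> are dense, which yields the countable set \<open>T\<close>.\<close>
  ultimately have "AE y in (lborel :: ((real^'n) \<times> real) measure). AE x in (lborel :: (real^'n) measure). (x, y) \<notin> N"
    using lborel_pair.AE_commute[of "\<lambda>x y. (x, y) \<notin> N"] by blast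
  from AE_lborel_dense[OF this oS] have dense: "S \<subseteq> closure {y \<in> S. AE x in lborel. (x, y) \<notin> N}" .
  obtain T where T: "countable T" "T \<subseteq> {y \<in> S. AE x in lborel. (x, y) \<notin> N}" "{y \<in> S. AE x in lborel. (x, y) \<notin> N} \<subseteq> closure T"
    using separable by blast
  have ST: "S \<subseteq> closure T" using dense closure_minimal[OF T(3) closed_closure] by blast
  have "(0, 1) \<in> S" by (simp add: S_def)
  hence Tne: "T \<noteq> {}" using ST by auto
  define e where "e = from_nat_into T"
  have e: "range e = T" unfolding e_def using Tne T(1) by (rule range_from_nat_into)
  have eT: "e j \<in> T" for j using e by auto
  have eS: "e j \<in> UNIV \<times> {0<..}" for j using subsetD[OF T(2) eT[of j]] by (simp add: S_def)
  \<comment> \<open>The first index of a good point within \<open>1 / real (Suc k)\<close> of the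
    arguments; taking the least one makes the choice measurable.\<close>
  define J where "J k x = (LEAST j. dist (e j) (p x, m x) < 1 / real (Suc k))" for k x
  have J: "dist (e (J k x)) (p x, m x) < 1 / real (Suc k)" for k x
  proof -
    have "(p x, m x) \<in> closure T" using ST pos by (auto simp: S_def)
    then obtain y where "y \<in> T" "dist y (p x, m x) < 1 / real (Suc k)"
      unfolding closure_approachable by (metis of_nat_0_less_iff zero_less_Suc zero_less_divide_1_iff)
    then obtain j where "dist (e j) (p x, m x) < 1 / real (Suc k)" using e by blast
    thus ?thesis unfolding J_def by (rule LeastI)
  qed
  have Jm [measurable]: "J k \<in> measurable torus (count_space UNIV)" for k
    unfolding J_def dist_norm norm_Pair by (cases "\<forall>j. \<exists>a b. e j = (a, b)") measurable
  define f where "f k x = F (x, e (J k x))" for k x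
  have idm: "(\<lambda>x. x) \<in> torus \<rightarrow>\<^sub>M (borel :: (real^'n) measure)" by (rule borel_measurable_torus) simp
  have em: "(\<lambda>x. e (J k x)) \<in> torus \<rightarrow>\<^sub>M (borel :: ((real^'n) \<times> real) measure)" for k
    by (rule measurable_compose[OF Jm]) simp
  have pm: "(\<lambda>x. (x, e (J k x))) \<in> torus \<rightarrow>\<^sub>M borel" for k
    using idm em[of k] unfolding borel_prod[symmetric] by (intro measurable_Pair) 
  have "F \<in> borel_measurable borel" using F by simp
  hence fm: "f k \<in> borel_measurable torus" for k
    unfolding f_def by (rule measurable_compose[OF pm])
  have "AE x in lborel. (x, e j) \<notin> N" for j using subsetD[OF T(2) eT[of j]] by simp
  hence "AE x in lborel. \<forall>j. (x, e j) \<notin> N" by (subst AE_all_countable) blast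
  \<comment> \<open>Countably many null sets are united; outside of them \<open>F\<close> agrees
    with \<open>H\<close> at all chosen points simultaneously.\<close>
  hence aeN: "AE x in torus. \<forall>j. (x, e j) \<notin> N" by (rule AE_torus_lborel)
  show ?thesis
  proof (rule borel_measurable_torus_limit[OF fm])
    show "AE x in torus. (\<lambda>k. f k x) \<longlonglongrightarrow> H x (p x) (m x)"
      using aeN cont
    proof eventually_elim
      fix x assume x: "\<forall>j. (x, e j) \<notin> N" "continuous_on (UNIV \<times> {0<..}) (\<lambda>(p, m). H x p m)"
      have f: "f k x = (\<lambda>(p, m). H x p m) (e (J k x))" for k
        unfolding f_def using Hz[of x "e (J k x)"] x(1) eS[of "J k x"] by (simp add: split_beta S_def)
      have "(\<lambda>k. dist (e (J k x)) (p x, m x)) \<longlonglongrightarrow> 0"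
      proof (rule Lim_null_comparison[OF always_eventually])
        show "\<forall>k. norm (dist (e (J k x)) (p x, m x)) \<le> inverse (real (Suc k))"
          unfolding real_norm_def abs_of_nonneg[OF zero_le_dist] inverse_eq_divide using J less_imp_le by blast
      qed (rule LIMSEQ_inverse_real_of_nat)
      hence "(\<lambda>k. e (J k x)) \<longlonglongrightarrow> (p x, m x)" by (rule iffD2[OF tendsto_dist_iff])
      moreover have mem: "(p x, m x) \<in> UNIV \<times> {0<..}" using pos[of x] by simp
      moreover have "\<forall>\<^sub>F k in sequentially. e (J k x) \<in> UNIV \<times> {0<..}" by (intro always_eventually allI eS)
      ultimately have "(\<lambda>k. (\<lambda>(p, m). H x p m) (e (J k x))) \<longlonglongrightarrow> (\<lambda>(p, m). H x p m) (p x, m x)"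
        by (rule continuous_on_tendsto_compose[OF x(2)])
      thus "(\<lambda>k. f k x) \<longlonglongrightarrow> H x (p x) (m x)" unfolding f by (simp only: prod.case)
    qed
  qed
qed

text \<open>Each component of the gradient is a pointwise limit of difference quotients, which are
  measurable by the preceding lemma.\<close>

lemma gradient_measurable:
  fixes H :: "real^'n \<Rightarrow> real^'n \<Rightarrow> real \<Rightarrow> real"
  assumes meas: "(\<lambda>(x, p, m). H x p m) \<in> borel_measurable (lebesgue_on (UNIV \<times> UNIV \<times> {0<..}))"
    and reg: "AE x in torus. continuous_on (UNIV \<times> {0<..}) (\<lambda>(p, m). H x p m) \<and> (\<forall>m>0. (\<lambda>p. H x p m) differentiable_on UNIV)"
    and p: "p \<in> borel_measurable torus" and m: "m \<in> borel_measurable torus"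
    and pos: "\<And>x. m x > 0"
  shows "(\<lambda>x. DpH H x (p x) (m x)) \<in> borel_measurable torus"
proof -
  have cont: "AE x in torus. continuous_on (UNIV \<times> {0<..}) (\<lambda>(p, m). H x p m)" using reg by (auto elim: eventually_mono)
  have "(\<lambda>x. b \<bullet> DpH H x (p x) (m x)) \<in> borel_measurable torus" for b
  proof (rule borel_measurable_torus_limit)
    have "(\<lambda>x. p x + (1 / real (Suc k)) *\<^sub>R b) \<in> borel_measurable torus" for k using p by measurable
    from caratheodory_measurable[OF meas cont this m pos] caratheodory_measurable[OF meas cont p m pos]
    show "(\<lambda>x. real (Suc k) * (H x (p x + (1 / real (Suc k)) *\<^sub>R b) (m x) - H x (p x) (m x))) \<in> borel_measurable torus" for k
      by measurable
    show "AE x in torus. (\<lambda>k. real (Suc k) * (H x (p x + (1 / real (Suc k)) *\<^sub>R b) (m x) - H x (p x) (m x)))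
        \<longlonglongrightarrow> b \<bullet> DpH H x (p x) (m x)"
      using reg
    proof eventually_elim
      fix x assume x: "continuous_on (UNIV \<times> {0<..}) (\<lambda>(p, m). H x p m) \<and> (\<forall>m>0. (\<lambda>p. H x p m) differentiable_on UNIV)"
      hence "GDERIV (\<lambda>q. H x q (m x)) (p x) :> DpH H x (p x) (m x)"
        using pos[of x] by (intro GDERIV_grad) (auto simp: differentiable_on_def)
      thus "(\<lambda>k. real (Suc k) * (H x (p x + (1 / real (Suc k)) *\<^sub>R b) (m x) - H x (p x) (m x)))
        \<longlonglongrightarrow> b \<bullet> DpH H x (p x) (m x)" by (rule difference_quotient_limit)
    qed
  qed
  thus ?thesis by (subst borel_measurable_euclidean_space) (simp add: inner_commute)
qed

lemma hval_measurable:
  fixes H :: "real^'n \<Rightarrow> real^'n \<Rightarrow> real \<Rightarrow> real"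
  assumes meas: "(\<lambda>(x, p, m). H x p m) \<in> borel_measurable (lebesgue_on (UNIV \<times> UNIV \<times> {0<..}))"
    and ham: "AE x in torus. monotone_hamiltonian (H x) \<alpha> \<beta> C"
    and p: "p \<in> borel_measurable torus" and m: "m \<in> borel_measurable torus"
    and m0: "AE x in torus. m x \<ge> 0"
  shows "(\<lambda>x. hval (H x) (p x) (m x)) \<in> borel_measurable torus"
    and "(\<lambda>x. hflux (H x) (p x) (m x)) \<in> borel_measurable torus"
proof -
  have cont: "AE x in torus. continuous_on (UNIV \<times> {0<..}) (\<lambda>(p, m). H x p m)"
    using ham by (rule eventually_mono) (rule monotone_hamiltonian.cont)
  have reg: "AE x in torus. continuous_on (UNIV \<times> {0<..}) (\<lambda>(p, m). H x p m) \<and> (\<forall>m>0. (\<lambda>p. H x p m) differentiable_on UNIV)"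
    using ham by (rule eventually_mono) (blast intro: monotone_hamiltonian.cont monotone_hamiltonian.diff)
  \<comment> \<open>The maximum with \<open>0\<close> makes the approximating masses positive
    everywhere, although \<open>m\<close> is nonnegative only almost everywhere.\<close>
  define mk where "mk k x = max 0 (m x) + 1 / real (Suc k)" for k x
  have mkm [measurable]: "mk k \<in> borel_measurable torus" for k unfolding mk_def using m by measurable
  have mkp: "mk k x > 0" for k x by (simp add: mk_def add_nonneg_pos)
  have lim: "AE x in torus. (\<lambda>k. H x (p x) (mk k x)) \<longlonglongrightarrow> hval (H x) (p x) (m x)
      \<and> (\<lambda>k. mk k x *\<^sub>R DpH H x (p x) (mk k x)) \<longlonglongrightarrow> hflux (H x) (p x) (m x)"
    using ham m0
  proof eventually_elim
    fix x assume x: "monotone_hamiltonian (H x) \<alpha> \<beta> C" "m x \<ge> 0"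
    show "(\<lambda>k. H x (p x) (mk k x)) \<longlonglongrightarrow> hval (H x) (p x) (m x)
      \<and> (\<lambda>k. mk k x *\<^sub>R DpH H x (p x) (mk k x)) \<longlonglongrightarrow> hflux (H x) (p x) (m x)"
      using monotone_hamiltonian.hval_approx[OF x, of "p x"] x(2) by (simp add: mk_def)
  qed
  show "(\<lambda>x. hval (H x) (p x) (m x)) \<in> borel_measurable torus"
    by (rule borel_measurable_torus_limit[OF caratheodory_measurable[OF meas cont p mkm mkp]])
       (use lim in \<open>auto elim: eventually_mono\<close>)
  have "(\<lambda>x. mk k x *\<^sub>R DpH H x (p x) (mk k x)) \<in> borel_measurable torus" for k
    using gradient_measurable[OF meas reg p mkm[of k] mkp] by measurable
  thus "(\<lambda>x. hflux (H x) (p x) (m x)) \<in> borel_measurable torus"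
    by (rule borel_measurable_torus_limit) (use lim in \<open>auto elim: eventually_mono\<close>)
qed

section \<open>Sobolev functions on the torus\<close>

lemma Lp_mod_convex:
  fixes f g :: "'a \<Rightarrow> 'b::euclidean_space"
  assumes "in_Lp M p f" "in_Lp M p g" "p \<ge> 1" "0 \<le> t" "t \<le> 1"
  shows "in_Lp M p (\<lambda>x. (1 - t) *\<^sub>R f x + t *\<^sub>R g x)"
    and "Lp_mod M p (\<lambda>x. (1 - t) *\<^sub>R f x + t *\<^sub>R g x) \<le> (1 - t) * Lp_mod M p f + t * Lp_mod M p g"
proof -
  show i: "in_Lp M p (\<lambda>x. (1 - t) *\<^sub>R f x + t *\<^sub>R g x)"
    using assms by (intro in_Lp_add in_Lp_scaleR) auto
  have "Lp_mod M p (\<lambda>x. (1 - t) *\<^sub>R f x + t *\<^sub>R g x) \<le> (LINT x|M. (1 - t) * norm (f x) powr p + t * norm (g x) powr p)"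
    unfolding Lp_mod_def using in_LpD(2)[OF i] in_LpD(2)[OF assms(1)] in_LpD(2)[OF assms(2)]
    by (intro integral_mono norm_powr_convex assms Bochner_Integration.integrable_add integrable_mult_right) auto
  also have "\<dots> = (1 - t) * Lp_mod M p f + t * Lp_mod M p g"
    unfolding Lp_mod_def using in_LpD(2)[OF assms(1)] in_LpD(2)[OF assms(2)] by simp
  finally show "Lp_mod M p (\<lambda>x. (1 - t) *\<^sub>R f x + t *\<^sub>R g x) \<le> (1 - t) * Lp_mod M p f + t * Lp_mod M p g" .
qed

lemma Lp_mod_uniformly_convex:
  fixes p :: real
  assumes p: "p > 1" and "B \<ge> 0" "\<epsilon> > 0"
  obtains d where "d > 0"
    "\<And>f g :: 'a \<Rightarrow> 'b::euclidean_space. in_Lp M p f \<Longrightarrow> in_Lp M p g \<Longrightarrow> Lp_mod M p f \<le> B \<Longrightarrow> Lp_mod M p g \<le> B \<Longrightarrow>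
      Lp_mod M p f + Lp_mod M p g - 2 * Lp_mod M p (\<lambda>x. (1/2) *\<^sub>R (f x + g x)) < d \<Longrightarrow> Lp_mod M p (\<lambda>x. f x - g x) < \<epsilon>"
proof -
  \<comment> \<open>With this \<open>\<delta>\<close> and a gap below
    \<open>\<epsilon> / (2 * C)\<close>, each of the two terms of the integrated pointwise
    inequality contributes at most \<open>\<epsilon> / 2\<close>.\<close>
  define \<delta> where "\<delta> = \<epsilon> / (4 * (B + 1))"
  have \<delta>: "\<delta> > 0" using assms by (simp add: \<delta>_def)
  obtain C where C: "C > 0" "\<And>a b :: 'b. norm (a - b) powr p \<le> \<delta> * (norm a powr p + norm b powr p)
      + C * (norm a powr p + norm b powr p - 2 * norm ((1/2) *\<^sub>R (a + b)) powr p)"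
    using norm_powr_uniformly_convex[OF p \<delta>, where 'a = 'b] by blast
  have "Lp_mod M p (\<lambda>x. f x - g x) < \<epsilon>"
    if f: "in_Lp M p f" and g: "in_Lp M p g" and B: "Lp_mod M p f \<le> B" "Lp_mod M p g \<le> B"
      and d: "Lp_mod M p f + Lp_mod M p g - 2 * Lp_mod M p (\<lambda>x. (1/2) *\<^sub>R (f x + g x)) < \<epsilon> / (2 * C)"
    for f g :: "'a \<Rightarrow> 'b"
  proof -
    have p0: "p \<ge> 0" using p by simp
    have m: "in_Lp M p (\<lambda>x. (1/2) *\<^sub>R (f x + g x))" by (intro in_Lp_scaleR in_Lp_add f g p0)
    have D: "in_Lp M p (\<lambda>x. f x - g x)" by (intro in_Lp_diff f g p0)
    note i = in_LpD(2)[OF f] in_LpD(2)[OF g] in_LpD(2)[OF m] in_LpD(2)[OF D]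
    have "Lp_mod M p (\<lambda>x. f x - g x) \<le> (LINT x|M. \<delta> * (norm (f x) powr p + norm (g x) powr p)
      + C * (norm (f x) powr p + norm (g x) powr p - 2 * norm ((1/2) *\<^sub>R (f x + g x)) powr p))"
      unfolding Lp_mod_def
      by (intro integral_mono i C(2) Bochner_Integration.integrable_add integrable_mult_right Bochner_Integration.integrable_diff)
    also have "\<dots> = \<delta> * (Lp_mod M p f + Lp_mod M p g)
      + C * (Lp_mod M p f + Lp_mod M p g - 2 * Lp_mod M p (\<lambda>x. (1/2) *\<^sub>R (f x + g x)))"
      unfolding Lp_mod_def using i by (simp del: norm_scaleR)
    also have "\<dots> < \<delta> * (B + B) + C * (\<epsilon> / (2 * C))"
      using B d C(1) \<delta> by (intro add_le_less_mono mult_left_mono mult_strict_left_mono) auto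
    also have "\<dots> \<le> \<epsilon> / 2 + \<epsilon> / 2"
      using assms C(1) by (intro add_mono) (auto simp: \<delta>_def field_simps)
    finally show ?thesis by simp
  qed
  moreover have "\<epsilon> / (2 * C) > 0" using assms C by simp
  ultimately show thesis using that by blast
qed

text \<open>As \<open>f n\<close> is nonnegative, the negative part of \<open>g\<close> is bounded
  by the distance between \<open>f n\<close> and \<open>g\<close>, so its integral vanishes.\<close>

lemma AE_nonneg_Lp_closed:
  fixes f :: "nat \<Rightarrow> 'a \<Rightarrow> real"
  assumes f: "\<And>n. in_Lp M p (f n)" and g: "in_Lp M p g" and nn: "\<And>n. AE x in M. f n x \<ge> 0" and p: "p > 0"
    and lim: "(\<lambda>n. Lp_mod M p (\<lambda>x. f n x - g x)) \<longlonglongrightarrow> 0"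
  shows "AE x in M. g x \<ge> 0"
proof -
  note [measurable] = in_LpD(1)[OF g]
  have i: "integrable M (\<lambda>x. \<bar>min 0 (g x)\<bar> powr p)"
    by (rule Bochner_Integration.integrable_bound[OF in_LpD(2)[OF g]]) (use p in \<open>auto intro!: powr_mono2\<close>)
  have "(LINT x|M. \<bar>min 0 (g x)\<bar> powr p) \<le> Lp_mod M p (\<lambda>x. f n x - g x)" for n
    unfolding Lp_mod_def
  proof (rule integral_mono_AE[OF i in_LpD(2)[OF in_Lp_diff(1)[OF f g]]])
    show "AE x in M. \<bar>min 0 (g x)\<bar> powr p \<le> norm (f n x - g x) powr p"
      using nn[of n] by eventually_elim (use p in \<open>auto intro!: powr_mono2\<close>)
  qed (use p in simp)
  hence "(LINT x|M. \<bar>min 0 (g x)\<bar> powr p) \<le> 0" by (intro LIMSEQ_le_const[OF lim]) blast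
  moreover have "(LINT x|M. \<bar>min 0 (g x)\<bar> powr p) \<ge> 0" by simp
  ultimately have "(LINT x|M. \<bar>min 0 (g x)\<bar> powr p) = 0" by (rule antisym)
  hence "AE x in M. \<bar>min 0 (g x)\<bar> powr p = 0"
    by (rule iffD1[OF integral_nonneg_eq_0_iff_AE[OF i], rotated]) simp
  thus ?thesis by (rule eventually_mono) (auto simp: min_def split: if_splits)
qed

lemma finite_convex_combination:
  fixes w :: "'i \<Rightarrow> 'a \<Rightarrow> 'b::real_vector"
  assumes two: "\<And>a b t. a \<in> K \<Longrightarrow> b \<in> K \<Longrightarrow> 0 \<le> t \<Longrightarrow> t \<le> 1 \<Longrightarrow> (\<lambda>x. (1 - t) *\<^sub>R a x + t *\<^sub>R b x) \<in> K"
    and fin: "finite I"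
  shows "(\<And>i. i \<in> I \<Longrightarrow> l i \<ge> (0::real)) \<Longrightarrow> sum l I = 1 \<Longrightarrow> (\<And>i. i \<in> I \<Longrightarrow> w i \<in> K) \<Longrightarrow> (\<lambda>x. \<Sum>i\<in>I. l i *\<^sub>R w i x) \<in> K"
  using fin
proof (induction I arbitrary: l rule: finite_induct)
  case (insert i I)
  show ?case
  proof (cases "l i = 1")
    case True
    hence "sum l I = 0" using insert by simp
    hence "l j = 0" if "j \<in> I" for j using insert that by (simp add: sum_nonneg_eq_0_iff)
    hence "(\<lambda>x. \<Sum>i\<in>insert i I. l i *\<^sub>R w i x) = w i" using insert True by auto
    thus ?thesis using insert by simp
  next
    case False
    define l' where "l' j = l j / (1 - l i)" for j
    have "l i \<le> 1" using insert sum_nonneg[of I l] by auto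
    hence li: "0 < 1 - l i" "0 \<le> l i" using False insert by auto
    have "(\<lambda>x. \<Sum>j\<in>I. l' j *\<^sub>R w j x) \<in> K"
      by (rule insert.IH) (use insert li in \<open>auto simp: l'_def sum_divide_distrib[symmetric]\<close>)
    from two[OF this, of "w i" "l i"] have "(\<lambda>x. (1 - l i) *\<^sub>R (\<Sum>j\<in>I. l' j *\<^sub>R w j x) + l i *\<^sub>R w i x) \<in> K"
      using insert li by auto
    moreover have "(1 - l i) *\<^sub>R (\<Sum>j\<in>I. l' j *\<^sub>R w j x) = (\<Sum>j\<in>I. l j *\<^sub>R w j x)" for x
      using li by (simp add: scaleR_sum_right l'_def)
    ultimately show ?thesis using insert by (simp add: add.commute)
  qed
qed simp

section \<open>Sobolev pairs\<close>

lemma in_Lp_continuous: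
  fixes f :: "real^'n \<Rightarrow> 'b::euclidean_space"
  assumes "continuous_on UNIV f" "periodic f" "p > 0"
  shows "in_Lp torus p f"
  unfolding in_Lp_def using assms
  by (auto intro!: borel_measurable_torus borel_measurable_continuous_onI integrable_torus_continuous continuous_on_norm_powr
      simp: periodic_def)

text \<open>The closure of the graph of the gradient on smooth functions. Integration by parts and
  Poincare's inequality pass from smooth functions to such pairs by continuity, and completeness of
  the space is built in.\<close>

definition sobolev :: "real \<Rightarrow> (real^'n \<Rightarrow> real) \<Rightarrow> (real^'n \<Rightarrow> real^'n) \<Rightarrow> bool" where
  "sobolev p u g \<longleftrightarrow> in_Lp torus p u \<and> in_Lp torus p g \<and>
     (\<forall>\<epsilon>>0. \<exists>\<phi>\<in>Cinf_torus. Lp_mod torus p (\<lambda>x. u x - \<phi> x) < \<epsilon> \<and> Lp_mod torus p (\<lambda>x. g x - grad \<phi> x) < \<epsilon>)"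

lemma sobolevD:
  assumes "sobolev p u g"
  shows "in_Lp torus p u" "in_Lp torus p g"
  using assms by (auto simp: sobolev_def)

lemma Cinf_in_Lp:
  assumes "\<phi> \<in> Cinf_torus" "p > 0"
  shows "in_Lp torus p \<phi>" "in_Lp torus p (grad \<phi>)"
  using Cinf_torusD[OF assms(1)] assms(2) by (auto intro: in_Lp_continuous)

lemma sobolev_smooth: "\<phi> \<in> Cinf_torus \<Longrightarrow> p > 0 \<Longrightarrow> sobolev p \<phi> (grad \<phi>)"
  unfolding sobolev_def by (intro conjI Cinf_in_Lp allI impI bexI[of _ \<phi>]) (auto simp: Lp_mod_def)

lemma sobolev_approx:
  assumes "sobolev p u g"
  obtains \<phi> where "\<And>n. \<phi> n \<in> Cinf_torus" "(\<lambda>n. Lp_mod torus p (\<lambda>x. \<phi> n x - u x)) \<longlonglongrightarrow> 0"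
    "(\<lambda>n. Lp_mod torus p (\<lambda>x. grad (\<phi> n) x - g x)) \<longlonglongrightarrow> 0"
proof -
  have "\<exists>\<phi>\<in>Cinf_torus. Lp_mod torus p (\<lambda>x. u x - \<phi> x) < 1 / real (Suc n) \<and> Lp_mod torus p (\<lambda>x. g x - grad \<phi> x) < 1 / real (Suc n)" for n
    using assms unfolding sobolev_def by simp
  hence "\<exists>\<phi>. \<forall>n. \<phi> n \<in> Cinf_torus \<and> Lp_mod torus p (\<lambda>x. u x - \<phi> n x) < 1 / real (Suc n) \<and> Lp_mod torus p (\<lambda>x. g x - grad (\<phi> n) x) < 1 / real (Suc n)"
    by (intro choice) blast
  then obtain \<phi> where \<phi>: "\<And>n. \<phi> n \<in> Cinf_torus"
    "\<And>n. Lp_mod torus p (\<lambda>x. u x - \<phi> n x) < 1 / real (Suc n)" "\<And>n. Lp_mod torus p (\<lambda>x. g x - grad (\<phi> n) x) < 1 / real (Suc n)"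
    by blast
  have z: "(\<lambda>n. 1 / real (Suc n)) \<longlonglongrightarrow> 0" using LIMSEQ_inverse_real_of_nat by (simp add: inverse_eq_divide)
  show thesis
  proof (rule that[OF \<phi>(1)])
    show "(\<lambda>n. Lp_mod torus p (\<lambda>x. \<phi> n x - u x)) \<longlonglongrightarrow> 0"
      by (rule Lim_null_comparison[OF always_eventually z])
         (use \<phi>(2) in \<open>simp add: Lp_mod_minus_commute[of _ _ _ u] less_imp_le del: of_nat_Suc\<close>)
    show "(\<lambda>n. Lp_mod torus p (\<lambda>x. grad (\<phi> n) x - g x)) \<longlonglongrightarrow> 0"
      by (rule Lim_null_comparison[OF always_eventually z])
         (use \<phi>(3) in \<open>simp add: Lp_mod_minus_commute[of _ _ _ g] less_imp_le del: of_nat_Suc\<close>)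
  qed
qed

lemma Lp_mod_linear_le:
  assumes "in_Lp M p f" "in_Lp M p g" "p \<ge> 0"
  shows "Lp_mod M p (\<lambda>x. a *\<^sub>R f x + b *\<^sub>R g x) \<le> 2 powr p * (\<bar>a\<bar> powr p * Lp_mod M p f + \<bar>b\<bar> powr p * Lp_mod M p g)"
  using in_Lp_add(2)[OF in_Lp_scaleR(1)[OF assms(1), of a] in_Lp_scaleR(1)[OF assms(2), of b] assms(3)]
  by (simp add: in_Lp_scaleR(2)[OF assms(1)] in_Lp_scaleR(2)[OF assms(2)])

lemma sobolevI_seq:
  assumes p: "p \<ge> 1" and u: "in_Lp torus p u" and g: "in_Lp torus p g" and w: "\<And>n. sobolev p (v n) (h n)"
    and lim: "(\<lambda>n. Lp_mod torus p (\<lambda>x. v n x - u x)) \<longlonglongrightarrow> 0" "(\<lambda>n. Lp_mod torus p (\<lambda>x. h n x - g x)) \<longlonglongrightarrow> 0"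
  shows "sobolev p u g"
  unfolding sobolev_def
proof (intro conjI u g allI impI)
  fix e :: real assume e: "e > 0"
  \<comment> \<open>Two errors of size \<open>d\<close> add up to \<open>e\<close> after the factor
    \<open>2 powr p\<close> of the triangle inequality.\<close>
  define d where "d = e / (2 * 2 powr p)"
  have d: "d > 0" "2 powr p * (d + d) = e" using e by (simp_all add: d_def)
  have "\<forall>\<^sub>F n in sequentially. Lp_mod torus p (\<lambda>x. v n x - u x) < d \<and> Lp_mod torus p (\<lambda>x. h n x - g x) < d"
    using order_tendstoD(2)[OF lim(1) d(1)] order_tendstoD(2)[OF lim(2) d(1)] by eventually_elim simp
  then obtain n where n: "Lp_mod torus p (\<lambda>x. v n x - u x) < d" "Lp_mod torus p (\<lambda>x. h n x - g x) < d"
    using eventually_happens trivial_limit_sequentially by blast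
  from w[of n] d(1) obtain \<phi> where \<phi>: "\<phi> \<in> Cinf_torus" "Lp_mod torus p (\<lambda>x. v n x - \<phi> x) < d" "Lp_mod torus p (\<lambda>x. h n x - grad \<phi> x) < d"
    unfolding sobolev_def by blast
  have p0: "p > 0" "p \<ge> 0" using p by auto
  have tri: "Lp_mod torus p (\<lambda>x. f1 x - f3 x) < e"
    if "in_Lp torus p f1" "in_Lp torus p f2" "in_Lp torus p f3" "Lp_mod torus p (\<lambda>x. f2 x - f1 x) < d" "Lp_mod torus p (\<lambda>x. f2 x - f3 x) < d"
    for f1 f2 f3 :: "real^'a \<Rightarrow> 'c::euclidean_space"
  proof -
    have "Lp_mod torus p (\<lambda>x. (f2 x - f3 x) - (f2 x - f1 x)) \<le> 2 powr p * (Lp_mod torus p (\<lambda>x. f2 x - f3 x) + Lp_mod torus p (\<lambda>x. f2 x - f1 x))"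
      using that p0 by (intro in_Lp_diff) auto
    also have "\<dots> < 2 powr p * (d + d)" using that by (intro mult_strict_left_mono add_strict_mono) auto
    finally show ?thesis using d by simp
  qed
  show "\<exists>\<phi>\<in>Cinf_torus. Lp_mod torus p (\<lambda>x. u x - \<phi> x) < e \<and> Lp_mod torus p (\<lambda>x. g x - grad \<phi> x) < e"
    using tri[OF u sobolevD(1)[OF w] Cinf_in_Lp(1)[OF \<phi>(1) p0(1)] n(1) \<phi>(2)]
      tri[OF g sobolevD(2)[OF w] Cinf_in_Lp(2)[OF \<phi>(1) p0(1)] n(2) \<phi>(3)] \<phi>(1) by blast
qed

lemma sobolev_linear:
  assumes p: "p \<ge> 1" and 1: "sobolev p u g" and 2: "sobolev p v h"
  shows "sobolev p (\<lambda>x. a * u x + b * v x) (\<lambda>x. a *\<^sub>R g x + b *\<^sub>R h x)"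
proof -
  have p0: "p > 0" "p \<ge> 0" using p by auto
  obtain \<phi> where \<phi>: "\<And>n. \<phi> n \<in> Cinf_torus" "(\<lambda>n. Lp_mod torus p (\<lambda>x. \<phi> n x - u x)) \<longlonglongrightarrow> 0"
    "(\<lambda>n. Lp_mod torus p (\<lambda>x. grad (\<phi> n) x - g x)) \<longlonglongrightarrow> 0" using sobolev_approx[OF 1] by blast
  obtain \<psi> where \<psi>: "\<And>n. \<psi> n \<in> Cinf_torus" "(\<lambda>n. Lp_mod torus p (\<lambda>x. \<psi> n x - v x)) \<longlonglongrightarrow> 0"
    "(\<lambda>n. Lp_mod torus p (\<lambda>x. grad (\<psi> n) x - h x)) \<longlonglongrightarrow> 0" using sobolev_approx[OF 2] by blast
  note i1 = sobolevD[OF 1] and i2 = sobolevD[OF 2] and j1 = Cinf_in_Lp[OF \<phi>(1) p0(1)] and j2 = Cinf_in_Lp[OF \<psi>(1) p0(1)]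
  have lim: "(\<lambda>n. Lp_mod torus p (\<lambda>x. (a *\<^sub>R f n x + b *\<^sub>R f' n x) - (a *\<^sub>R k x + b *\<^sub>R k' x))) \<longlonglongrightarrow> 0"
    if "\<And>n. in_Lp torus p (f n)" "\<And>n. in_Lp torus p (f' n)" "in_Lp torus p k" "in_Lp torus p k'"
      "(\<lambda>n. Lp_mod torus p (\<lambda>x. f n x - k x)) \<longlonglongrightarrow> 0" "(\<lambda>n. Lp_mod torus p (\<lambda>x. f' n x - k' x)) \<longlonglongrightarrow> 0"
    for f f' :: "nat \<Rightarrow> real^'n \<Rightarrow> 'c::euclidean_space" and k k'
  proof (rule Lim_null_comparison[OF always_eventually])
    have "(\<lambda>n. 2 powr p * (\<bar>a\<bar> powr p * Lp_mod torus p (\<lambda>x. f n x - k x) + \<bar>b\<bar> powr p * Lp_mod torus p (\<lambda>x. f' n x - k' x)))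
      \<longlonglongrightarrow> 2 powr p * (\<bar>a\<bar> powr p * 0 + \<bar>b\<bar> powr p * 0)" using that by (intro tendsto_intros)
    thus "(\<lambda>n. 2 powr p * (\<bar>a\<bar> powr p * Lp_mod torus p (\<lambda>x. f n x - k x) + \<bar>b\<bar> powr p * Lp_mod torus p (\<lambda>x. f' n x - k' x))) \<longlonglongrightarrow> 0"
      by simp
    have e: "(a *\<^sub>R f n x + b *\<^sub>R f' n x) - (a *\<^sub>R k x + b *\<^sub>R k' x) = a *\<^sub>R (f n x - k x) + b *\<^sub>R (f' n x - k' x)" for n x
      by (simp add: scaleR_diff_right)
    show "\<forall>n. norm (Lp_mod torus p (\<lambda>x. (a *\<^sub>R f n x + b *\<^sub>R f' n x) - (a *\<^sub>R k x + b *\<^sub>R k' x)))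
      \<le> 2 powr p * (\<bar>a\<bar> powr p * Lp_mod torus p (\<lambda>x. f n x - k x) + \<bar>b\<bar> powr p * Lp_mod torus p (\<lambda>x. f' n x - k' x))"
      unfolding e real_norm_def abs_of_nonneg[OF Lp_mod_nonneg]
      by (intro allI Lp_mod_linear_le in_Lp_diff that p0)
  qed
  have s: "sobolev p (\<lambda>x. a *\<^sub>R \<phi> n x + b *\<^sub>R \<psi> n x) (\<lambda>x. a *\<^sub>R grad (\<phi> n) x + b *\<^sub>R grad (\<psi> n) x)" for n
  proof -
    have "grad (\<lambda>x. a * \<phi> n x + b * \<psi> n x) = (\<lambda>x. a *\<^sub>R grad (\<phi> n) x + b *\<^sub>R grad (\<psi> n) x)"
      by (rule ext) (rule Cinf_torus_linear(2)[OF \<phi>(1) \<psi>(1)])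
    thus ?thesis using sobolev_smooth[OF Cinf_torus_linear(1)[OF \<phi>(1) \<psi>(1), of a n b n] p0(1)] by simp
  qed
  have "sobolev p (\<lambda>x. a *\<^sub>R u x + b *\<^sub>R v x) (\<lambda>x. a *\<^sub>R g x + b *\<^sub>R h x)"
    by (rule sobolevI_seq[OF p _ _ s lim[OF j1(1) j2(1) i1(1) i2(1) \<phi>(2) \<psi>(2)] lim[OF j1(2) j2(2) i1(2) i2(2) \<phi>(3) \<psi>(3)]])
       (intro in_Lp_add in_Lp_scaleR i1 i2 p0)+
  thus ?thesis by simp
qed

lemma in_Lp_nth:
  fixes f :: "'a \<Rightarrow> real^'n"
  assumes f: "in_Lp M p f" and p: "p \<ge> 0"
  shows "in_Lp M p (\<lambda>x. f x $ i)" "Lp_mod M p (\<lambda>x. f x $ i) \<le> Lp_mod M p f"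
proof -
  have m: "(\<lambda>x. f x $ i) \<in> borel_measurable M"
    using borel_measurable_inner[OF in_LpD(1)[OF f] borel_measurable_const[of "axis i 1"]] by (simp add: inner_axis)
  have le: "norm (f x $ i) powr p \<le> norm (f x) powr p" for x
    using component_le_norm_cart[of "f x" i] p by (intro powr_mono2) auto
  show i: "in_Lp M p (\<lambda>x. f x $ i)" by (rule in_Lp_bound[OF m in_LpD(2)[OF f]]) (use le in auto)
  show "Lp_mod M p (\<lambda>x. f x $ i) \<le> Lp_mod M p f"
    unfolding Lp_mod_def by (intro integral_mono in_LpD(2)[OF i] in_LpD(2)[OF f] le)
qed

text \<open>Both sides of the smooth identity converge, since the approximants converge in the power
  \<open>p\<close> and the test function lies in the dual power. This leads back to the weak
  gradient of the definitions.\<close>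

lemma sobolev_weak_gradient:
  fixes u :: "real^'n \<Rightarrow> real"
  assumes p: "p > 1" and s: "sobolev p u g" and \<psi>: "\<psi> \<in> Cinf_torus"
  shows "(LINT x|torus. u x * (grad \<psi> x $ i)) = - (LINT x|torus. (g x $ i) * \<psi> x)"
proof -
  obtain \<phi> where \<phi>: "\<And>n. \<phi> n \<in> Cinf_torus" "(\<lambda>n. Lp_mod torus p (\<lambda>x. \<phi> n x - u x)) \<longlonglongrightarrow> 0"
    "(\<lambda>n. Lp_mod torus p (\<lambda>x. grad (\<phi> n) x - g x)) \<longlonglongrightarrow> 0" using sobolev_approx[OF s] by blast
  define q where "q = p / (p - 1)"
  have q: "q > 1" "1/p + 1/q = 1" using p by (simp_all add: q_def field_simps)
  have p0: "p > 0" "p \<ge> 0" using p by auto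
  note l = in_Lp_nth(1)[OF Cinf_in_Lp(2)]
  have "(\<lambda>n. LINT x|torus. \<phi> n x * (grad \<psi> x $ i)) \<longlonglongrightarrow> (LINT x|torus. u x * (grad \<psi> x $ i))"
    by (rule Lp_mod_tendsto_integral_mult[OF Cinf_in_Lp(1)[OF \<phi>(1) p0(1)] sobolevD(1)[OF s] l[OF \<psi>] p q \<phi>(2)]) (use q in auto)
  moreover have "(\<lambda>n. LINT x|torus. (grad (\<phi> n) x $ i) * \<psi> x) \<longlonglongrightarrow> (LINT x|torus. (g x $ i) * \<psi> x)"
  proof (rule Lp_mod_tendsto_integral_mult[OF l[OF \<phi>(1)] in_Lp_nth(1)[OF sobolevD(2)[OF s]] Cinf_in_Lp(1)[OF \<psi>] p q])
    show "(\<lambda>n. Lp_mod torus p (\<lambda>x. grad (\<phi> n) x $ i - g x $ i)) \<longlonglongrightarrow> 0"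
      by (rule Lim_null_comparison[OF always_eventually \<phi>(3)])
         (use in_Lp_nth(2)[OF in_Lp_diff(1)[OF Cinf_in_Lp(2)[OF \<phi>(1) p0(1)] sobolevD(2)[OF s] p0(2)] p0(2), of _ i] in simp)
  qed (use p q in auto)
  ultimately have "(\<lambda>n. - (LINT x|torus. (grad (\<phi> n) x $ i) * \<psi> x)) \<longlonglongrightarrow> (LINT x|torus. u x * (grad \<psi> x $ i))"
    "(\<lambda>n. - (LINT x|torus. (grad (\<phi> n) x $ i) * \<psi> x)) \<longlonglongrightarrow> - (LINT x|torus. (g x $ i) * \<psi> x)"
    by (simp_all add: torus_integration_by_parts[OF \<phi>(1) \<psi>] tendsto_minus)
  thus ?thesis by (rule LIMSEQ_unique)
qed

lemma torus_mean_powr_le: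
  fixes f :: "real^'n \<Rightarrow> real"
  assumes "in_Lp torus p f" "p \<ge> 1"
  shows "\<bar>LINT x|torus. f x\<bar> powr p \<le> Lp_mod torus p f"
  unfolding Lp_mod_def real_norm_def
  by (rule torus.jensens_inequality[where I = UNIV])
     (use assms torus.in_Lp_integrable[OF assms] in_LpD(2)[OF assms(1)] abs_powr_convex[OF assms(2)] in auto)

text \<open>With the error \<open>f = \<phi> n - u\<close>, the function minus its mean splits into
  the same expression for \<open>\<phi> n\<close> and for \<open>f\<close>. The former obeys the
  smooth inequality, the latter tends to zero; the powers of two come from the triangle
  inequality.\<close>

lemma sobolev_poincare:
  fixes u :: "real^'n \<Rightarrow> real"
  assumes p: "p \<ge> 1" and s: "sobolev p u g"
  shows "Lp_mod torus p (\<lambda>x. u x - (LINT y|torus. u y)) \<le> 2 powr p * (norm (1 :: real^'n) powr p * (2 powr p * Lp_mod torus p g))"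
proof -
  obtain \<phi> where \<phi>: "\<And>n. \<phi> n \<in> Cinf_torus" "(\<lambda>n. Lp_mod torus p (\<lambda>x. \<phi> n x - u x)) \<longlonglongrightarrow> 0"
    "(\<lambda>n. Lp_mod torus p (\<lambda>x. grad (\<phi> n) x - g x)) \<longlonglongrightarrow> 0" using sobolev_approx[OF s] by blast
  have p0: "p > 0" "p \<ge> 0" using p by auto
  define c where "c = norm (1 :: real^'n) powr p"
  note i = Cinf_in_Lp[OF \<phi>(1) p0(1)] sobolevD[OF s]
  have le: "Lp_mod torus p (\<lambda>x. u x - (LINT y|torus. u y))
      \<le> 2 powr p * (c * (2 powr p * (Lp_mod torus p g + Lp_mod torus p (\<lambda>x. grad (\<phi> n) x - g x)))
          + 2 powr p * (Lp_mod torus p (\<lambda>x. \<phi> n x - u x) + Lp_mod torus p (\<lambda>x. \<phi> n x - u x)))" for n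
  proof -
    define f where "f x = \<phi> n x - u x" for x
    define a where "a = (LINT y|torus. \<phi> n y)"
    have f: "in_Lp torus p f" unfolding f_def by (intro in_Lp_diff i p0)
    have int: "integrable torus (\<phi> n)" "integrable torus u" using torus.in_Lp_integrable i p by blast+
    have m: "(LINT y|torus. f y) = a - (LINT y|torus. u y)" unfolding f_def a_def using int by simp
    have f1: "in_Lp torus p (\<lambda>x. f x - (LINT y|torus. f y))"
      and "Lp_mod torus p (\<lambda>x. f x - (LINT y|torus. f y)) \<le> 2 powr p * (Lp_mod torus p f + Lp_mod torus p (\<lambda>x :: real^'n. LINT y|torus. f y))"
      by (intro in_Lp_diff f torus.in_Lp_const p0)+
    moreover have "Lp_mod torus p (\<lambda>x :: real^'n. LINT y|torus. f y) \<le> Lp_mod torus p f"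
      using torus_mean_powr_le[OF f p] unfolding Lp_mod_def by simp
    ultimately have 1: "Lp_mod torus p (\<lambda>x. f x - (LINT y|torus. f y)) \<le> 2 powr p * (Lp_mod torus p f + Lp_mod torus p f)"
      by (meson add_left_mono mult_left_mono order_trans powr_ge_zero)
    have "Lp_mod torus p (\<lambda>x. (grad (\<phi> n) x - g x) + g x) \<le> 2 powr p * (Lp_mod torus p (\<lambda>x. grad (\<phi> n) x - g x) + Lp_mod torus p g)"
      by (intro in_Lp_add in_Lp_diff i p0)
    hence 2: "Lp_mod torus p (grad (\<phi> n)) \<le> 2 powr p * (Lp_mod torus p g + Lp_mod torus p (\<lambda>x. grad (\<phi> n) x - g x))"
      by (simp add: add.commute)
    have "Lp_mod torus p (\<lambda>x. \<phi> n x - a) \<le> c * Lp_mod torus p (grad (\<phi> n))"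
      unfolding c_def a_def by (rule torus_poincare[OF \<phi>(1) p])
    also have "\<dots> \<le> c * (2 powr p * (Lp_mod torus p g + Lp_mod torus p (\<lambda>x. grad (\<phi> n) x - g x)))"
      using 2 by (intro mult_left_mono) (auto simp: c_def)
    finally have 3: "Lp_mod torus p (\<lambda>x. \<phi> n x - a) \<le> c * (2 powr p * (Lp_mod torus p g + Lp_mod torus p (\<lambda>x. grad (\<phi> n) x - g x)))" .
    have "(\<lambda>x. u x - (LINT y|torus. u y)) = (\<lambda>x. (\<phi> n x - a) - (f x - (LINT y|torus. f y)))"
      unfolding m by (simp add: f_def)
    hence "Lp_mod torus p (\<lambda>x. u x - (LINT y|torus. u y))
        \<le> 2 powr p * (Lp_mod torus p (\<lambda>x. \<phi> n x - a) + Lp_mod torus p (\<lambda>x. f x - (LINT y|torus. f y)))"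
      by (simp only:) (intro in_Lp_diff f1 i torus.in_Lp_const p0)
    also have "\<dots> \<le> 2 powr p * (c * (2 powr p * (Lp_mod torus p g + Lp_mod torus p (\<lambda>x. grad (\<phi> n) x - g x)))
          + 2 powr p * (Lp_mod torus p f + Lp_mod torus p f))"
      using 1 3 by (intro mult_left_mono add_mono) auto
    moreover have "f = (\<lambda>x. \<phi> n x - u x)" by (rule ext) (rule f_def)
    ultimately show ?thesis by (simp only:)
  qed
  have "(\<lambda>n. 2 powr p * (c * (2 powr p * (Lp_mod torus p g + Lp_mod torus p (\<lambda>x. grad (\<phi> n) x - g x)))
          + 2 powr p * (Lp_mod torus p (\<lambda>x. \<phi> n x - u x) + Lp_mod torus p (\<lambda>x. \<phi> n x - u x))))
     \<longlonglongrightarrow> 2 powr p * (c * (2 powr p * (Lp_mod torus p g + 0)) + 2 powr p * (0 + 0))"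
    by (intro tendsto_intros \<phi>)
  hence "Lp_mod torus p (\<lambda>x. u x - (LINT y|torus. u y)) \<le> 2 powr p * (c * (2 powr p * (Lp_mod torus p g + 0)) + 2 powr p * (0 + 0))"
    by (rule LIMSEQ_le_const) (use le in blast)
  thus ?thesis by (simp add: c_def)
qed

text \<open>Young's inequality with the dual exponents \<open>q\<close> and \<open>b\<close> splits
  each product in the integrand of the pairing. The bound depends on the state and the direction
  only through \<open>M\<close>, \<open>U\<close> and \<open>P\<close>, so it is uniform along
  segments and can serve as a dominating function.\<close>

lemma (in monotone_hamiltonian) form_bound:
  fixes v u u' m m' U P M :: real and p p' :: "real^'n"
  assumes m: "0 \<le> m" "m \<le> M" "\<bar>m'\<bar> \<le> M" and u: "\<bar>u\<bar> \<le> U" "\<bar>u'\<bar> \<le> U" and p: "norm p \<le> P" "norm p' \<le> P"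
  shows "\<bar>(v - u - hval h p m) * m' + (m - 1) * u' + hflux h p m \<bullet> p'\<bar>
    \<le> (21 * C + 4) * (1 + \<bar>v\<bar> powr ((\<beta> + 1) / \<beta>) + M powr (\<beta> + 1) + U powr (\<alpha> * ((\<beta> + 1) / \<beta>)) + P powr (\<alpha> * ((\<beta> + 1) / \<beta>)))"
proof -
  define q b \<gamma> where "q = (\<beta> + 1) / \<beta>" and "b = \<beta> + 1" and "\<gamma> = \<alpha> * q"
  have q: "q > 1" "b > 1" "1/q + 1/b = 1" using \<beta> by (simp_all add: q_def b_def field_simps)
  have \<gamma>: "\<gamma> \<ge> q" "\<gamma> \<ge> 1" "\<gamma> \<ge> 0" using \<alpha> q mult_mono[of 1 \<alpha> 1 q] mult_right_mono[of 1 \<alpha> q] by (simp_all add: \<gamma>_def)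
  have nn: "M \<ge> 0" "U \<ge> 0" "P \<ge> 0" using m u p norm_ge_zero[of p] by linarith+
  have Y: "x * M \<le> x powr q + M powr b" if "x \<ge> 0" for x using young_crude[OF that nn(1) q(1,2,3)] .
  have "U powr q \<le> 1 + U powr \<gamma>" using powr_le_one_add_powr[of U q \<gamma>] nn q \<gamma> by simp
  hence UM: "U * M \<le> 1 + U powr \<gamma> + M powr b" using Y[OF nn(2)] by linarith
  have U1: "U \<le> 1 + U powr \<gamma>" using powr_le_one_add_powr[of U 1 \<gamma>] nn \<gamma> by simp
  have M1: "M \<le> 1 + M powr b" using powr_le_one_add_powr[of M 1 b] nn q by simp
  have "P powr \<alpha> * M \<le> P powr \<gamma> + M powr b" using Y[of "P powr \<alpha>"] by (simp add: powr_powr \<gamma>_def)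
  moreover have "M powr \<beta> * M = M powr b" using nn by (cases "M = 0") (simp_all add: b_def powr_add)
  ultimately have GM: "gr P M * M \<le> P powr \<gamma> + 3 * M powr b + 1" using M1 by (simp add: distrib_right)
  have "\<bar>hval h p m\<bar> \<le> 4 * C * gr (norm p) m" by (rule hval_abs_bound[OF m(1)])
  also have "\<dots> \<le> 4 * C * gr P M" using C by (intro mult_left_mono gr_mono m p) auto
  finally have hv: "\<bar>hval h p m\<bar> * \<bar>m'\<bar> \<le> (4 * C * gr P M) * M" using m C by (intro mult_mono) auto
  have "C * (gr P M * M) \<le> C * (P powr \<gamma> + 3 * M powr b + 1)" using GM C by (intro mult_left_mono) auto
  hence h1: "\<bar>hval h p m\<bar> * \<bar>m'\<bar> \<le> 4 * (C * (P powr \<gamma> + 3 * M powr b + 1))"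
    and h2: "\<bar>hflux h p m \<bullet> p'\<bar> \<le> 3 * (C * (P powr \<gamma> + 3 * M powr b + 1))"
    using hv hflux_inner_bound[OF m(1) p(1) m(2) p(2)] by (simp_all only: mult.assoc mult.commute[of M] mult.left_commute[of M])
  have a1: "\<bar>v\<bar> * \<bar>m'\<bar> \<le> \<bar>v\<bar> powr q + M powr b"
    using Y[of "\<bar>v\<bar>"] mult_left_mono[OF m(3), of "\<bar>v\<bar>"] by simp
  have a2: "\<bar>u\<bar> * \<bar>m'\<bar> \<le> 1 + U powr \<gamma> + M powr b" using UM mult_mono[OF u(1) m(3)] nn by simp
  have a3: "\<bar>m - 1\<bar> * \<bar>u'\<bar> \<le> (M + 1) * U" using m u nn by (intro mult_mono) auto
  have a4: "(M + 1) * U \<le> 2 + 2 * U powr \<gamma> + M powr b" using UM U1 by (simp add: algebra_simps)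
  have tri: "\<bar>a + b + c\<bar> \<le> \<bar>a\<bar> + \<bar>b\<bar> + \<bar>c\<bar>" "\<bar>a - b - c\<bar> \<le> \<bar>a\<bar> + \<bar>b\<bar> + \<bar>c\<bar>" for a b c :: real by linarith+
  have "\<bar>(v - u - hval h p m) * m'\<bar> \<le> (\<bar>v\<bar> + \<bar>u\<bar> + \<bar>hval h p m\<bar>) * \<bar>m'\<bar>"
    unfolding abs_mult by (intro mult_right_mono tri(2) abs_ge_zero)
  also have "\<dots> \<le> (\<bar>v\<bar> powr q + M powr b) + (1 + U powr \<gamma> + M powr b) + 4 * (C * (P powr \<gamma> + 3 * M powr b + 1))"
    unfolding distrib_right by (intro add_mono a1 a2 h1)
  finally have b1: "\<bar>(v - u - hval h p m) * m'\<bar>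
    \<le> (\<bar>v\<bar> powr q + M powr b) + (1 + U powr \<gamma> + M powr b) + 4 * (C * (P powr \<gamma> + 3 * M powr b + 1))" .
  have b2: "\<bar>(m - 1) * u'\<bar> \<le> 2 + 2 * U powr \<gamma> + M powr b" unfolding abs_mult by (rule order_trans[OF a3 a4])
  have "\<bar>(v - u - hval h p m) * m' + (m - 1) * u' + hflux h p m \<bullet> p'\<bar>
      \<le> (\<bar>v\<bar> powr q + M powr b) + (1 + U powr \<gamma> + M powr b) + 4 * (C * (P powr \<gamma> + 3 * M powr b + 1))
        + (2 + 2 * U powr \<gamma> + M powr b) + 3 * (C * (P powr \<gamma> + 3 * M powr b + 1))"
    by (rule order_trans[OF tri(1) add_mono[OF add_mono[OF b1 b2] h2]])
  \<comment> \<open>The terms with \<open>C\<close> sum to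
    \<open>7 * C * (P powr \<gamma> + 3 * M powr b + 1)\<close>, whence \<open>21\<close>. The
    remaining coefficients are at most \<open>3\<close>.\<close>
  also have "\<dots> \<le> (21 * C + 4) * (1 + \<bar>v\<bar> powr q + M powr b + U powr \<gamma> + P powr \<gamma>)"
  proof -
    define x1 x2 x3 x4 where "x1 = \<bar>v\<bar> powr q" and "x2 = M powr b" and "x3 = U powr \<gamma>" and "x4 = P powr \<gamma>"
    have "x1 \<ge> 0" "x2 \<ge> 0" "x3 \<ge> 0" "x4 \<ge> 0" by (simp_all add: x1_def x2_def x3_def x4_def)
    moreover from this C have "C * x1 \<ge> 0" "C * x2 \<ge> 0" "C * x3 \<ge> 0" "C * x4 \<ge> 0" by simp_all
    ultimately show ?thesis
      unfolding x1_def[symmetric] x2_def[symmetric] x3_def[symmetric] x4_def[symmetric]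
      using C by (simp add: algebra_simps)
  qed
  finally show ?thesis unfolding q_def b_def \<gamma>_def .
qed

section \<open>The operator and the variational inequality\<close>

text \<open>Density, value function and candidate gradient are packed into one vector-valued
  function, so that convex combinations and differences of states are taken pointwise.\<close>

abbreviation mass :: "('a \<Rightarrow> real \<times> real \<times> 'b) \<Rightarrow> 'a \<Rightarrow> real" where
  "mass z \<equiv> \<lambda>x. fst (z x)"

abbreviation val :: "('a \<Rightarrow> real \<times> real \<times> 'b) \<Rightarrow> 'a \<Rightarrow> real" where
  "val z \<equiv> \<lambda>x. fst (snd (z x))"

abbreviation slope :: "('a \<Rightarrow> real \<times> real \<times> 'b) \<Rightarrow> 'a \<Rightarrow> 'b" where
  "slope z \<equiv> \<lambda>x. snd (snd (z x))"

locale mfg_problem =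
  fixes H :: "real^'n \<Rightarrow> real^'n \<Rightarrow> real \<Rightarrow> real" and V :: "real^'n \<Rightarrow> real" and \<alpha> \<beta> C :: real
  assumes \<alpha>: "\<alpha> > 1" and \<beta>: "\<beta> > 0" and C: "C > 0"
    and meas: "(\<lambda>(x, p, m). H x p m) \<in> borel_measurable (lebesgue_on (UNIV \<times> UNIV \<times> {0<..}))"
    and ham: "AE x in torus. monotone_hamiltonian (H x) \<alpha> \<beta> C"
    and V: "in_Lp torus ((\<beta> + 1) / \<beta>) V"
begin

abbreviation \<gamma> :: real where "\<gamma> \<equiv> \<alpha> * ((\<beta> + 1) / \<beta>)"

lemma exponents: "(\<beta> + 1) / \<beta> > 1" "\<gamma> > 1" "\<gamma> \<ge> (\<beta> + 1) / \<beta>" "\<beta> + 1 > 1"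
proof -
  show q: "(\<beta> + 1) / \<beta> > 1" "\<beta> + 1 > 1" using \<beta> by (simp_all add: field_simps)
  show "\<gamma> \<ge> (\<beta> + 1) / \<beta>" using mult_right_mono[of 1 \<alpha> "(\<beta> + 1) / \<beta>"] \<alpha> q by simp
  thus "\<gamma> > 1" using q by linarith
qed

text \<open>Only integrability is asked; \<open>slope\<close> may be unrelated to
  \<open>val\<close>. The link between the two is part of \<open>admissible\<close>.\<close>

definition state :: "(real^'n \<Rightarrow> real \<times> real \<times> (real^'n)) \<Rightarrow> bool" where
  "state z \<longleftrightarrow> in_Lp torus (\<beta> + 1) (mass z) \<and> in_Lp torus \<gamma> (val z) \<and> in_Lp torus \<gamma> (slope z)"

definition energy :: "(real^'n \<Rightarrow> real \<times> real \<times> (real^'n)) \<Rightarrow> real" where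
  "energy z = Lp_mod torus (\<beta> + 1) (mass z) + Lp_mod torus \<gamma> (val z) + Lp_mod torus \<gamma> (slope z)"

text \<open>
  Integrating \<open>form w d\<close> pairs the operator \<open>(m, u) \<mapsto> (V - u - H, m - 1 - div (m D\<^sub>pH))\<close> at \<open>w\<close> with the
  direction \<open>d\<close>. The third component of a state stands for the weak gradient of the second.
\<close>

definition form :: "(real^'n \<Rightarrow> real \<times> real \<times> (real^'n)) \<Rightarrow> (real^'n \<Rightarrow> real \<times> real \<times> (real^'n)) \<Rightarrow> real^'n \<Rightarrow> real" where
  "form w d x = (V x - val w x - hval (H x) (slope w x) (mass w x)) * mass d x + (mass w x - 1) * val d x
     + hflux (H x) (slope w x) (mass w x) \<bullet> slope d x"

definition pairing :: "(real^'n \<Rightarrow> real \<times> real \<times> (real^'n)) \<Rightarrow> (real^'n \<Rightarrow> real \<times> real \<times> (real^'n)) \<Rightarrow> real" where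
  "pairing w d = (LINT x|torus. form w d x)"

text \<open>Built from the absolute values of \<open>w\<close> and \<open>d\<close> added together,
  so that it dominates the integrand at every nonnegative point of the segment from \<open>w\<close>
  to \<open>w + d\<close>, not only at \<open>w\<close>.\<close>

definition dom :: "(real^'n \<Rightarrow> real \<times> real \<times> (real^'n)) \<Rightarrow> (real^'n \<Rightarrow> real \<times> real \<times> (real^'n)) \<Rightarrow> real^'n \<Rightarrow> real" where
  "dom w d x = (21 * C + 4) * (1 + \<bar>V x\<bar> powr ((\<beta> + 1) / \<beta>) + (\<bar>mass w x\<bar> + \<bar>mass d x\<bar>) powr (\<beta> + 1)
     + (\<bar>val w x\<bar> + \<bar>val d x\<bar>) powr \<gamma> + (norm (slope w x) + norm (slope d x)) powr \<gamma>)"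

lemma stateD:
  assumes "state z"
  shows "in_Lp torus (\<beta> + 1) (mass z)" "in_Lp torus \<gamma> (val z)" "in_Lp torus \<gamma> (slope z)"
  using assms by (simp_all add: state_def)

lemma energy_nonneg: "energy z \<ge> 0"
  by (simp add: energy_def)

lemma state_linear:
  assumes "state z" "state w"
  shows "state (\<lambda>x. a *\<^sub>R z x + b *\<^sub>R w x)"
proof -
  have e: "\<beta> + 1 \<ge> 0" "\<gamma> \<ge> 0" using exponents by linarith+
  have "in_Lp torus (\<beta> + 1) (\<lambda>x. a *\<^sub>R mass z x + b *\<^sub>R mass w x)"
    "in_Lp torus \<gamma> (\<lambda>x. a *\<^sub>R val z x + b *\<^sub>R val w x)" "in_Lp torus \<gamma> (\<lambda>x. a *\<^sub>R slope z x + b *\<^sub>R slope w x)"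
    by (intro in_Lp_add in_Lp_scaleR stateD assms e)+
  thus ?thesis by (simp add: state_def)
qed

lemma state_diff: "state z \<Longrightarrow> state w \<Longrightarrow> state (\<lambda>x. z x - w x)"
  using state_linear[of z w 1 "-1"] by simp

lemma state_scaleR: "state z \<Longrightarrow> state (\<lambda>x. a *\<^sub>R z x)"
  using state_linear[of z z a 0] by simp

lemma form_linear: "form w (\<lambda>x. a *\<^sub>R d x + b *\<^sub>R e x) x = a * form w d x + b * form w e x"
  by (simp add: form_def algebra_simps inner_add_right)

lemma integrable_dom:
  assumes "state w" "state d"
  shows "integrable torus (dom w d)"
    and "(LINT x|torus. dom w d x) \<le> (21 * C + 4) * (1 + Lp_mod torus ((\<beta> + 1) / \<beta>) V + (2 powr (\<beta> + 1) + 2 powr \<gamma>) * (energy w + energy d))"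
proof -
  have e: "\<beta> + 1 \<ge> 0" "\<gamma> \<ge> 0" using exponents by linarith+
  note w = stateD[OF assms(1), THEN in_Lp_norm(1)] and d = stateD[OF assms(2), THEN in_Lp_norm(1)]
  note wn = stateD[OF assms(1), THEN in_Lp_norm(2)] and dn = stateD[OF assms(2), THEN in_Lp_norm(2)]
  note s = in_Lp_add[OF w(1) d(1) e(1)] in_Lp_add[OF w(2) d(2) e(2)] in_Lp_add[OF w(3) d(3) e(2)]
  have i: "integrable torus (\<lambda>x. (\<bar>mass w x\<bar> + \<bar>mass d x\<bar>) powr (\<beta> + 1))"
    "integrable torus (\<lambda>x. (\<bar>val w x\<bar> + \<bar>val d x\<bar>) powr \<gamma>)"
    "integrable torus (\<lambda>x. (norm (slope w x) + norm (slope d x)) powr \<gamma>)"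
    "integrable torus (\<lambda>x. \<bar>V x\<bar> powr ((\<beta> + 1) / \<beta>))"
    using in_LpD(2)[OF s(1)] in_LpD(2)[OF s(3)] in_LpD(2)[OF s(5)] in_LpD(2)[OF V] by simp_all
  show "integrable torus (dom w d)" unfolding dom_def
    by (intro integrable_mult_right Bochner_Integration.integrable_add i torus.integrable_const)
  have b: "(LINT x|torus. (\<bar>mass w x\<bar> + \<bar>mass d x\<bar>) powr (\<beta> + 1)) \<le> 2 powr (\<beta> + 1) * (Lp_mod torus (\<beta> + 1) (mass w) + Lp_mod torus (\<beta> + 1) (mass d))"
    "(LINT x|torus. (\<bar>val w x\<bar> + \<bar>val d x\<bar>) powr \<gamma>) \<le> 2 powr \<gamma> * (Lp_mod torus \<gamma> (val w) + Lp_mod torus \<gamma> (val d))"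
    "(LINT x|torus. (norm (slope w x) + norm (slope d x)) powr \<gamma>) \<le> 2 powr \<gamma> * (Lp_mod torus \<gamma> (slope w) + Lp_mod torus \<gamma> (slope d))"
    using s(2) s(4) s(6) unfolding wn dn by (simp_all add: Lp_mod_def)
  define k where "k = 2 powr (\<beta> + 1) + 2 powr \<gamma>"
  have k: "2 powr (\<beta> + 1) \<le> k" "2 powr \<gamma> \<le> k" by (simp_all add: k_def)
  have kb: "r * (Lp_mod torus p f + Lp_mod torus p g) \<le> k * (Lp_mod torus p f + Lp_mod torus p g)" if "r \<le> k"
    for r p and f g :: "real^'n \<Rightarrow> 'c::euclidean_space" using that by (intro mult_right_mono) auto
  have "(LINT x|torus. dom w d x) = (21 * C + 4) * (1 + Lp_mod torus ((\<beta> + 1) / \<beta>) V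
      + (LINT x|torus. (\<bar>mass w x\<bar> + \<bar>mass d x\<bar>) powr (\<beta> + 1))
      + (LINT x|torus. (\<bar>val w x\<bar> + \<bar>val d x\<bar>) powr \<gamma>) + (LINT x|torus. (norm (slope w x) + norm (slope d x)) powr \<gamma>))"
    unfolding dom_def using i by (simp add: Lp_mod_def)
  also have "\<dots> \<le> (21 * C + 4) * (1 + Lp_mod torus ((\<beta> + 1) / \<beta>) V
      + k * (Lp_mod torus (\<beta> + 1) (mass w) + Lp_mod torus (\<beta> + 1) (mass d))
      + k * (Lp_mod torus \<gamma> (val w) + Lp_mod torus \<gamma> (val d)) + k * (Lp_mod torus \<gamma> (slope w) + Lp_mod torus \<gamma> (slope d)))"
    using C by (intro mult_left_mono add_mono order_refl order_trans[OF b(1) kb[OF k(1)]] order_trans[OF b(2) kb[OF k(2)]]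
      order_trans[OF b(3) kb[OF k(2)]]) auto
  also have "\<dots> = (21 * C + 4) * (1 + Lp_mod torus ((\<beta> + 1) / \<beta>) V + k * (energy w + energy d))"
    unfolding energy_def by (simp only: distrib_left add.assoc add.commute add.left_commute)
  finally show "(LINT x|torus. dom w d x) \<le> (21 * C + 4) * (1 + Lp_mod torus ((\<beta> + 1) / \<beta>) V + (2 powr (\<beta> + 1) + 2 powr \<gamma>) * (energy w + energy d))"
    by (simp only: k_def)
qed

text \<open>The state \<open>w'\<close> differs from \<open>w\<close> on purpose: it will run
  through a segment starting at \<open>w\<close> while the dominating function stays fixed.\<close>

lemma form_le_dom:
  assumes "monotone_hamiltonian (H x) \<alpha> \<beta> C" "0 \<le> mass w' x" "mass w' x \<le> \<bar>mass w x\<bar> + \<bar>mass d x\<bar>"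
    "\<bar>val w' x\<bar> \<le> \<bar>val w x\<bar> + \<bar>val d x\<bar>" "norm (slope w' x) \<le> norm (slope w x) + norm (slope d x)"
  shows "\<bar>form w' d x\<bar> \<le> dom w d x"
  unfolding form_def dom_def
  by (rule monotone_hamiltonian.form_bound[OF assms(1,2,3) _ assms(4) _ assms(5)]) auto

lemma form_measurable:
  assumes w: "state w" and pos: "AE x in torus. mass w x \<ge> 0" and d: "state d"
  shows "form w d \<in> borel_measurable torus"
proof -
  note [measurable] = stateD[OF w, THEN in_LpD(1)] stateD[OF d, THEN in_LpD(1)] in_LpD(1)[OF V]
    hval_measurable[OF meas ham stateD(3)[OF w, THEN in_LpD(1)] stateD(1)[OF w, THEN in_LpD(1)] pos]
  show ?thesis unfolding form_def by measurable
qed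

lemma form_integrable:
  assumes w: "state w" and pos: "AE x in torus. mass w x \<ge> 0" and d: "state d"
  shows "integrable torus (form w d)" and "\<bar>pairing w d\<bar> \<le> (LINT x|torus. dom w d x)"
proof -
  have le: "AE x in torus. norm (form w d x) \<le> dom w d x"
    using ham pos by eventually_elim (use form_le_dom in \<open>auto simp del: form_le_dom\<close>)
  show i: "integrable torus (form w d)"
    by (rule Bochner_Integration.integrable_bound[OF integrable_dom(1)[OF w d] form_measurable[OF w pos d]])
       (use le in \<open>auto elim!: eventually_mono\<close>)
  have "\<bar>pairing w d\<bar> \<le> (LINT x|torus. norm (form w d x))" unfolding pairing_def using integral_norm_bound[of torus "form w d"] by simp
  also have "\<dots> \<le> (LINT x|torus. dom w d x)"
    using i le by (intro integral_mono_AE integrable_dom w d) auto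
  finally show "\<bar>pairing w d\<bar> \<le> (LINT x|torus. dom w d x)" .
qed

lemma pairing_linear:
  assumes w: "state w" and pos: "AE x in torus. mass w x \<ge> 0" and d: "state d" "state e"
  shows "pairing w (\<lambda>x. a *\<^sub>R d x + b *\<^sub>R e x) = a * pairing w d + b * pairing w e"
  unfolding pairing_def form_linear using form_integrable(1)[OF w pos d(1)] form_integrable(1)[OF w pos d(2)] by simp

lemma pairing_diff:
  assumes w: "state w" and pos: "AE x in torus. mass w x \<ge> 0" and d: "state d" "state e"
  shows "pairing w (\<lambda>x. d x - e x) = pairing w d - pairing w e"
  using pairing_linear[OF assms, of 1 "-1"] by simp

lemma pairing_sum:
  assumes w: "state w" and pos: "AE x in torus. mass w x \<ge> 0" and d: "\<And>i. i \<in> I \<Longrightarrow> state (d i)"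
  shows "pairing w (\<lambda>x. \<Sum>i\<in>I. l i *\<^sub>R d i x) = (\<Sum>i\<in>I. l i * pairing w (d i))"
proof -
  have f: "form w (\<lambda>x. \<Sum>i\<in>I. l i *\<^sub>R d i x) = (\<lambda>x. \<Sum>i\<in>I. l i * form w (d i) x)"
    by (rule ext) (simp add: form_def fst_sum snd_sum sum_distrib_left sum_distrib_right inner_sum_right distrib_left sum.distrib ac_simps)
  have "integrable torus (\<lambda>x. l i * form w (d i) x)" if "i \<in> I" for i
    by (intro integrable_mult_right form_integrable(1)[OF w pos d[OF that]])
  from Bochner_Integration.integral_sum[OF this] show ?thesis unfolding pairing_def f by simp
qed

text \<open>The exponent \<open>\<beta> + 1 + \<gamma>\<close> exceeds both exponents in the energy,
  and \<open>1 / s\<close> is at least \<open>1\<close>, so one factor covers all three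
  components.\<close>

lemma energy_scaleR_le:
  assumes "state d" "0 < s" "s \<le> 1"
  shows "energy (\<lambda>x. (1 / s) *\<^sub>R d x) \<le> (1 / s) powr (\<beta> + 1 + \<gamma>) * energy d"
proof -
  have e: "\<beta> + 1 \<ge> 0" "\<gamma> \<ge> 1" using exponents by linarith+
  have le: "\<bar>1 / s\<bar> powr p * x \<le> (1 / s) powr (\<beta> + 1 + \<gamma>) * x" if "p \<le> \<beta> + 1 + \<gamma>" "x \<ge> 0" for p x
    using assms that by (intro mult_right_mono) (auto intro!: powr_mono)
  have "energy (\<lambda>x. (1 / s) *\<^sub>R d x) = \<bar>1 / s\<bar> powr (\<beta> + 1) * Lp_mod torus (\<beta> + 1) (mass d)
      + \<bar>1 / s\<bar> powr \<gamma> * Lp_mod torus \<gamma> (val d) + \<bar>1 / s\<bar> powr \<gamma> * Lp_mod torus \<gamma> (slope d)"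
    unfolding energy_def fst_scaleR snd_scaleR by (simp only: in_Lp_scaleR(2)[OF stateD(1)[OF assms(1)]]
      in_Lp_scaleR(2)[OF stateD(2)[OF assms(1)]] in_Lp_scaleR(2)[OF stateD(3)[OF assms(1)]])
  also have "\<dots> \<le> (1 / s) powr (\<beta> + 1 + \<gamma>) * energy d"
    unfolding energy_def distrib_left by (intro add_mono le) (use e in auto)
  finally show ?thesis .
qed

text \<open>
  Applying the energy bound to \<open>d / s\<close> and multiplying by \<open>s\<close> shows continuity in the direction
  without passing to dual exponents.
\<close>

lemma pairing_tendsto_0:
  assumes w: "state w" and pos: "AE x in torus. mass w x \<ge> 0" and d: "\<And>n. state (d n)"
    and lim: "(\<lambda>n. energy (d n)) \<longlonglongrightarrow> 0"
  shows "(\<lambda>n. pairing w (d n)) \<longlonglongrightarrow> 0"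
proof (rule LIMSEQ_I)
  fix \<epsilon> :: real assume \<epsilon>: "\<epsilon> > 0"
  define K k a where "K = 21 * C + 4" and "k = 2 powr (\<beta> + 1) + 2 powr \<gamma>" and "a = 1 + Lp_mod torus ((\<beta> + 1) / \<beta>) V + k * energy w"
  have K: "K > 0" "k > 0" "a > 0"
    using C energy_nonneg[of w] by (simp_all add: K_def k_def a_def add_pos_nonneg add_pos_pos)
  \<comment> \<open>The part of the bound that does not involve \<open>d n\<close> is
    \<open>s * (K * a)\<close>; this \<open>s\<close> makes it at most
    \<open>\<epsilon> / 2\<close>. The other part is a fixed multiple of the vanishing
    energy.\<close>
  define s where "s = min 1 (\<epsilon> / (2 * K * a))"
  have s: "0 < s" "s \<le> 1" using \<epsilon> K by (simp_all add: s_def)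
  have "s * (K * a) \<le> \<epsilon> / (2 * K * a) * (K * a)" using K by (intro mult_right_mono) (simp_all add: s_def)
  also have "\<dots> = \<epsilon> / 2" using K by simp
  finally have s2: "s * (K * a) \<le> \<epsilon> / 2" .
  define r where "r = s * K * k * (1 / s) powr (\<beta> + 1 + \<gamma>)"
  have le: "\<bar>pairing w (d n)\<bar> \<le> s * (K * a) + r * energy (d n)" for n
  proof -
    define e where "e = (\<lambda>x. (1 / s) *\<^sub>R d n x)"
    have st: "state e" unfolding e_def by (rule state_scaleR[OF d])
    have "d n = (\<lambda>x. s *\<^sub>R e x + 0 *\<^sub>R e x)" using s by (simp add: e_def)
    hence "pairing w (d n) = s * pairing w e" using pairing_linear[OF w pos st st, of s 0] by simp
    hence "\<bar>pairing w (d n)\<bar> = s * \<bar>pairing w e\<bar>" using s by (simp add: abs_mult)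
    also have "\<dots> \<le> s * (K * (1 + Lp_mod torus ((\<beta> + 1) / \<beta>) V + k * (energy w + energy e)))"
      using s unfolding K_def k_def
      by (intro mult_left_mono order_trans[OF form_integrable(2)[OF w pos st] integrable_dom(2)[OF w st]]) auto
    also have "\<dots> = s * (K * a) + s * K * k * energy e" by (simp add: a_def algebra_simps)
    also have "\<dots> \<le> s * (K * a) + s * K * k * ((1 / s) powr (\<beta> + 1 + \<gamma>) * energy (d n))"
      using s K energy_scaleR_le[OF d s, of n] unfolding e_def by (intro add_left_mono mult_left_mono) auto
    finally show ?thesis by (simp add: r_def mult.assoc)
  qed
  have "(\<lambda>n. r * energy (d n)) \<longlonglongrightarrow> 0" using lim by (rule tendsto_mult_right_zero)
  from LIMSEQ_D[OF this, of "\<epsilon> / 2"] \<epsilon> obtain N where N: "\<And>n. n \<ge> N \<Longrightarrow> \<bar>r * energy (d n)\<bar> < \<epsilon> / 2" by auto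
  show "\<exists>N. \<forall>n\<ge>N. norm (pairing w (d n) - 0) < \<epsilon>"
  proof (intro exI allI impI)
    fix n assume "N \<le> n"
    from N[OF this] le[of n] s2 show "norm (pairing w (d n) - 0) < \<epsilon>" by simp
  qed
qed

text \<open>Three separate bounds instead of one bound on \<open>energy\<close>: the mass constraint
  can then be recognised as inactive, and exploited as such, before anything is known about the
  other two.\<close>

definition admissible :: "real \<Rightarrow> (real^'n \<Rightarrow> real \<times> real \<times> (real^'n)) set" where
  "admissible R = {z. in_Lp torus (\<beta> + 1) (mass z) \<and> (AE x in torus. mass z x \<ge> 0) \<and> Lp_mod torus (\<beta> + 1) (mass z) \<le> R
     \<and> sobolev \<gamma> (val z) (slope z) \<and> Lp_mod torus \<gamma> (val z) \<le> R \<and> Lp_mod torus \<gamma> (slope z) \<le> R}"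

lemma admissibleD:
  assumes "z \<in> admissible R"
  shows "state z" "AE x in torus. mass z x \<ge> 0" "sobolev \<gamma> (val z) (slope z)"
    "Lp_mod torus (\<beta> + 1) (mass z) \<le> R" "Lp_mod torus \<gamma> (val z) \<le> R" "Lp_mod torus \<gamma> (slope z) \<le> R"
  using assms sobolevD by (auto simp: admissible_def state_def)

lemma admissible_convex:
  assumes z: "z \<in> admissible R" and w: "w \<in> admissible R" and t: "0 \<le> t" "t \<le> 1"
  shows "(\<lambda>x. (1 - t) *\<^sub>R z x + t *\<^sub>R w x) \<in> admissible R"
proof -
  note Z = admissibleD[OF z] and W = admissibleD[OF w]
  have e: "\<beta> + 1 \<ge> 1" "\<gamma> \<ge> 1" using exponents by linarith+
  have R: "(1 - t) * a + t * b \<le> R" if "a \<le> R" "b \<le> R" for a b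
    using convex_bound_le[OF that, of "1 - t" t] t by simp
  note c1 = Lp_mod_convex[OF stateD(1)[OF Z(1)] stateD(1)[OF W(1)] e(1) t]
    and c2 = Lp_mod_convex[OF stateD(2)[OF Z(1)] stateD(2)[OF W(1)] e(2) t]
    and c3 = Lp_mod_convex[OF stateD(3)[OF Z(1)] stateD(3)[OF W(1)] e(2) t]
  have "AE x in torus. 0 \<le> (1 - t) * mass z x + t * mass w x"
    using Z(2) W(2) by eventually_elim (use t in simp)
  thus ?thesis
    using c1(1) order_trans[OF c1(2) R[OF Z(4) W(4)]] order_trans[OF c2(2) R[OF Z(5) W(5)]] order_trans[OF c3(2) R[OF Z(6) W(6)]]
      sobolev_linear[OF e(2) Z(3) W(3), of "1 - t" t]
    by (simp add: admissible_def)
qed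

lemma admissible_const:
  assumes "R \<ge> 1"
  shows "(\<lambda>x. (1, 0, 0)) \<in> admissible R"
proof -
  have g: "grad (\<lambda>x :: real^'n. 0 :: real) = (\<lambda>x. 0)" by (rule ext) (rule grad_eqI[OF GDERIV_const])
  have "sobolev \<gamma> (\<lambda>x :: real^'n. 0) (grad (\<lambda>x. 0))"
    by (rule sobolev_smooth[OF Cinf_torus_const]) (use exponents in linarith)
  hence "sobolev \<gamma> (\<lambda>x :: real^'n. 0) (\<lambda>x. 0)" unfolding g .
  moreover have "in_Lp torus (\<beta> + 1) (\<lambda>x :: real^'n. 1 :: real)" by (rule torus.in_Lp_const)
  ultimately show ?thesis using assms exponents by (simp add: admissible_def Lp_mod_def)
qed

text \<open>In the sum the potential cancels, and so do the products of mass and value differences,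
  which enter with opposite signs. What remains is the monotonicity expression of \<open>H\<close>,
  available where both masses are positive.\<close>

lemma pairing_monotone:
  assumes z: "z \<in> admissible R" "AE x in torus. mass z x > 0" and w: "w \<in> admissible R" "AE x in torus. mass w x > 0"
  shows "pairing w (\<lambda>x. w x - z x) + pairing z (\<lambda>x. z x - w x) \<ge> 0"
proof -
  note Z = admissibleD[OF z(1)] and W = admissibleD[OF w(1)]
  have i: "integrable torus (form w (\<lambda>x. w x - z x))" "integrable torus (form z (\<lambda>x. z x - w x))"
    by (intro form_integrable Z W state_diff)+
  have "AE x in torus. 0 \<le> form w (\<lambda>x. w x - z x) x + form z (\<lambda>x. z x - w x) x"
    using ham z(2) w(2)
  proof eventually_elim
    fix x assume x: "monotone_hamiltonian (H x) \<alpha> \<beta> C" "mass z x > 0" "mass w x > 0"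
    from monotone_hamiltonian.mono[OF x(1,3,2), of "slope w x" "slope z x"]
    show "0 \<le> form w (\<lambda>x. w x - z x) x + form z (\<lambda>x. z x - w x) x"
      using x(2,3) by (simp add: form_def hval_def hflux_def algebra_simps inner_diff_left inner_diff_right)
  qed
  hence "0 \<le> (LINT x|torus. form w (\<lambda>x. w x - z x) x + form z (\<lambda>x. z x - w x) x)" by (rule integral_nonneg_AE)
  thus ?thesis using i by (simp add: pairing_def)
qed

text \<open>The unknown is sought as a convex combination of the test states themselves. Minty's
  inequalities then read as nonnegative payoffs of a matrix, and \<open>pairing_monotone\<close> is
  the hypothesis of the matrix game.\<close>

lemma admissible_finite_minty:
  assumes F: "finite F" "F \<subseteq> {w \<in> admissible R. AE x in torus. mass w x > 0}" and R: "R \<ge> 1"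
  shows "\<exists>z\<in>admissible R. \<forall>w\<in>F. pairing w (\<lambda>x. w x - z x) \<ge> 0"
proof (cases "F = {}")
  case True thus ?thesis using admissible_const[OF R] by blast
next
  case False
  have wF: "w \<in> admissible R" "AE x in torus. mass w x > 0" if "w \<in> F" for w using that F(2) by auto
  define B where "B w z = pairing w (\<lambda>x. w x - z x)" for w z
  obtain l where l: "\<And>i. l i \<ge> 0" "sum l F = 1" "\<And>j. j \<in> F \<Longrightarrow> (\<Sum>i\<in>F. l i * B j i) \<ge> 0"
    by (rule skew_dominated_matrix_game[OF F(1) False, of B]) (auto simp: B_def intro!: pairing_monotone wF)
  define z where "z = (\<lambda>x. \<Sum>i\<in>F. l i *\<^sub>R i x)"
  have zK: "z \<in> admissible R"
    unfolding z_def by (rule finite_convex_combination[OF admissible_convex F(1), where w = "\<lambda>i. i"]) (use l wF in auto)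
  have "pairing w (\<lambda>x. w x - z x) \<ge> 0" if w: "w \<in> F" for w
  proof -
    note W = admissibleD[OF wF(1)[OF w]]
    have "w x - z x = (\<Sum>i\<in>F. l i *\<^sub>R (w x - i x))" for x
      using l(2) by (simp add: z_def scaleR_diff_right sum_subtractf flip: scaleR_sum_left)
    hence "pairing w (\<lambda>x. w x - z x) = (\<Sum>i\<in>F. l i * B w i)"
      unfolding B_def using pairing_sum[OF W(1,2), of F "\<lambda>i x. w x - i x" l] state_diff[OF W(1) admissibleD(1)[OF wF(1)]] by simp
    thus ?thesis using l(3)[OF w] by simp
  qed
  thus ?thesis using zK by blast
qed

text \<open>The gap of the energy is a sum of three nonnegative gaps, so its smallness makes each of
  them small.\<close>

lemma energy_uniformly_convex:
  assumes \<epsilon>: "\<epsilon> > 0" and R: "R \<ge> 0"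
  shows "\<exists>\<delta>>0. \<forall>a\<in>admissible R. \<forall>b\<in>admissible R.
    energy a + energy b - 2 * energy (\<lambda>x. (1/2) *\<^sub>R (a x + b x)) < \<delta> \<longrightarrow> energy (\<lambda>x. a x - b x) < \<epsilon>"
proof -
  have e: "\<beta> + 1 > 1" "\<gamma> > 1" "\<epsilon> / 3 > 0" using exponents \<epsilon> by simp_all
  obtain d1 where d1: "d1 > 0" "\<And>f g :: real^'n \<Rightarrow> real. in_Lp torus (\<beta> + 1) f \<Longrightarrow> in_Lp torus (\<beta> + 1) g \<Longrightarrow> Lp_mod torus (\<beta> + 1) f \<le> R \<Longrightarrow> Lp_mod torus (\<beta> + 1) g \<le> R \<Longrightarrow>
      Lp_mod torus (\<beta> + 1) f + Lp_mod torus (\<beta> + 1) g - 2 * Lp_mod torus (\<beta> + 1) (\<lambda>x. (1/2) *\<^sub>R (f x + g x)) < d1 \<Longrightarrow> Lp_mod torus (\<beta> + 1) (\<lambda>x. f x - g x) < \<epsilon> / 3"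
    using Lp_mod_uniformly_convex[OF e(1) R e(3), where 'b = real and M = torus] by blast
  obtain d2 where d2: "d2 > 0" "\<And>f g :: real^'n \<Rightarrow> real. in_Lp torus \<gamma> f \<Longrightarrow> in_Lp torus \<gamma> g \<Longrightarrow> Lp_mod torus \<gamma> f \<le> R \<Longrightarrow> Lp_mod torus \<gamma> g \<le> R \<Longrightarrow>
      Lp_mod torus \<gamma> f + Lp_mod torus \<gamma> g - 2 * Lp_mod torus \<gamma> (\<lambda>x. (1/2) *\<^sub>R (f x + g x)) < d2 \<Longrightarrow> Lp_mod torus \<gamma> (\<lambda>x. f x - g x) < \<epsilon> / 3"
    using Lp_mod_uniformly_convex[OF e(2) R e(3), where 'b = real and M = torus] by blast
  obtain d3 where d3: "d3 > 0" "\<And>f g :: real^'n \<Rightarrow> real^'n. in_Lp torus \<gamma> f \<Longrightarrow> in_Lp torus \<gamma> g \<Longrightarrow> Lp_mod torus \<gamma> f \<le> R \<Longrightarrow> Lp_mod torus \<gamma> g \<le> R \<Longrightarrow>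
      Lp_mod torus \<gamma> f + Lp_mod torus \<gamma> g - 2 * Lp_mod torus \<gamma> (\<lambda>x. (1/2) *\<^sub>R (f x + g x)) < d3 \<Longrightarrow> Lp_mod torus \<gamma> (\<lambda>x. f x - g x) < \<epsilon> / 3"
    using Lp_mod_uniformly_convex[OF e(2) R e(3), where 'b = "real^'n" and M = torus] by blast
  have gap: "2 * Lp_mod torus p (\<lambda>x. (1/2) *\<^sub>R (f x + g x)) \<le> Lp_mod torus p f + Lp_mod torus p g"
    if "in_Lp torus p f" "in_Lp torus p g" "p > 1" for p and f g :: "real^'n \<Rightarrow> 'c::euclidean_space"
    using Lp_mod_convex(2)[OF that(1,2), of "1/2"] that(3) by (simp add: scaleR_add_right)
  show ?thesis
  proof (intro exI[of _ "min d1 (min d2 d3)"] conjI ballI impI)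
    show "min d1 (min d2 d3) > 0" using d1(1) d2(1) d3(1) by simp
    fix a b assume a: "a \<in> admissible R" and b: "b \<in> admissible R"
      and small: "energy a + energy b - 2 * energy (\<lambda>x. (1/2) *\<^sub>R (a x + b x)) < min d1 (min d2 d3)"
    note a' = admissibleD[OF a] and b' = admissibleD[OF b]
    note sa = stateD[OF a'(1)] and sb = stateD[OF b'(1)]
    define g1 g2 g3 where "g1 = Lp_mod torus (\<beta> + 1) (mass a) + Lp_mod torus (\<beta> + 1) (mass b) - 2 * Lp_mod torus (\<beta> + 1) (\<lambda>x. (1/2) *\<^sub>R (mass a x + mass b x))"
      and "g2 = Lp_mod torus \<gamma> (val a) + Lp_mod torus \<gamma> (val b) - 2 * Lp_mod torus \<gamma> (\<lambda>x. (1/2) *\<^sub>R (val a x + val b x))"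
      and "g3 = Lp_mod torus \<gamma> (slope a) + Lp_mod torus \<gamma> (slope b) - 2 * Lp_mod torus \<gamma> (\<lambda>x. (1/2) *\<^sub>R (slope a x + slope b x))"
    have "energy a + energy b - 2 * energy (\<lambda>x. (1/2) *\<^sub>R (a x + b x)) = g1 + g2 + g3"
      unfolding energy_def g1_def g2_def g3_def fst_scaleR snd_scaleR fst_add snd_add by argo
    moreover have "g1 \<ge> 0" "g2 \<ge> 0" "g3 \<ge> 0"
      using gap[OF sa(1) sb(1) e(1)] gap[OF sa(2) sb(2) e(2)] gap[OF sa(3) sb(3) e(2)] unfolding g1_def g2_def g3_def by linarith+
    ultimately have "g1 < d1" "g2 < d2" "g3 < d3" using small by linarith+
    hence "Lp_mod torus (\<beta> + 1) (\<lambda>x. mass a x - mass b x) < \<epsilon> / 3" "Lp_mod torus \<gamma> (\<lambda>x. val a x - val b x) < \<epsilon> / 3"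
      "Lp_mod torus \<gamma> (\<lambda>x. slope a x - slope b x) < \<epsilon> / 3"
      using d1(2)[OF sa(1) sb(1) a'(4) b'(4)] d2(2)[OF sa(2) sb(2) a'(5) b'(5)] d3(2)[OF sa(3) sb(3) a'(6) b'(6)]
      unfolding g1_def g2_def g3_def by blast+
    thus "energy (\<lambda>x. a x - b x) < \<epsilon>" unfolding energy_def fst_diff snd_diff by linarith
  qed
qed

lemma admissible_complete:
  assumes z: "\<And>n. z n \<in> admissible R"
    and cauchy: "\<And>\<epsilon>. \<epsilon> > 0 \<Longrightarrow> \<exists>N. \<forall>m\<ge>N. \<forall>n\<ge>N. energy (\<lambda>x. z m x - z n x) < \<epsilon>"
  shows "\<exists>y\<in>admissible R. (\<lambda>n. energy (\<lambda>x. z n x - y x)) \<longlonglongrightarrow> 0"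
proof -
  note Z = admissibleD[OF z] and s = stateD[OF admissibleD(1)[OF z]]
  have e: "\<beta> + 1 > 0" "\<gamma> > 0" "\<beta> + 1 \<ge> 1" "\<gamma> \<ge> 1" using exponents by linarith+
  have c: "\<exists>N. \<forall>m\<ge>N. \<forall>n\<ge>N. Lp_mod torus (\<beta> + 1) (\<lambda>x. mass (z m) x - mass (z n) x) < \<epsilon>"
    "\<exists>N. \<forall>m\<ge>N. \<forall>n\<ge>N. Lp_mod torus \<gamma> (\<lambda>x. val (z m) x - val (z n) x) < \<epsilon>"
    "\<exists>N. \<forall>m\<ge>N. \<forall>n\<ge>N. Lp_mod torus \<gamma> (\<lambda>x. slope (z m) x - slope (z n) x) < \<epsilon>" if "\<epsilon> > 0" for \<epsilon>
  proof -
    have le: "Lp_mod torus (\<beta> + 1) (\<lambda>x. mass (z m) x - mass (z n) x) \<le> energy (\<lambda>x. z m x - z n x)"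
      "Lp_mod torus \<gamma> (\<lambda>x. val (z m) x - val (z n) x) \<le> energy (\<lambda>x. z m x - z n x)"
      "Lp_mod torus \<gamma> (\<lambda>x. slope (z m) x - slope (z n) x) \<le> energy (\<lambda>x. z m x - z n x)" for m n
      by (simp_all add: energy_def)
    show "\<exists>N. \<forall>m\<ge>N. \<forall>n\<ge>N. Lp_mod torus (\<beta> + 1) (\<lambda>x. mass (z m) x - mass (z n) x) < \<epsilon>"
      "\<exists>N. \<forall>m\<ge>N. \<forall>n\<ge>N. Lp_mod torus \<gamma> (\<lambda>x. val (z m) x - val (z n) x) < \<epsilon>"
      "\<exists>N. \<forall>m\<ge>N. \<forall>n\<ge>N. Lp_mod torus \<gamma> (\<lambda>x. slope (z m) x - slope (z n) x) < \<epsilon>"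
      using cauchy[OF that] le_less_trans[OF le(1)] le_less_trans[OF le(2)] le_less_trans[OF le(3)] by blast+
  qed
  obtain m where m: "in_Lp torus (\<beta> + 1) m" "(\<lambda>n. Lp_mod torus (\<beta> + 1) (\<lambda>x. mass (z n) x - m x)) \<longlonglongrightarrow> 0"
    by (rule Lp_complete[OF s(1) e(1) c(1)])
  obtain u where u: "in_Lp torus \<gamma> u" "(\<lambda>n. Lp_mod torus \<gamma> (\<lambda>x. val (z n) x - u x)) \<longlonglongrightarrow> 0"
    by (rule Lp_complete[OF s(2) e(2) c(2)])
  obtain g where g: "in_Lp torus \<gamma> g" "(\<lambda>n. Lp_mod torus \<gamma> (\<lambda>x. slope (z n) x - g x)) \<longlonglongrightarrow> 0"
    by (rule Lp_complete[OF s(3) e(2) c(3)])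
  define y where "y x = (m x, u x, g x)" for x
  have "y \<in> admissible R"
    using m(1) AE_nonneg_Lp_closed[OF s(1) m(1) Z(2) e(1) m(2)]
      Lp_mod_le_closed(2)[OF s(1) m(1) e(3) m(2) Z(4)] Lp_mod_le_closed(2)[OF s(2) u(1) e(4) u(2) Z(5)]
      Lp_mod_le_closed(2)[OF s(3) g(1) e(4) g(2) Z(6)] sobolevI_seq[OF e(4) u(1) g(1) Z(3) u(2) g(2)]
    by (simp add: admissible_def y_def)
  moreover have "(\<lambda>n. energy (\<lambda>x. z n x - y x)) \<longlonglongrightarrow> 0 + 0 + 0"
    unfolding energy_def fst_diff snd_diff y_def fst_conv snd_conv by (intro tendsto_add m u g)
  ultimately show ?thesis by auto
qed

lemma energy_diff_le:
  assumes "state a" "state b" "state c"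
  shows "energy (\<lambda>x. a x - c x) \<le> (2 powr (\<beta> + 1) + 2 powr \<gamma>) * (energy (\<lambda>x. a x - b x) + energy (\<lambda>x. b x - c x))"
proof -
  have e: "\<beta> + 1 \<ge> 0" "\<gamma> \<ge> 0" using exponents by linarith+
  define k where "k = 2 powr (\<beta> + 1) + 2 powr \<gamma>"
  have tri: "Lp_mod torus p (\<lambda>x. f x - h x) \<le> k * (Lp_mod torus p (\<lambda>x. f x - g x) + Lp_mod torus p (\<lambda>x. g x - h x))"
    if "in_Lp torus p f" "in_Lp torus p g" "in_Lp torus p h" "p \<ge> 0" "2 powr p \<le> k" for p and f g h :: "real^'n \<Rightarrow> 'c::euclidean_space"
  proof -
    have "Lp_mod torus p (\<lambda>x. f x - h x) \<le> 2 powr p * (Lp_mod torus p (\<lambda>x. f x - g x) + Lp_mod torus p (\<lambda>x. g x - h x))"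
      using in_Lp_add(2)[OF in_Lp_diff(1)[OF that(1,2,4)] in_Lp_diff(1)[OF that(2,3,4)] that(4)] by simp
    also have "\<dots> \<le> k * (Lp_mod torus p (\<lambda>x. f x - g x) + Lp_mod torus p (\<lambda>x. g x - h x))"
      using that by (intro mult_right_mono) auto
    finally show ?thesis .
  qed
  have k: "2 powr (\<beta> + 1) \<le> k" "2 powr \<gamma> \<le> k" by (simp_all add: k_def)
  note A = stateD[OF assms(1)] and B = stateD[OF assms(2)] and D = stateD[OF assms(3)]
  show ?thesis
    using tri[OF A(1) B(1) D(1) e(1) k(1)] tri[OF A(2) B(2) D(2) e(2) k(2)] tri[OF A(3) B(3) D(3) e(2) k(2)]
    unfolding energy_def fst_diff snd_diff k_def[symmetric] distrib_left by linarith
qed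

text \<open>For a fixed test state \<open>w\<close> the unknown enters only as a direction, hence
  affinely and continuously. Each constraint is thus convex and closed, as the intersection
  principle demands.\<close>

lemma minty_solution:
  assumes R: "R \<ge> 1"
  shows "\<exists>z\<in>admissible R. \<forall>w\<in>{w \<in> admissible R. AE x in torus. mass w x > 0}. pairing w (\<lambda>x. w x - z x) \<ge> 0"
proof (rule uniformly_convex_intersection[where \<Phi> = energy and mid = "\<lambda>a b x. (1/2) *\<^sub>R (a x + b x)" and B = "3 * R"
    and D = "\<lambda>a b. energy (\<lambda>x. a x - b x)" and T = "2 powr (\<beta> + 1) + 2 powr \<gamma>"])
  fix a assume "a \<in> admissible R"
  from admissibleD(4-6)[OF this] show "0 \<le> energy a \<and> energy a \<le> 3 * R"
    unfolding energy_def using Lp_mod_nonneg by (auto intro: add_nonneg_nonneg)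
next
  fix a b assume "a \<in> admissible R" "b \<in> admissible R"
  from admissible_convex[OF this, of "1/2"] show "(\<lambda>x. (1/2) *\<^sub>R (a x + b x)) \<in> admissible R"
    by (simp add: scaleR_add_right)
next
  fix a b w assume ab: "a \<in> admissible R" "b \<in> admissible R"
    and w: "w \<in> {w \<in> admissible R. AE x in torus. mass w x > 0}"
    and P: "pairing w (\<lambda>x. w x - a x) \<ge> 0" "pairing w (\<lambda>x. w x - b x) \<ge> 0"
  have W: "state w" "AE x in torus. mass w x \<ge> 0" using w admissibleD by blast+
  have "w x - (1/2) *\<^sub>R (a x + b x) = (1/2) *\<^sub>R (w x - a x) + (1/2) *\<^sub>R (w x - b x)" for x
    by (simp add: algebra_simps flip: scaleR_add_left)
  hence "pairing w (\<lambda>x. w x - (1/2) *\<^sub>R (a x + b x)) = 1/2 * pairing w (\<lambda>x. w x - a x) + 1/2 * pairing w (\<lambda>x. w x - b x)"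
    using pairing_linear[OF W state_diff[OF W(1) admissibleD(1)[OF ab(1)]] state_diff[OF W(1) admissibleD(1)[OF ab(2)]], of "1/2" "1/2"] by simp
  thus "pairing w (\<lambda>x. w x - (1/2) *\<^sub>R (a x + b x)) \<ge> 0" using P by simp
next
  fix F assume "finite F" "F \<subseteq> {w \<in> admissible R. AE x in torus. mass w x > 0}"
  thus "\<exists>z\<in>admissible R. \<forall>w\<in>F. pairing w (\<lambda>x. w x - z x) \<ge> 0" using R by (rule admissible_finite_minty)
next
  fix \<epsilon> :: real assume "\<epsilon> > 0"
  thus "\<exists>\<delta>>0. \<forall>a\<in>admissible R. \<forall>b\<in>admissible R.
    energy a + energy b - 2 * energy (\<lambda>x. (1/2) *\<^sub>R (a x + b x)) < \<delta> \<longrightarrow> energy (\<lambda>x. a x - b x) < \<epsilon>"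
    using R by (intro energy_uniformly_convex) auto
next
  fix z :: "nat \<Rightarrow> real^'n \<Rightarrow> real \<times> real \<times> (real^'n)"
  assume "\<And>n. z n \<in> admissible R" "\<And>\<epsilon>. \<epsilon> > 0 \<Longrightarrow> \<exists>N. \<forall>m\<ge>N. \<forall>n\<ge>N. energy (\<lambda>x. z m x - z n x) < \<epsilon>"
  thus "\<exists>y\<in>admissible R. (\<lambda>n. energy (\<lambda>x. z n x - y x)) \<longlonglongrightarrow> 0" by (rule admissible_complete)
next
  fix a b :: "real^'n \<Rightarrow> real \<times> real \<times> (real^'n)" show "energy (\<lambda>x. a x - b x) \<ge> 0" by (rule energy_nonneg)
next
  fix a b c assume "a \<in> admissible R" "b \<in> admissible R" "c \<in> admissible R"
  thus "energy (\<lambda>x. a x - c x) \<le> (2 powr (\<beta> + 1) + 2 powr \<gamma>) * (energy (\<lambda>x. a x - b x) + energy (\<lambda>x. b x - c x))"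
    by (intro energy_diff_le admissibleD(1))
next
  fix w y and z :: "nat \<Rightarrow> real^'n \<Rightarrow> real \<times> real \<times> (real^'n)"
  assume w: "w \<in> {w \<in> admissible R. AE x in torus. mass w x > 0}"
    and z: "\<And>n. z n \<in> admissible R \<and> pairing w (\<lambda>x. w x - z n x) \<ge> 0" and y: "y \<in> admissible R"
    and lim: "(\<lambda>n. energy (\<lambda>x. z n x - y x)) \<longlonglongrightarrow> 0"
  have W: "state w" "AE x in torus. mass w x \<ge> 0" using w admissibleD by blast+
  have Z: "state (z n)" and Y: "state y" for n using z y admissibleD(1) by blast+
  have "(\<lambda>n. pairing w (\<lambda>x. z n x - y x)) \<longlonglongrightarrow> 0" by (rule pairing_tendsto_0[OF W state_diff[OF Z Y] lim])
  moreover have "- pairing w (\<lambda>x. z n x - y x) \<ge> - pairing w (\<lambda>x. w x - y x)" for n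
    using z[of n] pairing_diff[OF W W(1) Y] pairing_diff[OF W W(1) Z[of n]] pairing_diff[OF W Z[of n] Y] by linarith
  ultimately have "- pairing w (\<lambda>x. w x - y x) \<le> - 0"
    by (intro LIMSEQ_le_const[OF tendsto_minus]) blast+
  thus "pairing w (\<lambda>x. w x - y x) \<ge> 0" by simp
qed

end

text \<open>The two powers balance at \<open>X\<close>: below it the lower power is bounded by its
  value at \<open>X\<close>, above it the higher power dominates.\<close>

lemma powr_absorb:
  fixes c e r s :: real
  assumes "0 < r" "r < s" "c > 0" "e > 0"
  obtains K where "K \<ge> 0" "\<And>x. x \<ge> 0 \<Longrightarrow> c * x powr r \<le> e * x powr s + K"
proof -
  define X where "X = (c / e) powr (1 / (s - r))"
  have X: "X powr (s - r) = c / e" "X \<ge> 0" using assms by (simp_all add: X_def powr_powr)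
  have "c * x powr r \<le> e * x powr s + c * X powr r" if x: "x \<ge> 0" for x
  proof (cases "x \<le> X")
    case True
    hence "x powr r \<le> X powr r" using assms x by (intro powr_mono2) auto
    hence "c * x powr r \<le> c * X powr r" using assms by simp
    moreover have "e * x powr s \<ge> 0" using assms by simp
    ultimately show ?thesis by linarith
  next
    case False
    hence "X powr (s - r) \<le> x powr (s - r)" using X assms by (intro powr_mono2) auto
    hence "c \<le> e * x powr (s - r)" unfolding X(1) using assms by (simp add: field_simps)
    hence "c * x powr r \<le> e * x powr (s - r) * x powr r" by (intro mult_right_mono) auto
    also have "\<dots> = e * x powr s" by (simp add: mult.assoc flip: powr_add)
    finally show ?thesis using assms by (simp add: add_increasing2)
  qed
  thus thesis using that[of "c * X powr r"] assms by simp
qed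

section \<open>From Minty's inequality to the variational inequality\<close>

context mfg_problem
begin

text \<open>Minty's inequality is tested at \<open>z + t k *\<^sub>R d\<close>, a point of positive
  mass on the segment towards \<open>w\<close>. Dividing by \<open>t k\<close> leaves the pairing at
  that point in the fixed direction \<open>d\<close>, and dominated convergence moves the base point
  to \<open>z\<close>; continuity of \<open>hval\<close> and \<open>hflux\<close> down to mass zero
  is essential here.\<close>

lemma minty_imp_variational:
  assumes z: "z \<in> admissible R" and minty: "\<And>w. w \<in> admissible R \<Longrightarrow> AE x in torus. mass w x > 0 \<Longrightarrow> pairing w (\<lambda>x. w x - z x) \<ge> 0"
    and w: "w \<in> admissible R" "AE x in torus. mass w x > 0"
  shows "pairing z (\<lambda>x. w x - z x) \<ge> 0"
proof -
  note Z = admissibleD[OF z] and W = admissibleD[OF w(1)]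
  define d where "d x = w x - z x" for x
  define t where "t k = 1 / real (Suc k)" for k
  have t: "0 < t k" "t k \<le> 1" for k by (simp_all add: t_def)
  have tlim: "t \<longlonglongrightarrow> 0" unfolding t_def using LIMSEQ_inverse_real_of_nat by (simp add: inverse_eq_divide)
  define y where "y k x = (1 - t k) *\<^sub>R z x + t k *\<^sub>R w x" for k x
  have yd: "y k x = z x + t k *\<^sub>R d x" for k x by (simp add: y_def d_def algebra_simps)
  have d: "state d" unfolding d_def by (rule state_diff[OF W(1) Z(1)])
  have y: "y k \<in> admissible R" for k unfolding y_def using t[of k] by (intro admissible_convex z w) auto
  note Y = admissibleD[OF y]
  have ypos: "AE x in torus. mass (y k) x > 0" for k
    using Z(2) w(2) by eventually_elim (use t[of k] in \<open>simp add: y_def add_nonneg_pos\<close>)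
  have nn: "pairing (y k) d \<ge> 0" for k
  proof -
    have "(\<lambda>x. y k x - z x) = (\<lambda>x. t k *\<^sub>R d x + 0 *\<^sub>R d x)" by (simp add: yd)
    hence "t k * pairing (y k) d \<ge> 0"
      using minty[OF y ypos, of k] pairing_linear[OF Y(1,2) d d, of k "t k" 0] by simp
    thus ?thesis using t[of k] by (simp add: zero_le_mult_iff)
  qed
  have "(\<lambda>k. pairing (y k) d) \<longlonglongrightarrow> pairing z d"
    unfolding pairing_def
  proof (rule integral_dominated_convergence[where w = "dom z d"])
    show "form z d \<in> borel_measurable torus" by (rule form_measurable[OF Z(1,2) d])
    show "form (y k) d \<in> borel_measurable torus" for k by (rule form_measurable[OF Y(1,2) d])
    show "integrable torus (dom z d)" by (rule integrable_dom[OF Z(1) d])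
    show "AE x in torus. (\<lambda>k. form (y k) d x) \<longlonglongrightarrow> form z d x"
      using ham Z(2) w(2)
    proof eventually_elim
      fix x assume x: "monotone_hamiltonian (H x) \<alpha> \<beta> C" "0 \<le> mass z x" "0 < mass w x"
      have pos: "mass (y k) x > 0" for k using t[of k] x by (simp add: y_def add_nonneg_pos)
      have "(\<lambda>k. z x + t k *\<^sub>R d x) \<longlonglongrightarrow> z x + 0 *\<^sub>R d x" by (intro tendsto_intros tlim)
      hence ylim: "(\<lambda>k. y k x) \<longlonglongrightarrow> z x" by (simp add: yd)
      have m: "(\<lambda>k. mass (y k) x) \<longlonglongrightarrow> mass z x" and u: "(\<lambda>k. val (y k) x) \<longlonglongrightarrow> val z x"
        and g: "(\<lambda>k. slope (y k) x) \<longlonglongrightarrow> slope z x" by (intro tendsto_intros ylim)+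
      have h: "(\<lambda>k. hval (H x) (slope (y k) x) (mass (y k) x)) \<longlonglongrightarrow> hval (H x) (slope z x) (mass z x)"
        using monotone_hamiltonian.hval_sequence(1)[OF x(1) g m pos] pos unfolding hval_def by simp
      have f: "(\<lambda>k. hflux (H x) (slope (y k) x) (mass (y k) x)) \<longlonglongrightarrow> hflux (H x) (slope z x) (mass z x)"
        using monotone_hamiltonian.hval_sequence(2)[OF x(1) g m pos] pos unfolding hflux_def by simp
      show "(\<lambda>k. form (y k) d x) \<longlonglongrightarrow> form z d x" unfolding form_def by (intro tendsto_intros m u g h f)
    qed
    show "AE x in torus. norm (form (y k) d x) \<le> dom z d x" for k
      using ham Z(2) ypos[of k]
    proof eventually_elim
      fix x assume x: "monotone_hamiltonian (H x) \<alpha> \<beta> C" "0 \<le> mass z x" "0 < mass (y k) x"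
      have s: "\<bar>a + t k * b\<bar> \<le> \<bar>a\<bar> + \<bar>b\<bar>" for a b :: real
        using abs_triangle_ineq[of a "t k * b"] t[of k] mult_right_mono[of "t k" 1 "\<bar>b\<bar>"] by (simp add: abs_mult)
      have s': "norm (a + t k *\<^sub>R b) \<le> norm a + norm b" for a b :: "real^'n"
        using norm_triangle_ineq[of a "t k *\<^sub>R b"] t[of k] mult_right_mono[of "t k" 1 "norm b"] by simp
      have "\<bar>form (y k) d x\<bar> \<le> dom z d x"
        by (rule form_le_dom[OF x(1)]) (use x s[of "mass z x" "mass d x"] s s' in \<open>auto simp: yd\<close>)
      thus "norm (form (y k) d x) \<le> dom z d x" by simp
    qed
  qed
  hence "pairing z d \<ge> 0" by (rule LIMSEQ_le_const) (use nn in blast)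
  thus ?thesis unfolding d_def .
qed

text \<open>A test state whose mass vanishes somewhere is mixed with a small multiple of
  \<open>(1, 0, 0)\<close>. The inequality is affine in the test state, so the multiple can be sent
  to zero.\<close>

lemma variational_solution:
  assumes R: "R \<ge> 1"
  obtains z where "z \<in> admissible R" "\<And>w. w \<in> admissible R \<Longrightarrow> pairing z (\<lambda>x. w x - z x) \<ge> 0"
proof -
  obtain z where z: "z \<in> admissible R"
    "\<And>w. w \<in> admissible R \<Longrightarrow> AE x in torus. mass w x > 0 \<Longrightarrow> pairing w (\<lambda>x. w x - z x) \<ge> 0"
    using minty_solution[OF R] by blast
  note Z = admissibleD[OF z(1)]
  have "pairing z (\<lambda>x. w x - z x) \<ge> 0" if w: "w \<in> admissible R" for w
  proof -
    define e0 where "e0 = (\<lambda>x :: real^'n. (1 :: real, 0 :: real, 0 :: real^'n))"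
    have e0: "e0 \<in> admissible R" unfolding e0_def by (rule admissible_const[OF R])
    note W = admissibleD[OF w] and E = admissibleD[OF e0]
    define t where "t k = 1 / real (Suc k)" for k
    have t: "0 < t k" "t k \<le> 1" for k by (simp_all add: t_def)
    have tlim: "t \<longlonglongrightarrow> 0" unfolding t_def using LIMSEQ_inverse_real_of_nat by (simp add: inverse_eq_divide)
    have "0 \<le> (1 - t k) * pairing z (\<lambda>x. w x - z x) + t k * pairing z (\<lambda>x. e0 x - z x)" for k
    proof -
      define y where "y x = (1 - t k) *\<^sub>R w x + t k *\<^sub>R e0 x" for x
      have y: "y \<in> admissible R" unfolding y_def using t[of k] by (intro admissible_convex w e0) auto
      have "AE x in torus. mass y x > 0"
        using W(2) by eventually_elim (use t[of k] in \<open>simp add: y_def e0_def add_nonneg_pos\<close>)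
      from minty_imp_variational[OF z y this] have "pairing z (\<lambda>x. y x - z x) \<ge> 0" by blast
      moreover have "(\<lambda>x. y x - z x) = (\<lambda>x. (1 - t k) *\<^sub>R (w x - z x) + t k *\<^sub>R (e0 x - z x))"
        by (simp add: y_def algebra_simps)
      ultimately show ?thesis
        using pairing_linear[OF Z(1,2) state_diff[OF W(1) Z(1)] state_diff[OF E(1) Z(1)], of "1 - t k" "t k"] by simp
    qed
    moreover have "(\<lambda>k. (1 - t k) * pairing z (\<lambda>x. w x - z x) + t k * pairing z (\<lambda>x. e0 x - z x))
        \<longlonglongrightarrow> (1 - 0) * pairing z (\<lambda>x. w x - z x) + 0 * pairing z (\<lambda>x. e0 x - z x)"
      by (intro tendsto_intros tlim)
    ultimately have "0 \<le> (1 - 0) * pairing z (\<lambda>x. w x - z x) + 0 * pairing z (\<lambda>x. e0 x - z x)"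
      by (intro LIMSEQ_le_const) blast+
    thus ?thesis by simp
  qed
  thus thesis using that z(1) by blast
qed

text \<open>
  Where a norm constraint is inactive at the solution, the test function may violate it: only a
  short step towards the test function is needed.
\<close>

lemma variational_relaxed:
  assumes z: "z \<in> admissible R" and vi: "\<And>w. w \<in> admissible R \<Longrightarrow> pairing z (\<lambda>x. w x - z x) \<ge> 0"
    and y: "y \<in> admissible R'"
    and m: "Lp_mod torus (\<beta> + 1) (mass z) < R \<or> Lp_mod torus (\<beta> + 1) (mass y) \<le> R"
    and u: "Lp_mod torus \<gamma> (val z) < R \<or> Lp_mod torus \<gamma> (val y) \<le> R"
    and g: "Lp_mod torus \<gamma> (slope z) < R \<or> Lp_mod torus \<gamma> (slope y) \<le> R"
  shows "pairing z (\<lambda>x. y x - z x) \<ge> 0"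
proof -
  note Z = admissibleD[OF z] and Y = admissibleD[OF y]
  have small: "\<exists>s>0. \<forall>t. 0 \<le> t \<longrightarrow> t \<le> s \<longrightarrow> t \<le> 1 \<longrightarrow> (1 - t) * a + t * b \<le> R" if "a \<le> R" "0 \<le> a" "0 \<le> b" "a < R \<or> b \<le> R" for a b :: real
  proof (cases "b \<le> R")
    case True
    thus ?thesis using that convex_bound_le[of a R b] by (intro exI[of _ 1]) auto
  next
    case False
    hence a: "a < R" using that by blast
    \<comment> \<open>For \<open>t \<le> s\<close> the increase \<open>t * b\<close> is at most the
      available room \<open>R - a\<close>; the \<open>+ 1\<close> keeps the denominator
      positive.\<close>
    define s where "s = (R - a) / (b + 1)"
    have "(1 - t) * a + t * b \<le> R" if "0 \<le> t" "t \<le> s" for t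
    proof -
      have "t * b \<le> s * (b + 1)" using that \<open>0 \<le> b\<close> by (intro mult_mono) auto
      also have "\<dots> = R - a" using \<open>0 \<le> b\<close> by (simp add: s_def)
      finally have "a + t * b \<le> R" by simp
      moreover have "t * a \<ge> 0" using that \<open>0 \<le> a\<close> by simp
      ultimately show ?thesis by (simp add: algebra_simps)
    qed
    moreover have "s > 0" using a that by (simp add: s_def)
    ultimately show ?thesis by blast
  qed
  obtain s1 where s1: "s1 > 0" "\<And>t. 0 \<le> t \<Longrightarrow> t \<le> s1 \<Longrightarrow> t \<le> 1 \<Longrightarrow> (1 - t) * Lp_mod torus (\<beta> + 1) (mass z) + t * Lp_mod torus (\<beta> + 1) (mass y) \<le> R"
    using small[OF Z(4) Lp_mod_nonneg Lp_mod_nonneg m] by blast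
  obtain s2 where s2: "s2 > 0" "\<And>t. 0 \<le> t \<Longrightarrow> t \<le> s2 \<Longrightarrow> t \<le> 1 \<Longrightarrow> (1 - t) * Lp_mod torus \<gamma> (val z) + t * Lp_mod torus \<gamma> (val y) \<le> R"
    using small[OF Z(5) Lp_mod_nonneg Lp_mod_nonneg u] by blast
  obtain s3 where s3: "s3 > 0" "\<And>t. 0 \<le> t \<Longrightarrow> t \<le> s3 \<Longrightarrow> t \<le> 1 \<Longrightarrow> (1 - t) * Lp_mod torus \<gamma> (slope z) + t * Lp_mod torus \<gamma> (slope y) \<le> R"
    using small[OF Z(6) Lp_mod_nonneg Lp_mod_nonneg g] by blast
  define t where "t = min 1 (min s1 (min s2 s3))"
  have t: "0 < t" "0 \<le> t" "t \<le> 1" "t \<le> s1" "t \<le> s2" "t \<le> s3" using s1(1) s2(1) s3(1) by (simp_all add: t_def)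
  have e: "\<beta> + 1 \<ge> 1" "\<gamma> \<ge> 1" using exponents by linarith+
  note c1 = Lp_mod_convex[OF stateD(1)[OF Z(1)] stateD(1)[OF Y(1)] e(1) t(2,3)]
    and c2 = Lp_mod_convex[OF stateD(2)[OF Z(1)] stateD(2)[OF Y(1)] e(2) t(2,3)]
    and c3 = Lp_mod_convex[OF stateD(3)[OF Z(1)] stateD(3)[OF Y(1)] e(2) t(2,3)]
  define w where "w x = (1 - t) *\<^sub>R z x + t *\<^sub>R y x" for x
  have "AE x in torus. 0 \<le> (1 - t) * mass z x + t * mass y x"
    using Z(2) Y(2) by eventually_elim (use t in simp)
  hence w: "w \<in> admissible R"
    using c1(1) order_trans[OF c1(2) s1(2)[OF t(2,4,3)]] order_trans[OF c2(2) s2(2)[OF t(2,5,3)]] order_trans[OF c3(2) s3(2)[OF t(2,6,3)]]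
      sobolev_linear[OF e(2) Z(3) Y(3), of "1 - t" t]
    by (simp add: admissible_def w_def)
  have "(\<lambda>x. w x - z x) = (\<lambda>x. t *\<^sub>R (y x - z x) + 0 *\<^sub>R (y x - z x))" by (simp add: w_def algebra_simps)
  hence "t * pairing z (\<lambda>x. y x - z x) \<ge> 0"
    using vi[OF w] pairing_linear[OF Z(1,2) state_diff[OF Y(1) Z(1)] state_diff[OF Y(1) Z(1)], of t 0] by simp
  thus ?thesis using t(1) by (simp add: zero_le_mult_iff)
qed

section \<open>A priori bounds\<close>

text \<open>With the test state \<open>(1, 0, 0)\<close> the terms containing \<open>val z\<close>
  cancel, and what is left is coercive in the mass by \<open>lagrangian_bound\<close>. The test
  state is admissible for every \<open>R \<ge> 1\<close>, so the bound is independent of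
  \<open>R\<close>.\<close>

lemma mass_bound:
  obtains E where "E \<ge> 0" "\<And>R z. R \<ge> 1 \<Longrightarrow> z \<in> admissible R \<Longrightarrow> (\<And>w. w \<in> admissible R \<Longrightarrow> pairing z (\<lambda>x. w x - z x) \<ge> 0) \<Longrightarrow>
    Lp_mod torus (\<beta> + 1) (mass z) \<le> E"
proof -
  define q b where "q = (\<beta> + 1) / \<beta>" and "b = \<beta> + 1"
  have q: "q > 1" "b > 1" "1/b + 1/q = 1" using \<beta> by (simp_all add: q_def b_def field_simps)
  \<comment> \<open>The coercive term equals four times \<open>\<epsilon> * m powr b\<close>. Three
    shares absorb the terms with \<open>V * m\<close>, \<open>C * m powr \<beta>\<close> and
    \<open>C * m\<close>; the fourth is the gain.\<close>
  define \<epsilon> where "\<epsilon> = 1 / (4 * C)"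
  have \<epsilon>: "\<epsilon> > 0" using C by (simp add: \<epsilon>_def)
  obtain K1 where K1: "K1 \<ge> 0" "\<And>x. x \<ge> 0 \<Longrightarrow> C * x powr \<beta> \<le> \<epsilon> * x powr b + K1"
    using powr_absorb[of \<beta> b C \<epsilon>] \<beta> C \<epsilon> by (auto simp: b_def)
  obtain K2 where K2: "K2 \<ge> 0" "\<And>x. x \<ge> 0 \<Longrightarrow> C * x powr 1 \<le> \<epsilon> * x powr b + K2"
    using powr_absorb[of 1 b C \<epsilon>] q C \<epsilon> by auto
  define d where "d = \<epsilon> powr (1 / b)"
  have d: "d > 0" "d powr b = \<epsilon>" using \<epsilon> q by (simp_all add: d_def powr_powr)
  define k where "k = (1 / d) powr q"
  define E where "E = 4 * C * ((k + 1) * Lp_mod torus q V + (1 + C + K1 + K2))"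
  have "Lp_mod torus (\<beta> + 1) (mass z) \<le> E"
    if R: "R \<ge> 1" and z: "z \<in> admissible R" and vi: "\<And>w. w \<in> admissible R \<Longrightarrow> pairing z (\<lambda>x. w x - z x) \<ge> 0" for R z
  proof -
    note Z = admissibleD[OF z]
    define e0 where "e0 = (\<lambda>x :: real^'n. (1 :: real, 0 :: real, 0 :: real^'n))"
    have e0: "e0 \<in> admissible R" unfolding e0_def by (rule admissible_const[OF R])
    have le: "AE x in torus. form z (\<lambda>x. e0 x - z x) x \<le> (k + 1) * \<bar>V x\<bar> powr q + (1 + C + K1 + K2) - \<epsilon> * \<bar>mass z x\<bar> powr b"
      using ham Z(2)
    proof eventually_elim
      fix x assume x: "monotone_hamiltonian (H x) \<alpha> \<beta> C" "0 \<le> mass z x"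
      define m p h f where "m = mass z x" and "p = slope z x" and "h = hval (H x) p m" and "f = hflux (H x) p m"
      have m: "m \<ge> 0" using x(2) by (simp add: m_def)
      have e: "form z (\<lambda>x. e0 x - z x) x = V x + V x * (- m) - h - (f \<bullet> p - m * h)"
        by (simp add: form_def e0_def m_def p_def h_def f_def algebra_simps)
      have 1: "f \<bullet> p - m * h \<ge> (1 / C) * m powr b - C * m"
        using monotone_hamiltonian.lagrangian_bound[OF x(1) m, of p] by (simp add: b_def f_def h_def)
      have "(1 / C) * norm p powr \<alpha> \<ge> 0" using C by simp
      hence 2: "h \<ge> - (C * m powr \<beta>) - C"
        using monotone_hamiltonian.hval_lower[OF x(1) m, of p] by (simp add: h_def algebra_simps)
      have "V x * (- m) \<le> \<bar>V x\<bar> * m" using m by (metis abs_ge_minus_self minus_mult_commute mult_right_mono)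
      also have "\<dots> \<le> \<epsilon> * m powr b + k * \<bar>V x\<bar> powr q"
        using young_scaled[of m "\<bar>V x\<bar>" b q d] m q d by (simp add: k_def mult.commute)
      finally have 3: "V x * (- m) \<le> \<epsilon> * m powr b + k * \<bar>V x\<bar> powr q" .
      have 4: "V x \<le> 1 + \<bar>V x\<bar> powr q" using powr_le_one_add_powr[of "\<bar>V x\<bar>" 1 q] q by simp
      have 5: "C * m powr \<beta> \<le> \<epsilon> * m powr b + K1" "C * m \<le> \<epsilon> * m powr b + K2" using K1(2)[OF m] K2(2)[OF m] m by simp_all
      have "(1 / C) * m powr b = 4 * (\<epsilon> * m powr b)" by (simp add: \<epsilon>_def)
      hence "V x + V x * (- m) - h - (f \<bullet> p - m * h) \<le> (k * \<bar>V x\<bar> powr q + \<bar>V x\<bar> powr q) + (1 + C + K1 + K2) - \<epsilon> * m powr b"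
        using 1 2 3 4 5 by linarith
      thus "form z (\<lambda>x. e0 x - z x) x \<le> (k + 1) * \<bar>V x\<bar> powr q + (1 + C + K1 + K2) - \<epsilon> * \<bar>mass z x\<bar> powr b"
        unfolding e using m by (simp add: m_def distrib_right)
    qed
    have iV: "integrable torus (\<lambda>x. \<bar>V x\<bar> powr q)" using in_LpD(2)[OF V] by (simp add: q_def)
    have im: "integrable torus (\<lambda>x. \<bar>mass z x\<bar> powr b)" using in_LpD(2)[OF stateD(1)[OF Z(1)]] by (simp add: b_def)
    have "0 \<le> pairing z (\<lambda>x. e0 x - z x)" by (rule vi[OF e0])
    also have "\<dots> \<le> (LINT x|torus. (k + 1) * \<bar>V x\<bar> powr q + (1 + C + K1 + K2) - \<epsilon> * \<bar>mass z x\<bar> powr b)"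
      unfolding pairing_def using le
      by (intro integral_mono_AE form_integrable Z state_diff admissibleD(1)[OF e0] Bochner_Integration.integrable_add
          Bochner_Integration.integrable_diff integrable_mult_right iV im torus.integrable_const)
    also have "\<dots> = (k + 1) * Lp_mod torus q V + (1 + C + K1 + K2) - \<epsilon> * Lp_mod torus b (mass z)"
      using iV im by (simp add: Lp_mod_def)
    finally have "\<epsilon> * Lp_mod torus b (mass z) \<le> (k + 1) * Lp_mod torus q V + (1 + C + K1 + K2)" by simp
    hence "4 * C * (\<epsilon> * Lp_mod torus b (mass z)) \<le> E" unfolding E_def using C by (intro mult_left_mono) auto
    moreover have "4 * C * (\<epsilon> * Lp_mod torus b (mass z)) = Lp_mod torus (\<beta> + 1) (mass z)" using C by (simp add: \<epsilon>_def b_def)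
    ultimately show ?thesis by (simp only:)
  qed
  moreover have "E \<ge> 0" unfolding E_def k_def using C K1 K2 by (intro mult_nonneg_nonneg add_nonneg_nonneg) auto
  ultimately show thesis using that by blast
qed

end

lemma integral_nonpos_AE_zero:
  fixes f :: "'a \<Rightarrow> real"
  assumes f: "integrable M f" "AE x in M. f x \<le> 0" and nn: "0 \<le> (LINT x|M. f x)"
  shows "AE x in M. f x = 0"
proof -
  have i: "integrable M (\<lambda>x. - f x)" using f(1) by simp
  have p: "AE x in M. 0 \<le> - f x" using f(2) by (rule eventually_mono) simp
  have "(LINT x|M. - f x) = 0" using integral_nonneg_AE[OF p] nn by simp
  hence "AE x in M. - f x = 0" using integral_nonneg_eq_0_iff_AE[OF i p] by blast
  thus ?thesis by (rule eventually_mono) simp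
qed

section \<open>Complementarity and bounds on the value function\<close>

context mfg_problem
begin

text \<open>The slack in the Hamilton-Jacobi inequality: its sign and its vanishing on positive mass
  together are the first condition of a strong solution.\<close>

definition residual :: "(real^'n \<Rightarrow> real \<times> real \<times> (real^'n)) \<Rightarrow> real^'n \<Rightarrow> real" where
  "residual z x = V x - val z x - hval (H x) (slope z x) (mass z x)"

lemma residual_measurable:
  assumes "state z" "AE x in torus. mass z x \<ge> 0"
  shows "residual z \<in> borel_measurable torus"
proof -
  note [measurable] = stateD[OF assms(1), THEN in_LpD(1)] in_LpD(1)[OF V]
    hval_measurable[OF meas ham stateD(3)[OF assms(1), THEN in_LpD(1)] stateD(1)[OF assms(1), THEN in_LpD(1)] assms(2)]
  show ?thesis unfolding residual_def by measurable
qed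

text \<open>Adding unit mass exactly where the residual is negative turns the pairing into the
  integral of its negative part. The new mass may exceed the bound \<open>R\<close>, which is why
  the mass constraint has to be inactive.\<close>

lemma residual_nonneg:
  assumes z: "z \<in> admissible R" and vi: "\<And>w. w \<in> admissible R \<Longrightarrow> pairing z (\<lambda>x. w x - z x) \<ge> 0"
    and inactive: "Lp_mod torus (\<beta> + 1) (mass z) < R"
  shows "AE x in torus. residual z x \<ge> 0"
proof -
  note Z = admissibleD[OF z]
  define \<eta> where "\<eta> x = (if residual z x < 0 then 1 else 0 :: real)" for x
  have \<eta>m: "\<eta> \<in> borel_measurable torus" unfolding \<eta>_def using residual_measurable[OF Z(1,2)] by measurable
  have \<eta>L: "in_Lp torus (\<beta> + 1) \<eta>"
    by (rule in_Lp_bound[OF \<eta>m torus.integrable_const[of 1]]) (auto simp: \<eta>_def)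
  have e: "\<beta> + 1 \<ge> 0" using exponents by linarith
  define y where "y x = (mass z x + \<eta> x, val z x, slope z x)" for x
  have yL: "in_Lp torus (\<beta> + 1) (\<lambda>x. mass z x + \<eta> x)" by (rule in_Lp_add(1)[OF stateD(1)[OF Z(1)] \<eta>L e])
  have "AE x in torus. 0 \<le> mass z x + \<eta> x" using Z(2) by (rule eventually_mono) (simp add: \<eta>_def)
  hence y: "y \<in> admissible (max R (Lp_mod torus (\<beta> + 1) (\<lambda>x. mass z x + \<eta> x)))"
    using yL Z(3,5,6) by (simp add: admissible_def y_def le_max_iff_disj)
  have nn: "pairing z (\<lambda>x. y x - z x) \<ge> 0"
    by (rule variational_relaxed[OF z vi y]) (use inactive Z in \<open>simp_all add: y_def\<close>)
  have f: "form z (\<lambda>x. y x - z x) = (\<lambda>x. min 0 (residual z x))"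
    by (rule ext) (simp add: form_def y_def residual_def[symmetric] \<eta>_def)
  have i: "integrable torus (\<lambda>x. min 0 (residual z x))"
    using form_integrable(1)[OF Z(1,2) state_diff[OF admissibleD(1)[OF y] Z(1)]] unfolding f .
  have "AE x in torus. min 0 (residual z x) = 0"
    by (rule integral_nonpos_AE_zero[OF i]) (use nn in \<open>simp_all add: pairing_def f\<close>)
  thus ?thesis by (rule eventually_mono) (simp add: min_def split: if_splits)
qed

lemma sobolev_zero: "sobolev \<gamma> (\<lambda>x :: real^'n. 0) (\<lambda>x. 0)"
  using admissibleD(3)[OF admissible_const[of 1]] by simp

text \<open>Removing all mass is admissible, and in this direction the pairing is minus the integral
  of \<open>mass * residual\<close>, whose integrand is already known to be nonnegative.\<close>

lemma complementarity:
  assumes z: "z \<in> admissible R" and vi: "\<And>w. w \<in> admissible R \<Longrightarrow> pairing z (\<lambda>x. w x - z x) \<ge> 0"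
    and inactive: "Lp_mod torus (\<beta> + 1) (mass z) < R"
  shows "AE x in torus. mass z x * residual z x = 0"
proof -
  note Z = admissibleD[OF z]
  have res: "AE x in torus. residual z x \<ge> 0" by (rule residual_nonneg[OF z _ inactive]) (rule vi)
  define y where "y x = (0 :: real, val z x, slope z x)" for x
  have "R \<ge> 0" using Z(4) Lp_mod_nonneg order_trans by blast
  hence y: "y \<in> admissible R" using Z(3,5,6) exponents(4) torus.in_Lp_const[of "\<beta> + 1" "0 :: real"]
    by (simp add: admissible_def y_def Lp_mod_def)
  have f: "form z (\<lambda>x. y x - z x) = (\<lambda>x. - (mass z x * residual z x))"
    by (rule ext) (simp add: form_def y_def residual_def[symmetric])
  have i: "integrable torus (\<lambda>x. - (mass z x * residual z x))"
    using form_integrable(1)[OF Z(1,2) state_diff[OF admissibleD(1)[OF y] Z(1)]] unfolding f .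
  have "AE x in torus. - (mass z x * residual z x) \<le> 0"
    using Z(2) res by eventually_elim simp
  hence "AE x in torus. - (mass z x * residual z x) = 0"
    by (rule integral_nonpos_AE_zero[OF i]) (use vi[OF y] in \<open>simp only: pairing_def f\<close>)
  thus ?thesis by (rule eventually_mono) simp
qed

text \<open>From above, the nonnegative residual and the lower bound of \<open>H\<close> limit the
  value function pointwise. From below, the test state keeps the mass and replaces the value
  function by zero; complementarity and \<open>lagrangian_bound\<close> then leave only the mean of
  \<open>val z\<close> and known quantities.\<close>

lemma mean_bound:
  assumes z: "z \<in> admissible R" and vi: "\<And>w. w \<in> admissible R \<Longrightarrow> pairing z (\<lambda>x. w x - z x) \<ge> 0"
    and inactive: "Lp_mod torus (\<beta> + 1) (mass z) < R" and E: "Lp_mod torus (\<beta> + 1) (mass z) \<le> E"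
  shows "\<bar>LINT x|torus. val z x\<bar> \<le> 1 + Lp_mod torus ((\<beta> + 1) / \<beta>) V + (1 + C) * E + 2 * C"
proof -
  note Z = admissibleD[OF z]
  have res: "AE x in torus. residual z x \<ge> 0" by (rule residual_nonneg[OF z _ inactive]) (rule vi)
  have com: "AE x in torus. mass z x * residual z x = 0" by (rule complementarity[OF z _ inactive]) (rule vi)
  define q b where "q = (\<beta> + 1) / \<beta>" and "b = \<beta> + 1"
  have q: "q > 1" "b > 1" "1/b + 1/q = 1" using \<beta> by (simp_all add: q_def b_def field_simps)
  define v where "v = Lp_mod torus q V"
  have iV: "integrable torus (\<lambda>x. \<bar>V x\<bar> powr q)" using in_LpD(2)[OF V] by (simp add: q_def)
  have im: "integrable torus (\<lambda>x. \<bar>mass z x\<bar> powr b)" using in_LpD(2)[OF stateD(1)[OF Z(1)]] by (simp add: b_def)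
  have iu: "integrable torus (val z)" using torus.in_Lp_integrable[OF stateD(2)[OF Z(1)]] exponents by simp
  have vL: "(LINT x|torus. \<bar>V x\<bar> powr q) = v" by (simp add: v_def Lp_mod_def)
  have mE: "(LINT x|torus. \<bar>mass z x\<bar> powr b) \<le> E" using E by (simp add: b_def Lp_mod_def)
  have CE: "(1 + C) * (LINT x|torus. \<bar>mass z x\<bar> powr b) \<le> (1 + C) * E" "C * (LINT x|torus. \<bar>mass z x\<bar> powr b) \<le> C * E"
    using mE C by (auto intro!: mult_left_mono)
  have E0: "E \<ge> 0" using order_trans[OF Lp_mod_nonneg E] .
  define y where "y x = (mass z x, 0 :: real, 0 :: real^'n)" for x
  have "R \<ge> 0" using Z(4) Lp_mod_nonneg order_trans by blast
  hence y: "y \<in> admissible R"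
    using Z(2,4) stateD(1)[OF Z(1)] sobolev_zero exponents(2) by (simp add: admissible_def y_def Lp_mod_def)
  have le: "AE x in torus. form z (\<lambda>x. y x - z x) x \<le> val z x + \<bar>V x\<bar> powr q + (1 + C) * \<bar>mass z x\<bar> powr b + C"
    using ham Z(2) com
  proof eventually_elim
    fix x assume x: "monotone_hamiltonian (H x) \<alpha> \<beta> C" "0 \<le> mass z x" "mass z x * residual z x = 0"
    define m p h f where "m = mass z x" and "p = slope z x" and "h = hval (H x) p m" and "f = hflux (H x) p m"
    have m: "m \<ge> 0" using x(2) by (simp add: m_def)
    \<comment> \<open>Complementarity trades the product of mass and value, over which there is no
      control yet, for terms in \<open>V\<close> and \<open>H\<close>.\<close>
    have "m * val z x = m * V x - m * h" using x(3) by (simp add: residual_def m_def h_def p_def algebra_simps)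
    hence e: "form z (\<lambda>x. y x - z x) x = val z x - V x * m - (f \<bullet> p - m * h)"
      by (simp add: form_def y_def flip: m_def p_def h_def f_def) (simp add: algebra_simps)
    have 1: "f \<bullet> p - m * h \<ge> (1 / C) * m powr b - C * m"
      using monotone_hamiltonian.lagrangian_bound[OF x(1) m, of p] by (simp add: b_def f_def h_def)
    have 2: "(1 / C) * m powr b \<ge> 0" using C by simp
    have "- (V x * m) \<le> \<bar>V x\<bar> * m" using m by (metis abs_ge_minus_self minus_mult_commute minus_mult_left mult_right_mono)
    also have "\<dots> \<le> m powr b + \<bar>V x\<bar> powr q" using young_crude[of m "\<bar>V x\<bar>" b q] m q by (simp add: mult.commute)
    finally have 3: "- (V x * m) \<le> m powr b + \<bar>V x\<bar> powr q" .
    have "m \<le> 1 + m powr b" using powr_le_one_add_powr[of m 1 b] m q by simp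
    hence "C * m \<le> C * (1 + m powr b)" using C by (intro mult_left_mono) auto
    hence "C * m \<le> C + C * m powr b" by (simp add: algebra_simps)
    hence "val z x - V x * m - (f \<bullet> p - m * h) \<le> val z x + \<bar>V x\<bar> powr q + (m powr b + C * m powr b) + C" using 1 2 3 by linarith
    thus "form z (\<lambda>x. y x - z x) x \<le> val z x + \<bar>V x\<bar> powr q + (1 + C) * \<bar>mass z x\<bar> powr b + C"
      unfolding e using m by (simp add: distrib_right flip: m_def)
  qed
  have "0 \<le> pairing z (\<lambda>x. y x - z x)" by (rule vi[OF y])
  also have "\<dots> \<le> (LINT x|torus. val z x + \<bar>V x\<bar> powr q + (1 + C) * \<bar>mass z x\<bar> powr b + C)"
    unfolding pairing_def using le
    by (intro integral_mono_AE form_integrable Z state_diff admissibleD(1)[OF y] Bochner_Integration.integrable_add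
          integrable_mult_right iV im iu torus.integrable_const)
  also have "\<dots> = (LINT x|torus. val z x) + v + (1 + C) * (LINT x|torus. \<bar>mass z x\<bar> powr b) + C"
    using iV im iu vL by simp
  finally have lower: "- (LINT x|torus. val z x) \<le> v + (1 + C) * E + C" using CE(1) by linarith
  have up: "AE x in torus. val z x \<le> \<bar>V x\<bar> powr q + C * \<bar>mass z x\<bar> powr b + (1 + 2 * C)"
    using ham Z(2) res
  proof eventually_elim
    fix x assume x: "monotone_hamiltonian (H x) \<alpha> \<beta> C" "0 \<le> mass z x" "0 \<le> residual z x"
    define m where "m = mass z x"
    have m: "m \<ge> 0" using x(2) by (simp add: m_def)
    have "(1 / C) * norm (slope z x) powr \<alpha> \<ge> 0" using C by simp
    hence 1: "hval (H x) (slope z x) m \<ge> - (C * m powr \<beta>) - C"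
      using monotone_hamiltonian.hval_lower[OF x(1) m, of "slope z x"] by (simp add: algebra_simps)
    have "m powr \<beta> \<le> 1 + m powr b" using powr_le_one_add_powr[of m \<beta> b] m \<beta> by (simp add: b_def)
    hence "C * m powr \<beta> \<le> C * (1 + m powr b)" using C by (intro mult_left_mono) auto
    hence 2: "C * m powr \<beta> \<le> C + C * m powr b" by (simp add: algebra_simps)
    have 3: "V x \<le> 1 + \<bar>V x\<bar> powr q" using powr_le_one_add_powr[of "\<bar>V x\<bar>" 1 q] q by simp
    have "val z x \<le> V x - hval (H x) (slope z x) m" using x(3) by (simp add: residual_def m_def)
    hence "val z x \<le> \<bar>V x\<bar> powr q + C * m powr b + (1 + 2 * C)" using 1 2 3 by linarith
    thus "val z x \<le> \<bar>V x\<bar> powr q + C * \<bar>mass z x\<bar> powr b + (1 + 2 * C)" using m by (simp flip: m_def)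
  qed
  have "(LINT x|torus. val z x) \<le> (LINT x|torus. \<bar>V x\<bar> powr q + C * \<bar>mass z x\<bar> powr b + (1 + 2 * C))"
    using up by (intro integral_mono_AE Bochner_Integration.integrable_add integrable_mult_right iV im iu torus.integrable_const)
  also have "\<dots> = v + C * (LINT x|torus. \<bar>mass z x\<bar> powr b) + (1 + 2 * C)" using iV im vL by simp
  finally have upper: "(LINT x|torus. val z x) \<le> v + C * E + (1 + 2 * C)" using CE(2) by linarith
  have "v + (1 + C) * E + C \<le> 1 + v + (1 + C) * E + 2 * C" "v + C * E + (1 + 2 * C) \<le> 1 + v + (1 + C) * E + 2 * C"
    using C E0 by (simp_all add: distrib_right)
  thus ?thesis using lower upper unfolding v_def q_def by linarith
qed

text \<open>The nonnegative residual and the lower growth of \<open>H\<close> bound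
  \<open>norm (slope z x) powr \<alpha>\<close> by the potential, the mass and the oscillation
  \<open>w\<close> of the value function. After raising to the power \<open>q\<close> the
  oscillation appears with exponent \<open>q\<close>, which is below \<open>\<gamma>\<close> because
  \<open>\<alpha> > 1\<close>; Poincare's inequality then lets the left side absorb it.\<close>

lemma slope_bound:
  assumes E: "E \<ge> 0"
  obtains F where "F \<ge> 0" "\<And>R z. z \<in> admissible R \<Longrightarrow> (\<And>w. w \<in> admissible R \<Longrightarrow> pairing z (\<lambda>x. w x - z x) \<ge> 0) \<Longrightarrow>
    Lp_mod torus (\<beta> + 1) (mass z) < R \<Longrightarrow> Lp_mod torus (\<beta> + 1) (mass z) \<le> E \<Longrightarrow>
    Lp_mod torus \<gamma> (val z) \<le> F \<and> Lp_mod torus \<gamma> (slope z) \<le> F"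
proof -
  define q b where "q = (\<beta> + 1) / \<beta>" and "b = \<beta> + 1"
  have q: "q > 1" "b > 1" "\<beta> * q = b" using \<beta> by (simp_all add: q_def b_def field_simps)
  have \<gamma>q: "\<gamma> = \<alpha> * q" by (simp add: q_def)
  have "1 * q < \<alpha> * q" using \<alpha> q by (intro mult_strict_right_mono) auto
  hence \<gamma>: "\<gamma> > q" "\<gamma> \<ge> 1" "\<gamma> \<ge> 0" using exponents(2) unfolding \<gamma>q by linarith+
  \<comment> \<open>Here \<open>c0\<close> is the bound of \<open>mean_bound\<close>,
    \<open>L\<close> collects two uses of \<open>powr_add_le\<close>, and \<open>\<kappa>\<close> is
    the constant of \<open>sobolev_poincare\<close>.\<close>
  define v c0 L \<kappa> where "v = Lp_mod torus q V" and "c0 = 1 + v + (1 + C) * E + 2 * C"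
    and "L = C powr q * (2 powr q * 2 powr q)" and "\<kappa> = 2 powr \<gamma> * (norm (1 :: real^'n) powr \<gamma> * 2 powr \<gamma>)"
  \<comment> \<open>Chosen so that \<open>L * \<epsilon> * \<kappa> \<le> 1 / 2\<close>: half of the
    gradient norm remains on the left.\<close>
  define \<epsilon> where "\<epsilon> = 1 / (2 * L * (\<kappa> + 1))"
  have pos: "v \<ge> 0" "c0 \<ge> 0" "L > 0" "\<kappa> \<ge> 0" using C E by (simp_all add: v_def c0_def L_def \<kappa>_def)
  hence \<epsilon>: "\<epsilon> > 0" by (simp add: \<epsilon>_def)
  obtain K where K: "K \<ge> 0" "\<And>x. x \<ge> 0 \<Longrightarrow> x powr q \<le> \<epsilon> * x powr \<gamma> + K"
    using powr_absorb[of q \<gamma> 1 \<epsilon>] q \<gamma> \<epsilon> by auto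
  define k where "k = K + (c0 + C) powr q"
  define F1 where "F1 = 2 * (L * (v + k + C powr q * E))"
  define F2 where "F2 = 2 powr \<gamma> * (\<kappa> * F1 + c0 powr \<gamma>)"
  have F: "F1 \<ge> 0" "F2 \<ge> 0" using pos K(1) E by (simp_all add: F1_def F2_def k_def)
  have "Lp_mod torus \<gamma> (val z) \<le> F1 + F2 \<and> Lp_mod torus \<gamma> (slope z) \<le> F1 + F2"
    if z: "z \<in> admissible R" and vi: "\<And>w. w \<in> admissible R \<Longrightarrow> pairing z (\<lambda>x. w x - z x) \<ge> 0"
      and inactive: "Lp_mod torus (\<beta> + 1) (mass z) < R" and mE: "Lp_mod torus (\<beta> + 1) (mass z) \<le> E" for R z
  proof -
    note Z = admissibleD[OF z] and s = stateD[OF admissibleD(1)[OF z]]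
    have res: "AE x in torus. residual z x \<ge> 0" by (rule residual_nonneg[OF z _ inactive]) (rule vi)
    define u0 where "u0 = (LINT x|torus. val z x)"
    define w where "w x = val z x - u0" for x
    have u0: "\<bar>u0\<bar> \<le> c0" unfolding u0_def c0_def v_def q_def by (rule mean_bound[OF z _ inactive mE]) (rule vi)
    have wL: "in_Lp torus \<gamma> w" unfolding w_def by (rule in_Lp_diff(1)[OF s(2) torus.in_Lp_const \<gamma>(3)])
    have poinc: "Lp_mod torus \<gamma> w \<le> \<kappa> * Lp_mod torus \<gamma> (slope z)"
      using sobolev_poincare[OF \<gamma>(2) Z(3)] unfolding w_def u0_def \<kappa>_def by (simp only: mult.assoc)
    have le: "AE x in torus. norm (slope z x) powr \<gamma> \<le> L * (\<bar>V x\<bar> powr q + \<epsilon> * \<bar>w x\<bar> powr \<gamma> + k + C powr q * \<bar>mass z x\<bar> powr b)"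
      using ham Z(2) res
    proof eventually_elim
      fix x assume x: "monotone_hamiltonian (H x) \<alpha> \<beta> C" "0 \<le> mass z x" "0 \<le> residual z x"
      define m p where "m = mass z x" and "p = slope z x"
      have m: "m \<ge> 0" using x(2) by (simp add: m_def)
      define A B where "A = \<bar>V x\<bar> + \<bar>w x\<bar>" and "B = (c0 + C) + C * m powr \<beta>"
      have AB: "A \<ge> 0" "B \<ge> 0" "q \<ge> 0" using pos C q by (simp_all add: A_def B_def)
      have "(1 / C) * norm p powr \<alpha> \<le> hval (H x) p m + C * (m powr \<beta> + 1)"
        using monotone_hamiltonian.hval_lower[OF x(1) m, of p] by simp
      also have "hval (H x) p m \<le> V x - val z x" using x(3) by (simp add: residual_def m_def p_def)
      \<comment> \<open>The value function is its mean plus \<open>w\<close>, and the mean is at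
        most \<open>c0\<close> in absolute value.\<close>
      also have "V x - val z x \<le> A + c0" using u0 by (simp add: A_def w_def)
      finally have "(1 / C) * norm p powr \<alpha> \<le> A + B" by (simp add: B_def algebra_simps)
      hence "norm p powr \<alpha> \<le> C * (A + B)" using C by (simp add: field_simps)
      hence "(norm p powr \<alpha>) powr q \<le> (C * (A + B)) powr q" using q by (intro powr_mono2) auto
      hence "norm p powr \<gamma> \<le> C powr q * (A + B) powr q" unfolding \<gamma>q using C AB by (simp add: powr_powr powr_mult)
      also have "\<dots> \<le> C powr q * (2 powr q * (A powr q + B powr q))"
        by (intro mult_left_mono powr_add_le AB) auto
      also have "\<dots> \<le> C powr q * (2 powr q * (2 powr q * (\<bar>V x\<bar> powr q + \<bar>w x\<bar> powr q) + 2 powr q * ((c0 + C) powr q + (C * m powr \<beta>) powr q)))"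
        unfolding A_def B_def using pos C AB by (intro mult_left_mono add_mono powr_add_le) auto
      also have "\<dots> = L * (\<bar>V x\<bar> powr q + \<bar>w x\<bar> powr q + (c0 + C) powr q + (C * m powr \<beta>) powr q)"
        unfolding L_def by (simp only: distrib_left mult.assoc add.assoc)
      also have "(C * m powr \<beta>) powr q = C powr q * m powr b" using C q(3) by (simp add: powr_mult powr_powr)
      also have "L * (\<bar>V x\<bar> powr q + \<bar>w x\<bar> powr q + (c0 + C) powr q + C powr q * m powr b)
        \<le> L * (\<bar>V x\<bar> powr q + (\<epsilon> * \<bar>w x\<bar> powr \<gamma> + K) + (c0 + C) powr q + C powr q * m powr b)"
        using pos K(2)[of "\<bar>w x\<bar>"] by (intro mult_left_mono add_mono order_refl) auto
      also have "\<dots> = L * (\<bar>V x\<bar> powr q + \<epsilon> * \<bar>w x\<bar> powr \<gamma> + k + C powr q * \<bar>mass z x\<bar> powr b)"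
        using m by (simp add: k_def flip: m_def)
      finally show "norm (slope z x) powr \<gamma> \<le> L * (\<bar>V x\<bar> powr q + \<epsilon> * \<bar>w x\<bar> powr \<gamma> + k + C powr q * \<bar>mass z x\<bar> powr b)"
        unfolding p_def .
    qed
    have iV: "integrable torus (\<lambda>x. \<bar>V x\<bar> powr q)" using in_LpD(2)[OF V] by (simp add: q_def)
    have im: "integrable torus (\<lambda>x. \<bar>mass z x\<bar> powr b)" using in_LpD(2)[OF s(1)] by (simp add: b_def)
    have iw: "integrable torus (\<lambda>x. \<bar>w x\<bar> powr \<gamma>)" using in_LpD(2)[OF wL] by simp
    define G where "G = Lp_mod torus \<gamma> (slope z)"
    have "G \<le> (LINT x|torus. L * (\<bar>V x\<bar> powr q + \<epsilon> * \<bar>w x\<bar> powr \<gamma> + k + C powr q * \<bar>mass z x\<bar> powr b))"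
      unfolding G_def Lp_mod_def using le
      by (intro integral_mono_AE in_LpD(2)[OF s(3)] integrable_mult_right Bochner_Integration.integrable_add iV im iw torus.integrable_const)
    also have "\<dots> = L * (v + \<epsilon> * Lp_mod torus \<gamma> w + k + C powr q * Lp_mod torus b (mass z))"
      using iV im iw by (simp add: Lp_mod_def v_def)
    also have "\<dots> \<le> L * (v + \<epsilon> * (\<kappa> * G) + k + C powr q * E)"
      using pos \<epsilon> poinc mE by (intro mult_left_mono add_mono order_refl) (auto simp: G_def b_def)
    also have "\<dots> = F1 / 2 + (L * \<epsilon> * \<kappa>) * G" by (simp add: F1_def algebra_simps)
    also have "\<dots> \<le> F1 / 2 + (1 / 2) * G"
    proof -
      have "L * \<epsilon> * \<kappa> = \<kappa> / (2 * (\<kappa> + 1))" using pos by (simp add: \<epsilon>_def)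
      also have "\<dots> \<le> 1 / 2" using pos by (simp add: field_simps)
      finally show ?thesis by (intro add_left_mono mult_right_mono) (simp_all add: G_def)
    qed
    finally have G: "G \<le> F1" by simp
    have "Lp_mod torus \<gamma> (\<lambda>x. w x + u0) \<le> 2 powr \<gamma> * (Lp_mod torus \<gamma> w + Lp_mod torus \<gamma> (\<lambda>x :: real^'n. u0))"
      by (rule in_Lp_add(2)[OF wL torus.in_Lp_const \<gamma>(3)])
    also have "Lp_mod torus \<gamma> (\<lambda>x :: real^'n. u0) = \<bar>u0\<bar> powr \<gamma>" by (simp add: Lp_mod_def)
    also have "2 powr \<gamma> * (Lp_mod torus \<gamma> w + \<bar>u0\<bar> powr \<gamma>) \<le> 2 powr \<gamma> * (\<kappa> * F1 + c0 powr \<gamma>)"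
      using order_trans[OF poinc mult_left_mono[OF G[unfolded G_def] pos(4)]] u0 \<gamma>(3)
      by (intro mult_left_mono add_mono powr_mono2) auto
    finally have "Lp_mod torus \<gamma> (val z) \<le> F2" by (simp add: w_def F2_def)
    thus ?thesis using F G by (simp add: G_def)
  qed
  thus thesis using that[of "F1 + F2"] F by simp
qed

text \<open>A state may carry any slope, so the constant directions \<open>(0, 0, axis i 1)\<close>
  are allowed; the form in such a direction is a component of the flux, already known to be
  integrable.\<close>

lemma hflux_in_Lp:
  assumes z: "state z" "AE x in torus. mass z x \<ge> 0"
  shows "in_Lp torus 1 (\<lambda>x. hflux (H x) (slope z x) (mass z x))"
proof -
  let ?f = "\<lambda>x. hflux (H x) (slope z x) (mass z x)"
  have m: "?f \<in> borel_measurable torus"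
    by (rule hval_measurable(2)[OF meas ham stateD(3)[OF z(1), THEN in_LpD(1)] stateD(1)[OF z(1), THEN in_LpD(1)] z(2)])
  have i: "integrable torus (\<lambda>x. ?f x $ i)" for i
  proof -
    have "state (\<lambda>x :: real^'n. (0, 0, axis i 1))" by (simp add: state_def torus.in_Lp_const)
    from form_integrable(1)[OF z this] show ?thesis by (simp add: form_def[abs_def] inner_axis)
  qed
  have int: "integrable torus (\<lambda>x. \<Sum>i\<in>UNIV. \<bar>?f x $ i\<bar>)"
    by (intro Bochner_Integration.integrable_sum integrable_abs i)
  show ?thesis by (rule in_Lp_bound[OF m int]) (simp add: norm_le_l1_cart)
qed

lemma solution_exists:
  obtains z where "state z" "AE x in torus. mass z x \<ge> 0" "sobolev \<gamma> (val z) (slope z)"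
    "AE x in torus. residual z x \<ge> 0" "AE x in torus. mass z x * residual z x = 0"
    "\<And>\<phi>. \<phi> \<in> Cinf_torus \<Longrightarrow> (LINT x|torus. (mass z x - 1) * \<phi> x + hflux (H x) (slope z x) (mass z x) \<bullet> grad \<phi> x) = 0"
proof -
  obtain E where E: "E \<ge> 0" "\<And>R z. R \<ge> 1 \<Longrightarrow> z \<in> admissible R \<Longrightarrow> (\<And>w. w \<in> admissible R \<Longrightarrow> pairing z (\<lambda>x. w x - z x) \<ge> 0) \<Longrightarrow>
    Lp_mod torus (\<beta> + 1) (mass z) \<le> E" using mass_bound by blast
  obtain F where F: "F \<ge> 0" "\<And>R z. z \<in> admissible R \<Longrightarrow> (\<And>w. w \<in> admissible R \<Longrightarrow> pairing z (\<lambda>x. w x - z x) \<ge> 0) \<Longrightarrow>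
    Lp_mod torus (\<beta> + 1) (mass z) < R \<Longrightarrow> Lp_mod torus (\<beta> + 1) (mass z) \<le> E \<Longrightarrow>
    Lp_mod torus \<gamma> (val z) \<le> F \<and> Lp_mod torus \<gamma> (slope z) \<le> F" using slope_bound[OF E(1)] by blast
  \<comment> \<open>The bounds \<open>E\<close> and \<open>F\<close> were obtained before
    \<open>R\<close>, so \<open>R\<close> can be placed strictly above both and all three
    constraints are inactive.\<close>
  define R where "R = 1 + E + F"
  have R: "R \<ge> 1" "E < R" "F < R" using E(1) F(1) by (simp_all add: R_def)
  obtain z where z: "z \<in> admissible R" and vi: "\<And>w. w \<in> admissible R \<Longrightarrow> pairing z (\<lambda>x. w x - z x) \<ge> 0"
    using variational_solution[OF R(1)] by blast
  note Z = admissibleD[OF z]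
  have mE: "Lp_mod torus (\<beta> + 1) (mass z) \<le> E" by (rule E(2)[OF R(1) z vi])
  hence m: "Lp_mod torus (\<beta> + 1) (mass z) < R" using R by linarith
  have "Lp_mod torus \<gamma> (val z) \<le> F \<and> Lp_mod torus \<gamma> (slope z) \<le> F" by (rule F(2)[OF z vi m mE])
  hence ug: "Lp_mod torus \<gamma> (val z) < R" "Lp_mod torus \<gamma> (slope z) < R" using R by linarith+
  have e: "\<gamma> \<ge> 1" "\<gamma> > 0" using exponents by linarith+
  have test: "pairing z (\<lambda>x. (0, c * \<phi> x, c *\<^sub>R grad \<phi> x)) \<ge> 0" if \<phi>: "\<phi> \<in> Cinf_torus" for \<phi> c
  proof -
    define y where "y x = (mass z x, val z x + c * \<phi> x, slope z x + c *\<^sub>R grad \<phi> x)" for x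
    have "sobolev \<gamma> (\<lambda>x. val z x + c * \<phi> x) (\<lambda>x. slope z x + c *\<^sub>R grad \<phi> x)"
      using sobolev_linear[OF e(1) Z(3) sobolev_smooth[OF \<phi> e(2)], of 1 c] by simp
    hence "y \<in> admissible (max R (max (Lp_mod torus \<gamma> (val y)) (Lp_mod torus \<gamma> (slope y))))"
      using Z(2,4) stateD(1)[OF Z(1)] by (simp add: admissible_def y_def le_max_iff_disj)
    from variational_relaxed[OF z vi this] m ug have "pairing z (\<lambda>x. y x - z x) \<ge> 0" by blast
    moreover have "(\<lambda>x. y x - z x) = (\<lambda>x. (0, c * \<phi> x, c *\<^sub>R grad \<phi> x))"
    proof
      fix x show "y x - z x = (0, c * \<phi> x, c *\<^sub>R grad \<phi> x)" by (cases "z x") (simp add: y_def)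
    qed
    ultimately show ?thesis by (simp only:)
  qed
  have "(LINT x|torus. (mass z x - 1) * \<phi> x + hflux (H x) (slope z x) (mass z x) \<bullet> grad \<phi> x) = 0" if \<phi>: "\<phi> \<in> Cinf_torus" for \<phi>
  proof -
    define J where "J = (LINT x|torus. (mass z x - 1) * \<phi> x + hflux (H x) (slope z x) (mass z x) \<bullet> grad \<phi> x)"
    have "pairing z (\<lambda>x. (0, c * \<phi> x, c *\<^sub>R grad \<phi> x)) = c * J" for c
    proof -
      have "form z (\<lambda>x. (0, c * \<phi> x, c *\<^sub>R grad \<phi> x)) = (\<lambda>x. c * ((mass z x - 1) * \<phi> x + hflux (H x) (slope z x) (mass z x) \<bullet> grad \<phi> x))"
        by (rule ext) (simp add: form_def algebra_simps)
      thus ?thesis unfolding pairing_def J_def by simp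
    qed
    \<comment> \<open>The value component carries no sign constraint, so both \<open>\<phi>\<close>
      and its negative are test directions and the inequality becomes an equation.\<close>
    from test[OF \<phi>, of 1, unfolded this] test[OF \<phi>, of "-1", unfolded this] show ?thesis by (simp add: J_def)
  qed
  thus thesis using that Z(1-3) residual_nonneg[OF z vi m] complementarity[OF z vi m] by blast
qed

end

section \<open>Periodic extension\<close>

text \<open>The solution found so far is meaningful on the unit cube only. Composing with this
  retraction onto the half-open cell makes it periodic and changes it on a null set at most.\<close>

definition fold_torus :: "real^'n \<Rightarrow> real^'n" where
  "fold_torus x = (\<chi> i. frac (x $ i))"

lemma fold_torus_cell: "x \<in> unit_cell \<Longrightarrow> fold_torus x = x"
  by (simp add: fold_torus_def unit_cell_def vec_eq_iff frac_eq)

lemma fold_torus_add: "\<forall>i. z $ i \<in> \<int> \<Longrightarrow> fold_torus (x + z) = fold_torus x"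
proof -
  assume z: "\<forall>i. z $ i \<in> \<int>"
  have "frac (x $ i + z $ i) = frac (x $ i)" for i
  proof -
    obtain k where "z $ i = of_int k" using z Ints_cases by blast
    thus ?thesis by (simp add: frac_def)
  qed
  thus ?thesis by (simp add: fold_torus_def)
qed

lemma periodic_fold_torus: "periodic (\<lambda>x. f (fold_torus x))"
  by (simp add: periodic_def fold_torus_add)

lemma AE_fold_torus: "AE x in (torus :: (real^'n) measure). fold_torus x = x"
  using AE_torus_unit_cell by (rule eventually_mono) (rule fold_torus_cell)

lemma Lp_torus_AE:
  fixes f g :: "real^'n \<Rightarrow> 'b::euclidean_space"
  assumes f: "in_Lp torus p f" and g: "periodic g" and eq: "AE x in torus. g x = f x"
  shows "g \<in> Lp_torus p"
proof -
  have "AE x in torus. f x = g x" using eq by (rule eventually_mono) simp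
  hence m: "g \<in> borel_measurable torus" by (rule borel_measurable_torus_AE[OF in_LpD(1)[OF f]])
  have "in_Lp torus p g"
    by (rule in_Lp_bound[OF m in_LpD(2)[OF f]]) (use eq in \<open>auto elim!: eventually_mono\<close>)
  thus ?thesis using m g by (simp add: Lp_torus_def in_Lp_def)
qed

lemma Lim_at_right_cong:
  fixes f g :: "real \<Rightarrow> 'b::t2_space"
  assumes "\<And>s :: real. s > 0 \<Longrightarrow> f s = g s"
  shows "Lim (at_right 0) f = Lim (at_right 0) g"
proof -
  have "\<forall>\<^sub>F s in at_right 0. f s = g s" using assms by (auto simp: eventually_at_filter)
  hence "(f \<longlongrightarrow> l) (at_right 0) \<longleftrightarrow> (g \<longlongrightarrow> l) (at_right 0)" for l by (rule tendsto_cong)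
  thus ?thesis by (simp add: t2_space_class.Lim_def)
qed

text \<open>Periodicity of \<open>H\<close> is known for positive masses; at mass zero it is
  inherited because a one-sided limit sees only such masses.\<close>

lemma mDpH_ext_periodic:
  assumes "on_torus H" "\<forall>i. z $ i \<in> \<int>"
  shows "mDpH_ext H (x + z) p m = mDpH_ext H x p m"
proof -
  have "(\<lambda>q. H (x + z) q s) = (\<lambda>q. H x q s)" if "s > 0" for s
    using assms that by (auto simp: on_torus_def periodic_def)
  hence "DpH H (x + z) p s = DpH H x p s" if "s > 0" for s using that by simp
  thus ?thesis unfolding mDpH_ext_def by (simp cong: if_cong) (intro impI Lim_at_right_cong, simp)
qed

theorem theorem1p4:
  fixes H :: "real^'n \<Rightarrow> real^'n \<Rightarrow> real \<Rightarrow> real" and V :: "real^'n \<Rightarrow> real"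
    and \<alpha> \<beta> \<beta>b \<gamma>b :: real
  assumes "\<alpha> > 1" and "\<beta> > 0"
    and "on_torus H" and "monotonicity H" and "power_growth \<alpha> \<beta> H"
    and "\<beta>b = \<beta> + 1" and "\<gamma>b = \<alpha> * ((\<beta> + 1) / \<beta>)"
    and "V \<in> Lp_torus (\<beta>b / (\<beta>b - 1))"
  shows "\<exists>m \<in> Lp_torus \<beta>b. \<exists>u \<in> W1p_torus \<gamma>b. strong_solution H V m u"
proof -
  obtain C where C: "C > 0" and growth: "AE x in torus. \<forall>p. \<forall>m>0.
        H x 0 m \<le> - (1 / C) * m powr \<beta> + C \<and>
        norm (DpH H x p m) \<le> C * (norm p powr (\<alpha> - 1) + m powr (\<beta> - \<beta> / \<alpha>) + 1) \<and>
        H x p m \<ge> (1 / C) * norm p powr \<alpha> - C * (m powr \<beta> + 1)"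
    using assms(5) unfolding power_growth_def by blast
  have reg: "regularity H" using assms(4) by (simp add: monotonicity_def)
  have mono: "AE x in torus. \<forall>p1 p2. \<forall>m1>0. \<forall>m2>0.
        (- H x p1 m1 + H x p2 m2) * (m1 - m2)
        + (m1 *\<^sub>R DpH H x p1 m1 - m2 *\<^sub>R DpH H x p2 m2) \<bullet> (p1 - p2) \<ge> 0"
    using assms(4) unfolding monotonicity_def by blast
  have "AE x in torus.
        continuous_on (UNIV \<times> {0<..}) (\<lambda>(p, m). H x p m) \<and>
        (\<forall>m>0. (\<lambda>p. H x p m) differentiable_on UNIV) \<and>
        continuous_on (UNIV \<times> {0<..}) (\<lambda>(p, m). DpH H x p m)"
    using reg unfolding regularity_def by blast
  hence ham: "AE x in torus. monotone_hamiltonian (H x) \<alpha> \<beta> C"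
    using mono growth
  proof eventually_elim
    case (elim x)
    show ?case by unfold_locales (use elim assms(1,2) C in blast)+
  qed
  interpret mfg_problem H V \<alpha> \<beta> C
  proof
    show "(\<lambda>(x, p, m). H x p m) \<in> borel_measurable (lebesgue_on (UNIV \<times> UNIV \<times> {0<..}))"
      using reg by (simp add: regularity_def)
    \<comment> \<open>The conjugate of \<open>\<beta> + 1\<close> is
      \<open>(\<beta> + 1) / \<beta>\<close>.\<close>
    show "in_Lp torus ((\<beta> + 1) / \<beta>) V" using assms(6,8) by (simp add: Lp_torus_def in_Lp_def)
  qed (use assms(1,2) C ham in blast)+
  obtain z where z: "state z" "AE x in torus. mass z x \<ge> 0" "sobolev \<gamma>b (val z) (slope z)"
    "AE x in torus. residual z x \<ge> 0" "AE x in torus. mass z x * residual z x = 0"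
    "\<And>\<phi>. \<phi> \<in> Cinf_torus \<Longrightarrow> (LINT x|torus. (mass z x - 1) * \<phi> x + hflux (H x) (slope z x) (mass z x) \<bullet> grad \<phi> x) = 0"
    using solution_exists unfolding assms(7) by blast
  \<comment> \<open>Periodic representatives. The equations below are transferred from
    \<open>z\<close> almost everywhere, and the integrals through their integrands.\<close>
  define m u Du where "m x = mass z (fold_torus x)" and "u x = val z (fold_torus x)" and "Du x = slope z (fold_torus x)" for x
  have per: "periodic m" "periodic u" "periodic Du"
    unfolding m_def u_def Du_def by (rule periodic_fold_torus)+
  have eq: "AE x in torus. m x = mass z x" "AE x in torus. u x = val z x" "AE x in torus. Du x = slope z x"
    using AE_fold_torus by (auto elim!: eventually_mono simp: m_def u_def Du_def)
  have e: "\<gamma>b > 1" "\<beta>b > 1" using exponents assms(6,7) by simp_all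
  note s = stateD[OF z(1), folded assms(6,7)]
  have L: "m \<in> Lp_torus \<beta>b" "u \<in> Lp_torus \<gamma>b" "Du \<in> Lp_torus \<gamma>b"
    by (rule Lp_torus_AE[OF s(1) per(1) eq(1)] Lp_torus_AE[OF s(2) per(2) eq(2)] Lp_torus_AE[OF s(3) per(3) eq(3)])+
  note s1 = torus.in_Lp_lower[OF s(1), of 1] torus.in_Lp_lower[OF s(2), of 1] torus.in_Lp_lower[OF s(3), of 1]
  have L1: "m \<in> Lp_torus 1" "u \<in> Lp_torus 1" "Du \<in> Lp_torus 1"
    using Lp_torus_AE[OF s1(1) per(1) eq(1)] Lp_torus_AE[OF s1(2) per(2) eq(2)] Lp_torus_AE[OF s1(3) per(3) eq(3)] e by simp_all
  have bm: "m \<in> borel_measurable torus" "u \<in> borel_measurable torus" "Du \<in> borel_measurable torus"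
    using L1 by (simp_all add: Lp_torus_def)
  have bz: "mass z \<in> borel_measurable torus" "val z \<in> borel_measurable torus" "slope z \<in> borel_measurable torus"
    using s by (simp_all add: in_Lp_def)
  have nth: "(\<lambda>x. f x $ i) \<in> borel_measurable torus" if "f \<in> borel_measurable torus" for f :: "real^'n \<Rightarrow> real^'n" and i
    using borel_measurable_inner[OF that borel_measurable_const[of "axis i 1"]] by (simp add: inner_axis)
  have smooth: "\<phi> \<in> borel_measurable torus" "grad \<phi> \<in> borel_measurable torus" if "\<phi> \<in> Cinf_torus" for \<phi> :: "real^'n \<Rightarrow> real"
    using Cinf_torusD(3,4)[OF that] by (auto intro: borel_measurable_torus borel_measurable_continuous_onI)
  have wg: "weak_gradient u Du"
    unfolding weak_gradient_def
  proof (intro conjI L1 ballI allI)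
    fix \<phi> :: "real^'n \<Rightarrow> real" and i assume \<phi>: "\<phi> \<in> Cinf_torus"
    note [measurable] = smooth(1)[OF \<phi>] nth[OF smooth(2)[OF \<phi>]] bm(2) bz(2) nth[OF bm(3)] nth[OF bz(3)]
    have "(LINT x|torus. u x * (grad \<phi> x $ i)) = (LINT x|torus. val z x * (grad \<phi> x $ i))"
      by (rule integral_cong_AE) (use eq(2) in \<open>auto elim!: eventually_mono\<close>)
    also have "\<dots> = - (LINT x|torus. (slope z x $ i) * \<phi> x)" by (rule sobolev_weak_gradient[OF e(1) z(3) \<phi>])
    also have "(LINT x|torus. (slope z x $ i) * \<phi> x) = (LINT x|torus. (Du x $ i) * \<phi> x)"
      by (rule integral_cong_AE) (use eq(3) in \<open>auto elim!: eventually_mono\<close>)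
    finally show "(LINT x|torus. u x * (grad \<phi> x $ i)) = - (LINT x|torus. (Du x $ i) * \<phi> x)" .
  qed
  have flux: "AE x in torus. mDpH_ext H x (Du x) (m x) = hflux (H x) (slope z x) (mass z x)"
    using ham z(2) eq by eventually_elim (simp add: monotone_hamiltonian.mDpH_ext_eq)
  \<comment> \<open>All terms are finite, so the extended-real expression collapses to minus the
    residual; its two properties become the two Hamilton-Jacobi conditions.\<close>
  have val: "AE x in torus. ereal (u x) + H_ext H x (Du x) (m x) - ereal (V x) = ereal (- residual z x)"
    using ham z(2) eq by eventually_elim (simp add: monotone_hamiltonian.H_ext_eq residual_def)
  have per_flux: "periodic (\<lambda>x. mDpH_ext H x (Du x) (m x))"
    using per(1,3) mDpH_ext_periodic[OF assms(3)] by (simp add: periodic_def)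
  have fi: "in_Lp torus 1 (\<lambda>x. hflux (H x) (slope z x) (mass z x))"
    by (rule hflux_in_Lp[OF z(1,2)])
  note [measurable] = in_LpD(1)[OF fi]
  have fL: "(\<lambda>x. mDpH_ext H x (Du x) (m x)) \<in> Lp_torus 1" by (rule Lp_torus_AE[OF fi per_flux flux])
  hence fLm: "(\<lambda>x. mDpH_ext H x (Du x) (m x)) \<in> borel_measurable torus" by (simp add: Lp_torus_def)
  have "strong_solution H V m u"
    unfolding strong_solution_def
  proof (intro conjI exI[of _ Du] wg fL L1 ballI)
    show "u \<in> W1p_torus 1" using L1 wg by (auto simp: W1p_torus_def)
    show "AE x in torus. m x \<ge> 0" using z(2) eq(1) by eventually_elim simp
    show "AE x in torus. ereal (u x) + H_ext H x (Du x) (m x) - ereal (V x) \<le> 0"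
      using val z(4) by eventually_elim simp
    show "AE x in torus. m x > 0 \<longrightarrow> ereal (u x) + H_ext H x (Du x) (m x) - ereal (V x) = 0"
      using val z(5) eq(1) by eventually_elim auto
    fix \<phi> :: "real^'n \<Rightarrow> real" assume \<phi>: "\<phi> \<in> Cinf_torus"
    note [measurable] = smooth[OF \<phi>] bm(1) bz(1) fLm
    have "(LINT x|torus. (m x - 1) * \<phi> x + mDpH_ext H x (Du x) (m x) \<bullet> grad \<phi> x)
        = (LINT x|torus. (mass z x - 1) * \<phi> x + hflux (H x) (slope z x) (mass z x) \<bullet> grad \<phi> x)"
    proof (rule integral_cong_AE)
      show "AE x in torus. (m x - 1) * \<phi> x + mDpH_ext H x (Du x) (m x) \<bullet> grad \<phi> x
          = (mass z x - 1) * \<phi> x + hflux (H x) (slope z x) (mass z x) \<bullet> grad \<phi> x"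
        using flux eq(1) by eventually_elim simp
    qed measurable
    thus "(LINT x|torus. (m x - 1) * \<phi> x + mDpH_ext H x (Du x) (m x) \<bullet> grad \<phi> x) = 0" using z(6)[OF \<phi>] by simp
  qed
  moreover have "u \<in> W1p_torus \<gamma>b" using L wg by (auto simp: W1p_torus_def)
  ultimately show ?thesis using L(1) by blast
qed

end
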